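(* Let $Y=[0,L_1]\times\cdots\times[0,L_d]$ be a periodic unit cell, let $0<\alpha_-<\alpha_+$, let $\varepsilon_0>0$ and let $\delta^{\mathrm{target}}>0$. Then there is a Fourier Neural Operator (FNO) $$\mathcal{F}_\theta:\ \mathrm{Sym}(d)\times\mathcal{M}_Y(\alpha_-,\alpha_+)\to H^1_\#(Y)^d$$ such that the estimate $$\left\|\mathcal{F}_\theta(\bar{\varepsilon},\mathbb{C})-\mathcal{S}(\bar{\varepsilon},\mathbb{C})\right\|_{H^1_\#(Y)^d}\le\delta^{\mathrm{target}}$$ holds for all $\bar{\varepsilon}\in\mathrm{Sym}(d)$ with $\|\bar{\varepsilon}\|\le\varepsilon_0$ and all $\mathbb{C}\in\mathcal{M}_Y(\alpha_-,\alpha_+)$. Here $\mathcal{S}$ is the exact solution operator: for $\bar\varepsilon\in\mathrm{Sym}(d)$ and $\mathbb{C}\in\mathcal{M}_Y(\alpha_-,\alpha_+)$, $u=\mathcal{S}(\bar{\varepsilon},\mathbb{C})\in H^1_\#(Y)^d$ is the unique (weak) solution of the corrector equation $$\operatorname{div}\,\mathbb{C}:\left(\bar{\varepsilon}+\nabla^s u\right)=0 .$$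
   Context: Tensors. $\mathrm{Sym}(d)$ is the space of real symmetric $d\times d$ matrices with the Frobenius inner product $\langle\varepsilon_1,\varepsilon_2\rangle=\operatorname{tr}(\varepsilon_1\varepsilon_2)$ and norm $\|\cdot\|$. $\mathrm{Sym}(\mathrm{Sym}(d))$ is the space of linear maps on $\mathrm{Sym}(d)$ that are self-adjoint for this inner product; $\mathbb{C}:\varepsilon$ denotes the application of $\mathbb{C}$ to $\varepsilon$, and $\varepsilon:\sigma$ for two matrices is the Frobenius inner product. Stiffness fields. $\mathcal{M}_Y(\alpha_-,\alpha_+)$ is the set of all $\mathbb{C}\in L^\infty(Y;\mathrm{Sym}(\mathrm{Sym}(d)))$ with $\alpha_-\|\varepsilon\|^2\le\varepsilon:\mathbb{C}(x):\varepsilon\le\alpha_+\|\varepsilon\|^2$ for a.e. $x\in Y$ and all $\varepsilon\in\mathrm{Sym}(d)$. Displacements. $H^1_\#(Y)^d$ is the space of $Y$-periodic $H^1$ vector fields $u:Y\to\mathbb{R}^d$ with $\int_Y u\,dx=0$, with any fixed norm equivalent to the standard $H^1$-norm (the statement does not depend on this choice); $\nabla^s$ is the symmetrized gradient. The corrector equation is understood in the dual space $H^{-1}_\#(Y)^d$ of $H^1_\#(Y)^d$. Fourier Neural Operators. A neural network (between finite-dimensional real vector spaces) is a finite composition of affine maps and componentwise applications of an activation function $\sigma:\mathbb{R}\to\mathbb{R}$ (a continuous function, for instance the ReLU $\sigma(t)=\max(t,0)$), where the activation may be applied to only some of the components. An FNO is a map of the form $$\mathcal{F}_\theta=\mathtt{P}_\theta\circ\mathtt{L}_{\theta,L}\circ\cdots\circ\mathtt{L}_{\theta,1}\circ\mathtt{E}_\theta,\qquad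 L\in\mathbb{N}_+ ,$$ acting on vector-valued functions on $Y$, where, for some $d_v\in\mathbb{N}_+$ with $d_v \geq d_u$: - the lifting $\mathtt{E}_\theta$ acts locally by a neural network $\mathbb{R}^{d_a}\to\mathbb{R}^{d_v}$, i.e. $(\mathtt{E}_\theta a)(x)=N(a(x))$; - each layer $\mathtt{L}_{\theta,\ell}$ maps functions $Y\to\mathbb{R}^{d_v}$ (here in $L^2(Y;\mathbb{R}^{d_v})$) to functions of the same type by $\mathtt{L}_{\theta,\ell}(v)=\sigma(W_\ell v+b_\ell+K_\ell\star v)$ with a matrix $W_\ell\in\mathbb{R}^{d_v\times d_v}$, a function $b_\ell:Y\to\mathbb{R}^{d_v}$, and a periodic convolution operator $K_\ell\star$; the activation $\sigma$ is applied componentwise, and possibly to only some of the components (the others being left unchanged); - the output layer is $\mathtt{P}_\theta(v)=W_{L+1}v+b_{L+1}+K_{L+1}\star v$ with $W_{L+1}\in\mathbb{R}^{d_u\times d_v}$, a function $b_{L+1}:Y\to\mathbb{R}^{d_u}$, and a periodic convolution operator $K_{L+1}\star$. Convolution operators are Fourier multipliers: $(K\star v)(x)=\sum_{\xi\in\mathbb{Z}^d}\hat K(\xi)\hat v(\xi)e^{\mathtt{i}\,\tilde\xi\cdot x}$, where $\tilde\xi_j=2\pi\xi_j/L_j$, $\hat v(\xi)=\frac{1}{\mathrm{vol}(Y)}\int_Y v(x)e^{-\mathtt{i}\,\tilde\xi\cdot x}\,dx$, and $\hat K$ is a complex-matrix-valued function on $\mathbb{Z}^d$ with $\hat K(-\xi)=\overline{\hat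 K(\xi)}$, such that the operator is bounded between the function spaces involved. Infinitely many Fourier coefficients $\hat K(\xi)$ may be non-zero. In the theorem, the input $(\bar\varepsilon,\mathbb{C})$ is identified, via coordinates, with a function $Y\to\mathbb{R}^{d_a}$, $d_a=\dim\mathrm{Sym}(d)+\dim\mathrm{Sym}(\mathrm{Sym}(d))$, whose $\bar\varepsilon$-components are constant in $x$, and the output has $d_u=d$ components. The FNO (its depth, weights, biases and kernels) may depend on $Y,\alpha_-,\alpha_+,\varepsilon_0,\delta^{\mathrm{target}}$, but not on $(\bar\varepsilon,\mathbb{C})$. *)

theory Defs
  imports "HOL-Analysis.Analysis"
begin

section \<open>Symmetric matrices, stiffness tensors and coordinates\<close>

text \<open>The library inner product and norm on \<^typ>\<open>real^'d^'d\<close> are the Frobenius ones.\<close>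

definition sym_mats :: "(real^'d^'d) set" where
  "sym_mats = {A. transpose A = A}"

text \<open>A linear map on the symmetric matrices is represented by its extension to all matrices
  that vanishes on the orthogonal complement (the skew-symmetric matrices). This makes the
  representation unique, so that dimensions and bases below are those of the space of
  self-adjoint maps on the symmetric matrices.\<close>

definition sym_sym :: "((real^'d^'d) \<Rightarrow>\<^sub>L (real^'d^'d)) set" where
  "sym_sym = {T.
     (\<forall>A\<in>sym_mats. blinfun_apply T A \<in> sym_mats) \<and>
     (\<forall>A\<in>sym_mats. \<forall>B\<in>sym_mats. blinfun_apply T A \<bullet> B = A \<bullet> blinfun_apply T B) \<and>
     (\<forall>A. transpose A = - A \<longrightarrow> blinfun_apply T A = 0)}"

definition ordered_basis :: "'a::real_vector set \<Rightarrow> 'a list \<Rightarrow> bool" where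
  "ordered_basis V bs \<longleftrightarrow> distinct bs \<and> independent (set bs) \<and> span (set bs) = V"

lemma ordered_basis_length: "ordered_basis V bs \<Longrightarrow> length bs = dim V"
  unfolding ordered_basis_def
  by (metis distinct_card real_vector.dim_eq_card_independent real_vector.dim_span)


section \<open>Function spaces on the periodic cell\<close>

text \<open>Elements of \<open>L\<^sup>p\<close> spaces are represented by functions on \<^typ>\<open>real^'d\<close>; only their values
  on the cell matter, and functions agreeing almost everywhere there represent the same element.\<close>

definition cell :: "real^'d \<Rightarrow> (real^'d) set" where
  "cell L = cbox 0 L"

abbreviation cellM :: "real^'d \<Rightarrow> (real^'d) measure" where
  "cellM L \<equiv> lebesgue_on (cell L)"

definition stiffness_fields ::
  "real^'d \<Rightarrow> real \<Rightarrow> real \<Rightarrow> (real^'d \<Rightarrow> (real^'d^'d) \<Rightarrow>\<^sub>L (real^'d^'d)) set" where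
  "stiffness_fields L \<alpha>m \<alpha>p = {C.
     C \<in> borel_measurable (cellM L) \<and>
     (\<exists>B. AE x in cellM L. norm (C x) \<le> B) \<and>
     (\<forall>x\<in>cell L. C x \<in> sym_sym) \<and>
     (AE x in cellM L. \<forall>A\<in>sym_mats.
        \<alpha>m * (norm A)\<^sup>2 \<le> A \<bullet> blinfun_apply (C x) A \<and>
        A \<bullet> blinfun_apply (C x) A \<le> \<alpha>p * (norm A)\<^sup>2)}"

definition sq_integrable :: "real^'d \<Rightarrow> (real^'d \<Rightarrow> 'b::euclidean_space) \<Rightarrow> bool" where
  "sq_integrable L f \<longleftrightarrow>
     f \<in> borel_measurable (cellM L) \<and> integrable (cellM L) (\<lambda>x. (norm (f x))\<^sup>2)"

definition partial :: "'d \<Rightarrow> (real^'d \<Rightarrow> real) \<Rightarrow> real^'d \<Rightarrow> real" where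
  "partial j f x = frechet_derivative f (at x) (axis j 1)"

text \<open>Functions of class \<open>C\<^sup>\<infinity>\<close>: the greatest class of differentiable functions that is closed under
  partial derivatives.\<close>

coinductive smooth :: "(real^'d \<Rightarrow> real) \<Rightarrow> bool" where
  smoothI: "(\<forall>x. f differentiable (at x)) \<Longrightarrow> (\<forall>j. smooth (partial j f)) \<Longrightarrow> smooth f"

definition periodic :: "real^'d \<Rightarrow> (real^'d \<Rightarrow> 'b) \<Rightarrow> bool" where
  "periodic L f \<longleftrightarrow> (\<forall>x j. f (x + axis j (L $ j)) = f x)"

text \<open>Weak derivatives on the torus: since the test functions are smooth and periodic (and need
  not vanish on the boundary of the cell), the existence of a square integrable weak gradient
  in this sense includes the periodicity of \<open>u\<close> across opposite faces.
  The entry \<open>G x $ i $ j\<close> is the \<open>j\<close>-th partial derivative of the \<open>i\<close>-th component.\<close>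

definition weak_grad ::
  "real^'d \<Rightarrow> (real^'d \<Rightarrow> real^'m) \<Rightarrow> (real^'d \<Rightarrow> real^'d^'m) \<Rightarrow> bool" where
  "weak_grad L u G \<longleftrightarrow> sq_integrable L G \<and>
     (\<forall>\<phi> i j. smooth \<phi> \<and> periodic L \<phi> \<longrightarrow>
        (\<integral>x. u x $ i * partial j \<phi> x \<partial>cellM L) = - (\<integral>x. G x $ i $ j * \<phi> x \<partial>cellM L))"

definition H1_per :: "real^'d \<Rightarrow> (real^'d \<Rightarrow> real^'m) set" where
  "H1_per L = {u. sq_integrable L u \<and> (\<exists>G. weak_grad L u G)}"

definition H1_per0 :: "real^'d \<Rightarrow> (real^'d \<Rightarrow> real^'m) set" where
  "H1_per0 L = {u \<in> H1_per L. (\<integral>x. u x \<partial>cellM L) = 0}"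

text \<open>The choice is unique almost everywhere for \<open>u\<close> in \<open>H1_per L\<close>.\<close>

definition grad :: "real^'d \<Rightarrow> (real^'d \<Rightarrow> real^'m) \<Rightarrow> real^'d \<Rightarrow> real^'d^'m" where
  "grad L u = (SOME G. weak_grad L u G)"

definition H1_norm :: "real^'d \<Rightarrow> (real^'d \<Rightarrow> real^'m) \<Rightarrow> real" where
  "H1_norm L u =
     sqrt ((\<integral>x. (norm (u x))\<^sup>2 \<partial>cellM L) + (\<integral>x. (norm (grad L u x))\<^sup>2 \<partial>cellM L))"

definition sym_grad :: "real^'d \<Rightarrow> (real^'d \<Rightarrow> real^'d) \<Rightarrow> real^'d \<Rightarrow> real^'d^'d" where
  "sym_grad L u x = (1/2) *\<^sub>R (grad L u x + transpose (grad L u x))"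


section \<open>The corrector equation\<close>

definition corrector_solution ::
  "real^'d \<Rightarrow> real^'d^'d \<Rightarrow> (real^'d \<Rightarrow> (real^'d^'d) \<Rightarrow>\<^sub>L (real^'d^'d)) \<Rightarrow> (real^'d \<Rightarrow> real^'d) \<Rightarrow> bool"
where
  "corrector_solution L e C u \<longleftrightarrow> u \<in> H1_per0 L \<and>
     (\<forall>v\<in>H1_per0 L.
        (\<integral>x. sym_grad L v x \<bullet> blinfun_apply (C x) (e + sym_grad L u x) \<partial>cellM L) = 0)"

definition unique_corrector_solution ::
  "real^'d \<Rightarrow> real^'d^'d \<Rightarrow> (real^'d \<Rightarrow> (real^'d^'d) \<Rightarrow>\<^sub>L (real^'d^'d)) \<Rightarrow> (real^'d \<Rightarrow> real^'d) \<Rightarrow> bool"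
where
  "unique_corrector_solution L e C u \<longleftrightarrow> corrector_solution L e C u \<and>
     (\<forall>w. corrector_solution L e C w \<longrightarrow> (AE x in cellM L. w x = u x))"

definition solution_op ::
  "real^'d \<Rightarrow> real^'d^'d \<Rightarrow> (real^'d \<Rightarrow> (real^'d^'d) \<Rightarrow>\<^sub>L (real^'d^'d)) \<Rightarrow> real^'d \<Rightarrow> real^'d" where
  "solution_op L e C = (SOME u. unique_corrector_solution L e C u)"


section \<open>Fourier multipliers\<close>

definition freq :: "real^'d \<Rightarrow> int^'d \<Rightarrow> real^'d" where
  "freq L \<xi> = (\<chi> j. 2 * pi * of_int (\<xi> $ j) / L $ j)"

definition fourier_coeff :: "real^'d \<Rightarrow> (real^'d \<Rightarrow> real) \<Rightarrow> int^'d \<Rightarrow> complex" where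
  "fourier_coeff L f \<xi> =
     (\<integral>x. complex_of_real (f x) * cis (- (freq L \<xi> \<bullet> x)) \<partial>cellM L)
       / complex_of_real (measure lebesgue (cell L))"

text \<open>\<open>w\<close> is the sum of the Fourier series with coefficients \<open>c\<close>, in the sense of (unconditional)
  convergence in \<open>L\<^sup>2\<close>.\<close>

definition has_fourier_sum :: "real^'d \<Rightarrow> (int^'d \<Rightarrow> complex) \<Rightarrow> (real^'d \<Rightarrow> real) \<Rightarrow> bool" where
  "has_fourier_sum L c w \<longleftrightarrow> sq_integrable L w \<and>
     ((\<lambda>X. \<integral>x. (cmod (complex_of_real (w x) - (\<Sum>\<xi>\<in>X. c \<xi> * cis (freq L \<xi> \<bullet> x))))\<^sup>2 \<partial>cellM L)
        \<longlongrightarrow> 0) (finite_subsets_at_top UNIV)"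

definition fourier_sum :: "real^'d \<Rightarrow> (int^'d \<Rightarrow> complex) \<Rightarrow> real^'d \<Rightarrow> real" where
  "fourier_sum L c = (SOME w. has_fourier_sum L c w)"

text \<open>Since the number \<open>d\<^sub>v\<close> of channels is quantified existentially, a point of \<open>\<real>\<^sup>n\<close> is
  represented by a function \<^typ>\<open>nat \<Rightarrow> real\<close> of which only the values at indices below \<open>n\<close>
  are used, and an \<open>m\<close>-by-\<open>n\<close> matrix by a function of two indices. The row index type \<open>'i\<close> below is
  \<^typ>\<open>nat\<close> in the hidden layers and the finite type indexing the output components in the last
  layer.\<close>

definition conv_coeff ::
  "real^'d \<Rightarrow> nat \<Rightarrow> (int^'d \<Rightarrow> 'i \<Rightarrow> nat \<Rightarrow> complex) \<Rightarrow> (real^'d \<Rightarrow> nat \<Rightarrow> real) \<Rightarrow> 'i \<Rightarrow> int^'d \<Rightarrow> complex"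
where
  "conv_coeff L n K v i \<xi> = (\<Sum>j<n. K \<xi> i j * fourier_coeff L (\<lambda>x. v x j) \<xi>)"

definition conv ::
  "real^'d \<Rightarrow> nat \<Rightarrow> (int^'d \<Rightarrow> 'i \<Rightarrow> nat \<Rightarrow> complex) \<Rightarrow> (real^'d \<Rightarrow> nat \<Rightarrow> real) \<Rightarrow> real^'d \<Rightarrow> 'i \<Rightarrow> real"
where
  "conv L n K v x i = fourier_sum L (conv_coeff L n K v i) x"

definition conj_symmetric :: "(int^'d \<Rightarrow> 'i \<Rightarrow> nat \<Rightarrow> complex) \<Rightarrow> bool" where
  "conj_symmetric K \<longleftrightarrow> (\<forall>\<xi> i j. K (- \<xi>) i j = cnj (K \<xi> i j))"

definition L2_field :: "real^'d \<Rightarrow> nat \<Rightarrow> (real^'d \<Rightarrow> nat \<Rightarrow> real) \<Rightarrow> bool" where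
  "L2_field L n v \<longleftrightarrow> (\<forall>i<n. sq_integrable L (\<lambda>x. v x i))"

definition L2_norm_field :: "real^'d \<Rightarrow> nat \<Rightarrow> (real^'d \<Rightarrow> nat \<Rightarrow> real) \<Rightarrow> real" where
  "L2_norm_field L n v = sqrt (\<Sum>i<n. \<integral>x. (v x i)\<^sup>2 \<partial>cellM L)"

text \<open>Convergence of the series is part of the boundedness conditions; without it \<open>conv\<close> would be an
  arbitrary function.\<close>

definition conv_bounded_L2 ::
  "real^'d \<Rightarrow> nat \<Rightarrow> nat \<Rightarrow> (int^'d \<Rightarrow> nat \<Rightarrow> nat \<Rightarrow> complex) \<Rightarrow> bool" where
  "conv_bounded_L2 L n m K \<longleftrightarrow> (\<exists>B. \<forall>v. L2_field L n v \<longrightarrow>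
     (\<forall>i<m. has_fourier_sum L (conv_coeff L n K v i) (\<lambda>x. conv L n K v x i)) \<and>
     L2_norm_field L m (conv L n K v) \<le> B * L2_norm_field L n v)"

definition conv_bounded_H1 ::
  "real^'d \<Rightarrow> nat \<Rightarrow> (int^'d \<Rightarrow> 'm::finite \<Rightarrow> nat \<Rightarrow> complex) \<Rightarrow> bool" where
  "conv_bounded_H1 L n K \<longleftrightarrow> (\<exists>B. \<forall>v. L2_field L n v \<longrightarrow>
     (\<forall>i. has_fourier_sum L (conv_coeff L n K v i) (\<lambda>x. conv L n K v x i)) \<and>
     (\<lambda>x. \<chi> i. conv L n K v x i) \<in> H1_per L \<and>
     H1_norm L (\<lambda>x. \<chi> i. conv L n K v x i) \<le> B * L2_norm_field L n v)"


section \<open>Neural networks and Fourier Neural Operators\<close>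

definition affine_map ::
  "nat \<Rightarrow> nat \<Rightarrow> (nat \<Rightarrow> nat \<Rightarrow> real) \<Rightarrow> (nat \<Rightarrow> real) \<Rightarrow> (nat \<Rightarrow> real) \<Rightarrow> nat \<Rightarrow> real" where
  "affine_map n m W b a = (\<lambda>i. if i < m then (\<Sum>j<n. W i j * a j) + b i else 0)"

definition activate :: "(real \<Rightarrow> real) \<Rightarrow> nat set \<Rightarrow> (nat \<Rightarrow> real) \<Rightarrow> nat \<Rightarrow> real" where
  "activate \<sigma> I a = (\<lambda>i. if i \<in> I then \<sigma> (a i) else a i)"

inductive neural_net ::
  "(real \<Rightarrow> real) \<Rightarrow> nat \<Rightarrow> nat \<Rightarrow> ((nat \<Rightarrow> real) \<Rightarrow> nat \<Rightarrow> real) \<Rightarrow> bool" for \<sigma> where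
  nn_affine: "neural_net \<sigma> n m (affine_map n m W b)"
| nn_comp_affine: "neural_net \<sigma> n k N \<Longrightarrow> neural_net \<sigma> n m (affine_map k m W b \<circ> N)"
| nn_comp_activate: "neural_net \<sigma> n m N \<Longrightarrow> I \<subseteq> {..<m} \<Longrightarrow> neural_net \<sigma> n m (activate \<sigma> I \<circ> N)"

definition layer_map ::
  "(real \<Rightarrow> real) \<Rightarrow> real^'d \<Rightarrow> nat \<Rightarrow> nat set \<Rightarrow> (nat \<Rightarrow> nat \<Rightarrow> real) \<Rightarrow> (real^'d \<Rightarrow> nat \<Rightarrow> real) \<Rightarrow>
   (int^'d \<Rightarrow> nat \<Rightarrow> nat \<Rightarrow> complex) \<Rightarrow> (real^'d \<Rightarrow> nat \<Rightarrow> real) \<Rightarrow> real^'d \<Rightarrow> nat \<Rightarrow> real"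
where
  "layer_map \<sigma> L dv I W b K v x =
     activate \<sigma> I (\<lambda>i. if i < dv then (\<Sum>j<dv. W i j * v x j) + b x i + conv L dv K v x i else 0)"

definition fno_layer ::
  "(real \<Rightarrow> real) \<Rightarrow> real^'d \<Rightarrow> nat \<Rightarrow> ((real^'d \<Rightarrow> nat \<Rightarrow> real) \<Rightarrow> real^'d \<Rightarrow> nat \<Rightarrow> real) \<Rightarrow> bool" where
  "fno_layer \<sigma> L dv A \<longleftrightarrow> (\<exists>I W b K.
     I \<subseteq> {..<dv} \<and> L2_field L dv b \<and> conj_symmetric K \<and> conv_bounded_L2 L dv dv K \<and>
     A = layer_map \<sigma> L dv I W b K \<and>
     (\<forall>v. L2_field L dv v \<longrightarrow> L2_field L dv (A v)))"

definition output_map ::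
  "real^'d \<Rightarrow> nat \<Rightarrow> ('m \<Rightarrow> nat \<Rightarrow> real) \<Rightarrow> (real^'d \<Rightarrow> real^'m) \<Rightarrow>
   (int^'d \<Rightarrow> 'm \<Rightarrow> nat \<Rightarrow> complex) \<Rightarrow> (real^'d \<Rightarrow> nat \<Rightarrow> real) \<Rightarrow> real^'d \<Rightarrow> real^'m"
where
  "output_map L dv W b K v x = (\<chi> i. (\<Sum>j<dv. W i j * v x j) + b x $ i + conv L dv K v x i)"

definition fno_output ::
  "real^'d \<Rightarrow> nat \<Rightarrow> ((real^'d \<Rightarrow> nat \<Rightarrow> real) \<Rightarrow> real^'d \<Rightarrow> real^'m) \<Rightarrow> bool" where
  "fno_output L dv P \<longleftrightarrow> (\<exists>W b K.
     sq_integrable L b \<and> conj_symmetric K \<and> conv_bounded_H1 L dv K \<and> P = output_map L dv W b K)"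

definition fno ::
  "(real \<Rightarrow> real) \<Rightarrow> real^'d \<Rightarrow> nat \<Rightarrow> ((real^'d \<Rightarrow> nat \<Rightarrow> real) \<Rightarrow> real^'d \<Rightarrow> real^'m) \<Rightarrow> bool" where
  "fno \<sigma> L da F \<longleftrightarrow> (\<exists>dv N As P.
     CARD('m) \<le> dv \<and> neural_net \<sigma> da dv N \<and>
     As \<noteq> [] \<and> (\<forall>A\<in>set As. fno_layer \<sigma> L dv A) \<and> fno_output L dv P \<and>
     F = (\<lambda>a. P (fold (\<lambda>A v. A v) As (\<lambda>x. N (a x)))))"

text \<open>The input field: the coordinates of the (constant) mean strain \<open>e\<close> followed by those of
  \<open>C x\<close>.\<close>

definition input_field ::
  "(real^'d^'d) list \<Rightarrow> ((real^'d^'d) \<Rightarrow>\<^sub>L (real^'d^'d)) list \<Rightarrow>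
   real^'d^'d \<Rightarrow> (real^'d \<Rightarrow> (real^'d^'d) \<Rightarrow>\<^sub>L (real^'d^'d)) \<Rightarrow> real^'d \<Rightarrow> nat \<Rightarrow> real"
where
  "input_field bs ts e C x i =
     (if i < length bs then representation (set bs) e (bs ! i)
      else if i < length bs + length ts
      then representation (set ts) (C x) (ts ! (i - length bs))
      else 0)"

end

theory Submission
  imports Defs
begin

text \<open>
  On square integrable matrix fields let \<open>P\<close> be the orthogonal projection onto the gradients of
  periodic fields; it is the Fourier multiplier \<open>\<omega>\<^sub>j \<omega>\<^sub>l / |\<omega>|\<^sup>2\<close>. Korn's inequality, an identity in
  Fourier space on the torus, and \<open>|C A|\<^sup>2 \<le> \<alpha>\<^sub>+ (A : C A)\<close> show that
  \<open>G \<mapsto> P (G - C (e + G) / \<alpha>\<^sub>+)\<close> contracts gradient fields by the factor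
  \<open>\<surd>(1 - \<alpha>\<^sub>- / (2 \<alpha>\<^sub>+))\<close>. Its fixed point is the gradient of the corrector, which gives existence,
  uniqueness and a geometrically convergent iteration.

  A network can imitate the iteration if it multiplies the bounded coefficients of \<open>C\<close> with the
  entries of \<open>e + G\<close>, which are only square integrable, up to an error that is uniformly small.
  The activation \<open>\<sigma>(t) = t g(t)\<close>, where \<open>g(t)\<close> is the distance of \<open>t\<close> to the nearest integer, achieves
  this: \<open>g(t) = \<sigma>(t + 1) - \<sigma>(t)\<close>, and with \<open>p = y + g(y)\<close> and \<open>p' = y + 1/2 + g(y + 1/2)\<close> one has
  \<open>g(p + x) + g(p' + x) - g(2 y + x) = g(x)\<close> for all \<open>y\<close>. Hence
  \<open>\<sigma>(p + x) + \<sigma>(p' + x) - \<sigma>(2 y + x) / 2 = y g(x) + O(1)\<close>, where \<open>g(x) = x\<close> on \<open>[0, 1/2]\<close>, and replacing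
  \<open>y\<close> by \<open>y / h\<close> turns the bounded error into \<open>O(h)\<close>. The output layer recovers the displacement from
  its approximate gradient by a Fourier multiplier.
\<close>

section \<open>Square integrable functions on the cell\<close>

text \<open>The obstacle is uniformity over the whole class of stiffness fields. The iterates are
  bounded in L^2 only, and an L^2 bound alone gives no level beyond which their large values are
  negligible, so truncating before multiplying would call for a higher integrability estimate.
  Piecewise linear networks with finitely many pieces cannot avoid truncation: for fixed c, a
  bounded error in c y for all y forces the asymptotic slope c, but such a network has finitely many
  slopes. An oscillating activation of linear growth has no such limit, because the phase selects
  the slope. Since its multiplication error does not depend on the size of y, the errors of the
  steps merely sum as a geometric series, and the scale h and the number of steps are fixed
  independently of each other and before the field is known.

  The iteration runs on full gradients instead of strains. The projection then acts on each row of
  the matrix separately. The price is that C is coercive only on symmetric parts; Korn's inequality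
  repairs this and is the origin of the 2 in the contraction factor.\<close>

definition l2 :: "real^'d \<Rightarrow> (real^'d \<Rightarrow> 'b::euclidean_space) \<Rightarrow> real" where
  "l2 L f = sqrt (\<integral>x. (norm (f x))\<^sup>2 \<partial>cellM L)"

lemma finite_measure_cell: "finite_measure (cellM L)"
  unfolding cell_def by (intro finite_measure_lebesgue_on) auto

lemma space_cellM [simp]: "space (cellM L) = cell L"
  by (simp add: space_restrict_space)

lemma l2_nonneg [simp]: "0 \<le> l2 L f"
  by (simp add: l2_def)

lemma l2_power2: "(l2 L f)\<^sup>2 = (\<integral>x. (norm (f x))\<^sup>2 \<partial>cellM L)"
  by (simp add: l2_def)

lemma l2_cong_AE:
  assumes "sq_integrable L f" "sq_integrable L g" "AE x in cellM L. norm (f x) = norm (g x)"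
  shows "l2 L f = l2 L g"
  unfolding l2_def using assms
  by (intro arg_cong[where f=sqrt] integral_cong_AE) (auto simp: sq_integrable_def)

lemma l2_minus [simp]: "l2 L (\<lambda>x. - f x) = l2 L f"
  by (simp add: l2_def)

lemma l2_minus_commute: "l2 L (\<lambda>x. f x - g x) = l2 L (\<lambda>x. g x - f x)"
  by (simp add: l2_def norm_minus_commute)

lemma l2_scaleR: "l2 L (\<lambda>x. c *\<^sub>R f x) = \<bar>c\<bar> * l2 L f"
  by (simp add: l2_def power_mult_distrib real_sqrt_mult)

lemma sq_integrable_bound:
  fixes f :: "real^'d \<Rightarrow> 'b::euclidean_space" and g :: "real^'d \<Rightarrow> 'c::euclidean_space"
  assumes "f \<in> borel_measurable (cellM L)" "sq_integrable L g"
    "AE x in cellM L. norm (f x) \<le> norm (g x)"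
  shows "sq_integrable L f"
  unfolding sq_integrable_def
proof
  show "integrable (cellM L) (\<lambda>x. (norm (f x))\<^sup>2)"
    by (rule Bochner_Integration.integrable_bound[of _ "\<lambda>x. (norm (g x))\<^sup>2"])
      (use assms in \<open>auto simp: sq_integrable_def elim!: eventually_mono intro!: power_mono\<close>)
qed fact

lemma sq_integrable_bounded:
  fixes f :: "real^'d \<Rightarrow> 'b::euclidean_space"
  assumes "f \<in> borel_measurable (cellM L)" "AE x in cellM L. norm (f x) \<le> B"
  shows "sq_integrable L f"
proof -
  interpret finite_measure "cellM L" by (rule finite_measure_cell)
  show ?thesis
    by (rule sq_integrable_bound[OF assms(1), of "\<lambda>_. B"])
      (use assms in \<open>auto simp: sq_integrable_def elim!: eventually_mono\<close>)
qed

lemma sq_integrable_const [simp]: "sq_integrable L (\<lambda>_. c)"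
  by (rule sq_integrable_bounded[of _ _ "norm c"]) auto

lemma sq_integrable_add:
  fixes f g :: "real^'d \<Rightarrow> 'b::euclidean_space"
  assumes "sq_integrable L f" "sq_integrable L g"
  shows "sq_integrable L (\<lambda>x. f x + g x)"
  unfolding sq_integrable_def
proof
  have [measurable]: "f \<in> borel_measurable (cellM L)" "g \<in> borel_measurable (cellM L)"
    using assms by (auto simp: sq_integrable_def)
  show "(\<lambda>x. f x + g x) \<in> borel_measurable (cellM L)" by measurable
  have "(norm (a + b))\<^sup>2 \<le> 2 * (norm a)\<^sup>2 + 2 * (norm b)\<^sup>2" for a b :: 'b
  proof -
    have "(norm (a + b))\<^sup>2 \<le> (norm a + norm b)\<^sup>2"
      by (intro power_mono norm_triangle_ineq) auto
    also have "\<dots> \<le> 2 * (norm a)\<^sup>2 + 2 * (norm b)\<^sup>2"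
      using sum_squares_bound[of "norm a" "norm b"] by (simp add: power2_sum)
    finally show ?thesis .
  qed
  then have le: "norm ((norm (f x + g x))\<^sup>2) \<le> norm (2 * (norm (f x))\<^sup>2 + 2 * (norm (g x))\<^sup>2)" for x
    by simp
  have int: "integrable (cellM L) (\<lambda>x. 2 * (norm (f x))\<^sup>2 + 2 * (norm (g x))\<^sup>2)"
    using assms by (simp add: sq_integrable_def)
  have meas: "(\<lambda>x. (norm (f x + g x))\<^sup>2) \<in> borel_measurable (cellM L)"
    by measurable
  show "integrable (cellM L) (\<lambda>x. (norm (f x + g x))\<^sup>2)"
    by (rule Bochner_Integration.integrable_bound[OF int meas AE_I2[OF le]])
qed

lemma sq_integrable_scaleR:
  assumes "sq_integrable L f" shows "sq_integrable L (\<lambda>x. c *\<^sub>R f x)"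
  using assms by (auto simp: sq_integrable_def power_mult_distrib)

lemma sq_integrable_mult_left:
  fixes f :: "real^'d \<Rightarrow> real"
  assumes "sq_integrable L f" shows "sq_integrable L (\<lambda>x. c * f x)"
  using sq_integrable_scaleR[OF assms, of c] by simp

lemma sq_integrable_minus:
  assumes "sq_integrable L f" shows "sq_integrable L (\<lambda>x. - f x)"
  using sq_integrable_scaleR[OF assms, of "-1"] by simp

lemma sq_integrable_diff:
  assumes "sq_integrable L f" "sq_integrable L g"
  shows "sq_integrable L (\<lambda>x. f x - g x)"
  using sq_integrable_add[OF assms(1) sq_integrable_minus[OF assms(2)]] by simp

lemma sq_integrable_sum:
  assumes "\<And>i. i \<in> I \<Longrightarrow> sq_integrable L (f i)"
  shows "sq_integrable L (\<lambda>x. \<Sum>i\<in>I. f i x)"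
  using assms by (induction I rule: infinite_finite_induct) (auto intro: sq_integrable_add)

lemma sq_integrable_norm:
  assumes "sq_integrable L f" shows "sq_integrable L (\<lambda>x. norm (f x))"
  using assms by (auto simp: sq_integrable_def)

lemma sq_integrable_bounded_linear:
  fixes f :: "real^'d \<Rightarrow> 'b::euclidean_space" and h :: "'b \<Rightarrow> 'c::euclidean_space"
  assumes h: "bounded_linear h" and f: "sq_integrable L f"
  shows "sq_integrable L (\<lambda>x. h (f x))"
proof -
  obtain K where K: "\<And>x. norm (h x) \<le> norm x * K" using bounded_linear.bounded[OF h] by auto
  have [measurable]: "f \<in> borel_measurable (cellM L)" using f by (auto simp: sq_integrable_def)
  have "norm (h x) \<le> norm (K *\<^sub>R x)" for x
    using K[of x] mult_right_mono[OF abs_ge_self[of K] norm_ge_zero[of x]] by (simp add: mult.commute)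
  then show ?thesis
    using borel_measurable_continuous_on[OF linear_continuous_on[OF h], of f "cellM L"]
    by (intro sq_integrable_bound[OF _ sq_integrable_scaleR[OF f, of K]]) (auto simp: sq_integrable_def)
qed

lemma sq_integrable_componentwise:
  fixes f :: "real^'d \<Rightarrow> real^'m"
  shows "sq_integrable L f \<longleftrightarrow> (\<forall>i. sq_integrable L (\<lambda>x. f x $ i))"
proof
  assume "sq_integrable L f"
  then show "\<forall>i. sq_integrable L (\<lambda>x. f x $ i)"
    using sq_integrable_bounded_linear[OF bounded_linear_vec_nth] by blast
next
  assume *: "\<forall>i. sq_integrable L (\<lambda>x. f x $ i)"
  have "sq_integrable L (\<lambda>x. \<Sum>i\<in>UNIV. f x $ i *\<^sub>R axis i (1::real))"
    by (intro sq_integrable_sum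
        sq_integrable_bounded_linear[where h="\<lambda>t. t *\<^sub>R axis _ (1::real)", OF bounded_linear_scaleR_left])
      (use * in auto)
  also have "(\<lambda>x. \<Sum>i\<in>UNIV. f x $ i *\<^sub>R axis i (1::real)) = f"
    by (simp add: fun_eq_iff vec_eq_iff axis_def if_distrib cong: if_cong)
  finally show "sq_integrable L f" .
qed

lemma sq_integrable_componentwise2:
  fixes f :: "real^'d \<Rightarrow> real^'n^'m"
  assumes "\<And>i j. sq_integrable L (\<lambda>x. f x $ i $ j)"
  shows "sq_integrable L f"
proof -
  have m: "(\<lambda>x. f x $ i) \<in> borel_measurable (cellM L)" for i
    using assms sq_integrable_componentwise[of L "\<lambda>x. f x $ i"] by (auto simp: sq_integrable_def)
  have s: "sq_integrable L (\<lambda>x. norm (f x $ i))" for i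
    using assms sq_integrable_componentwise[of L "\<lambda>x. f x $ i"] by (auto intro: sq_integrable_norm)
  have "(\<lambda>x. \<Sum>i\<in>UNIV. axis i (f x $ i)) = f"
    by (simp add: fun_eq_iff vec_eq_iff axis_def if_distrib[where f="\<lambda>v. v $ _"] cong: if_cong)
  moreover have "continuous_on UNIV (\<lambda>v :: real^'n. axis i v :: real^'n^'m)" for i
    unfolding axis_def
  proof (intro continuous_on_vec_lambda)
    show "continuous_on UNIV (\<lambda>v :: real^'n. if k = i then v else 0)" for k
      by (cases "k = i") auto
  qed
  from borel_measurable_continuous_on[OF this m]
  have "(\<lambda>x. \<Sum>i\<in>UNIV. axis i (f x $ i)) \<in> borel_measurable (cellM L)"
    by (rule borel_measurable_sum)
  ultimately have "f \<in> borel_measurable (cellM L)" by (simp only:)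
  moreover have "norm (f x) \<le> norm (\<Sum>i\<in>UNIV. norm (f x $ i))" for x
  proof -
    have "norm (f x) = L2_set (\<lambda>i. norm (f x $ i)) UNIV" by (rule norm_vec_def)
    also have "\<dots> \<le> (\<Sum>i\<in>UNIV. norm (f x $ i))" by (intro L2_set_le_sum) simp
    finally show ?thesis by (simp add: sum_nonneg)
  qed
  ultimately show ?thesis
    by (intro sq_integrable_bound[OF _ sq_integrable_sum[of UNIV L "\<lambda>i x. norm (f x $ i)", OF s]]) auto
qed

lemma sq_integrable_nth2:
  fixes f :: "real^'d \<Rightarrow> real^'n^'m"
  assumes "sq_integrable L f"
  shows "sq_integrable L (\<lambda>x. f x $ i $ j)"
  using sq_integrable_bounded_linear[OF bounded_linear_compose[OF bounded_linear_vec_nth bounded_linear_vec_nth] assms]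
  by simp

lemma sq_integrable_inner_integrable:
  fixes f g :: "real^'d \<Rightarrow> 'b::euclidean_space"
  assumes "sq_integrable L f" "sq_integrable L g"
  shows "integrable (cellM L) (\<lambda>x. f x \<bullet> g x)"
proof (rule Bochner_Integration.integrable_bound[of _ "\<lambda>x. (norm (f x))\<^sup>2 + (norm (g x))\<^sup>2"])
  have [measurable]: "f \<in> borel_measurable (cellM L)" "g \<in> borel_measurable (cellM L)"
    using assms by (auto simp: sq_integrable_def)
  show "(\<lambda>x. f x \<bullet> g x) \<in> borel_measurable (cellM L)" by measurable
  have "\<bar>a \<bullet> b\<bar> \<le> (norm a)\<^sup>2 + (norm b)\<^sup>2" for a b :: 'b
    using Cauchy_Schwarz_ineq2[of a b] sum_squares_bound[of "norm a" "norm b"]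
      mult_nonneg_nonneg[OF norm_ge_zero[of a] norm_ge_zero[of b]] by linarith
  then show "AE x in cellM L. norm (f x \<bullet> g x) \<le> norm ((norm (f x))\<^sup>2 + (norm (g x))\<^sup>2)"
    by (auto intro!: AE_I2 order_trans[OF _ abs_ge_self])
qed (use assms in \<open>auto simp: sq_integrable_def\<close>)

lemma sq_integrable_mult_integrable:
  fixes f g :: "real^'d \<Rightarrow> real"
  assumes "sq_integrable L f" "sq_integrable L g"
  shows "integrable (cellM L) (\<lambda>x. f x * g x)"
  using sq_integrable_inner_integrable[OF assms] by simp

lemma sq_integrable_integrable:
  fixes f :: "real^'d \<Rightarrow> 'b::euclidean_space"
  assumes "sq_integrable L f" shows "integrable (cellM L) f"
  using sq_integrable_mult_integrable[OF sq_integrable_norm[OF assms] sq_integrable_const[of L 1]]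
    assms integrable_norm_iff[of f "cellM L"] by (simp add: sq_integrable_def)

lemma l2_eq_0_iff:
  fixes f :: "real^'d \<Rightarrow> 'b::euclidean_space"
  assumes "sq_integrable L f"
  shows "l2 L f = 0 \<longleftrightarrow> (AE x in cellM L. f x = 0)"
  unfolding l2_def using assms integral_nonneg_eq_0_iff_AE[of "cellM L" "\<lambda>x. (norm (f x))\<^sup>2"]
  by (auto simp: sq_integrable_def)

text \<open>With a and b the two norms, the weights b/a and a/b in the pointwise
  arithmetic-geometric mean inequality are chosen so that its integral is exactly a * b. They
  require both norms to be positive, hence the separate degenerate case.\<close>

lemma l2_Cauchy_Schwarz:
  fixes f g :: "real^'d \<Rightarrow> 'b::euclidean_space"
  assumes f: "sq_integrable L f" and g: "sq_integrable L g"
  shows "\<bar>\<integral>x. f x \<bullet> g x \<partial>cellM L\<bar> \<le> l2 L f * l2 L g"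
proof (cases "l2 L f = 0 \<or> l2 L g = 0")
  case True
  then have "AE x in cellM L. f x \<bullet> g x = 0"
    using l2_eq_0_iff[OF f] l2_eq_0_iff[OF g] by auto
  then show ?thesis using integral_eq_zero_AE by fastforce
next
  case False
  define a b where "a = l2 L f" and "b = l2 L g"
  have ab: "0 < a" "0 < b" using False by (auto simp: a_def b_def order_less_le)
  have fi: "integrable (cellM L) (\<lambda>x. (norm (f x))\<^sup>2)" "integrable (cellM L) (\<lambda>x. (norm (g x))\<^sup>2)"
    using f g by (auto simp: sq_integrable_def)
  have "\<bar>v \<bullet> w\<bar> \<le> (b / a * (norm v)\<^sup>2 + a / b * (norm w)\<^sup>2) / 2" for v w :: 'b
  proof -
    have "0 \<le> (b * norm v - a * norm w)\<^sup>2 / (a * b)" using ab by simp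
    also have "\<dots> = b / a * (norm v)\<^sup>2 + a / b * (norm w)\<^sup>2 - 2 * (norm v * norm w)"
      using ab by (simp add: field_simps power2_eq_square)
    finally show ?thesis using Cauchy_Schwarz_ineq2[of v w] by simp
  qed
  then have "\<bar>\<integral>x. f x \<bullet> g x \<partial>cellM L\<bar> \<le> (\<integral>x. (b / a * (norm (f x))\<^sup>2 + a / b * (norm (g x))\<^sup>2) / 2 \<partial>cellM L)"
    using sq_integrable_inner_integrable[OF f g] fi
    by (intro order_trans[OF integral_abs_bound] integral_mono) auto
  also have "\<dots> = (b / a * a\<^sup>2 + a / b * b\<^sup>2) / 2"
    using fi by (simp add: a_def b_def l2_power2)
  also have "\<dots> = a * b" using ab by (simp add: power2_eq_square)
  finally show ?thesis by (simp add: a_def b_def)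
qed

lemma l2_power2_add:
  fixes f g :: "real^'d \<Rightarrow> 'b::euclidean_space"
  assumes f: "sq_integrable L f" and g: "sq_integrable L g"
  shows "(l2 L (\<lambda>x. f x + g x))\<^sup>2 = (l2 L f)\<^sup>2 + 2 * (\<integral>x. f x \<bullet> g x \<partial>cellM L) + (l2 L g)\<^sup>2"
proof -
  have fi: "integrable (cellM L) (\<lambda>x. (norm (f x))\<^sup>2)" "integrable (cellM L) (\<lambda>x. (norm (g x))\<^sup>2)"
    using f g by (auto simp: sq_integrable_def)
  have "(norm (a + b))\<^sup>2 = (norm a)\<^sup>2 + 2 * (a \<bullet> b) + (norm b)\<^sup>2" for a b :: 'b
    by (simp add: power2_norm_eq_inner algebra_simps inner_commute)
  then show ?thesis
    using fi sq_integrable_inner_integrable[OF f g] by (simp add: l2_power2)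
qed

lemma l2_triangle:
  fixes f g :: "real^'d \<Rightarrow> 'b::euclidean_space"
  assumes f: "sq_integrable L f" and g: "sq_integrable L g"
  shows "l2 L (\<lambda>x. f x + g x) \<le> l2 L f + l2 L g"
proof (rule power2_le_imp_le)
  show "(l2 L (\<lambda>x. f x + g x))\<^sup>2 \<le> (l2 L f + l2 L g)\<^sup>2"
    using l2_Cauchy_Schwarz[OF f g] by (simp add: l2_power2_add[OF f g] power2_sum)
qed simp

lemma l2_triangle_diff:
  fixes f g h :: "real^'d \<Rightarrow> 'b::euclidean_space"
  assumes "sq_integrable L f" "sq_integrable L g" "sq_integrable L h"
  shows "l2 L (\<lambda>x. f x - h x) \<le> l2 L (\<lambda>x. f x - g x) + l2 L (\<lambda>x. g x - h x)"
  using l2_triangle[OF sq_integrable_diff[OF assms(1,2)] sq_integrable_diff[OF assms(2,3)]] by simp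

lemma l2_mono:
  fixes f :: "real^'d \<Rightarrow> 'b::euclidean_space" and g :: "real^'d \<Rightarrow> 'c::euclidean_space"
  assumes "sq_integrable L f" "sq_integrable L g" "AE x in cellM L. norm (f x) \<le> norm (g x)"
  shows "l2 L f \<le> l2 L g"
  unfolding l2_def using assms
  by (intro real_sqrt_le_mono integral_mono_AE)
    (auto simp: sq_integrable_def elim!: eventually_mono intro!: power_mono)

lemma l2_const: "l2 L (\<lambda>_. c) = norm c * sqrt (measure lebesgue (cell L))"
proof -
  have "measure (cellM L) (cell L) = measure lebesgue (cell L)"
    by (rule measure_restrict_space) (auto simp: cell_def)
  then show ?thesis by (simp add: l2_def real_sqrt_mult mult.commute)
qed

lemma l2_le_of_AE_bound:
  fixes f :: "real^'d \<Rightarrow> 'b::euclidean_space"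
  assumes "sq_integrable L f" "AE x in cellM L. norm (f x) \<le> B"
  shows "l2 L f \<le> B * sqrt (measure lebesgue (cell L))"
\<comment> \<open>If the cell is a null set, the almost everywhere bound is vacuous and
  \<open>B\<close> may be negative; then both sides are 0. Otherwise some point satisfies the bound,
  which forces \<open>B\<close> to be nonnegative.\<close>
proof (cases "AE x in cellM L. False")
  case True
  then have "l2 L f = l2 L (\<lambda>_. 0::real)" "measure lebesgue (cell L) = 0"
  proof -
    from True show "l2 L f = l2 L (\<lambda>_. 0::real)"
      using assms(1) l2_eq_0_iff[OF assms(1)] by (auto simp: l2_const)
    have "cell L \<in> null_sets (cellM L)"
      using True by (auto simp: AE_iff_null[of "cellM L"] cell_def)
    then show "measure lebesgue (cell L) = 0"
      by (simp add: cell_def null_sets_def measure_def emeasure_restrict_space)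
  qed
  then show ?thesis by (simp add: l2_const)
next
  case False
  have "0 \<le> B"
  proof (rule ccontr)
    assume "\<not> 0 \<le> B"
    then have "\<not> norm (f x) \<le> B" for x using norm_ge_zero[of "f x"] by linarith
    then show False using assms(2) False by simp
  qed
  then show ?thesis
    using l2_mono[OF assms(1) sq_integrable_const[of L B]] assms(2) by (simp add: l2_const)
qed

lemma integral_norm_le_l2:
  fixes f :: "real^'d \<Rightarrow> 'b::euclidean_space"
  assumes "sq_integrable L f"
  shows "(\<integral>x. norm (f x) \<partial>cellM L) \<le> l2 L f * sqrt (measure lebesgue (cell L))"
  using l2_Cauchy_Schwarz[OF sq_integrable_norm[OF assms] sq_integrable_const[of L "1::real"]]
  by (simp add: l2_const) (simp add: l2_def)

text \<open>Geometric decay makes the increments summable in \<open>L\<^sup>1\<close>, hence almost everywhere.\<close>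

lemma l2_complete:
  fixes f :: "nat \<Rightarrow> real^'d \<Rightarrow> 'b::euclidean_space"
  assumes sq: "\<And>n. sq_integrable L (f n)"
    and q: "0 \<le> q" "q < 1"
    and step: "\<And>n. l2 L (\<lambda>x. f (Suc n) x - f n x) \<le> K * q ^ n"
  obtains g where "sq_integrable L g" "\<And>n. l2 L (\<lambda>x. f n x - g x) \<le> K / (1 - q) * q ^ n"
proof -
  have [measurable]: "f n \<in> borel_measurable (cellM L)" for n
    using sq by (auto simp: sq_integrable_def)
  have K: "0 \<le> K" using order_trans[OF l2_nonneg step[of 0]] by simp
  have dsq: "sq_integrable L (\<lambda>x. f m x - f n x)" for m n
    by (intro sq_integrable_diff sq)
  have dist: "l2 L (\<lambda>x. f (n + m) x - f n x) \<le> K / (1 - q) * q ^ n" for n m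
  proof -
    have "l2 L (\<lambda>x. f (n + m) x - f n x) \<le> (\<Sum>i<m. K * q ^ (n + i))"
    proof (induction m)
      case 0
      then show ?case by (simp add: l2_const)
    next
      case (Suc m)
      have "l2 L (\<lambda>x. f (n + Suc m) x - f n x) \<le>
          l2 L (\<lambda>x. f (n + Suc m) x - f (n + m) x) + l2 L (\<lambda>x. f (n + m) x - f n x)"
        by (intro l2_triangle_diff sq)
      then show ?case using Suc step[of "n + m"] by simp
    qed
    also have "\<dots> = K * q ^ n * (\<Sum>i<m. q ^ i)"
      by (simp add: sum_distrib_left power_add mult.assoc)
    also have "\<dots> \<le> K * q ^ n * (1 / (1 - q))"
      using q K by (intro mult_left_mono) (auto simp: sum_gp_strict divide_right_mono)
    finally show ?thesis by simp
  qed
  let ?V = "sqrt (measure lebesgue (cell L))"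
  have "AE x in cellM L. summable (\<lambda>n. norm (f (Suc n) x - f n x))"
  proof -
    have int: "integrable (cellM L) (\<lambda>x. norm (f (Suc n) x - f n x))" for n
      by (intro integrable_norm sq_integrable_integrable dsq)
    have "(\<Sum>n. \<integral>\<^sup>+x. norm (f (Suc n) x - f n x) \<partial>cellM L) \<le> (\<Sum>n. ennreal (K * ?V * q ^ n))"
    proof (intro suminf_le allI)
      fix n
      have "(\<integral>\<^sup>+x. norm (f (Suc n) x - f n x) \<partial>cellM L) = ennreal (\<integral>x. norm (f (Suc n) x - f n x) \<partial>cellM L)"
        by (intro nn_integral_eq_integral int) auto
      also have "\<dots> \<le> ennreal (K * ?V * q ^ n)"
        using integral_norm_le_l2[OF dsq[of "Suc n" n]] mult_right_mono[OF step[of n], of ?V]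
        by (intro ennreal_leI) (simp add: mult_ac)
      finally show "(\<integral>\<^sup>+x. norm (f (Suc n) x - f n x) \<partial>cellM L) \<le> ennreal (K * ?V * q ^ n)" .
    qed auto
    also have "\<dots> = ennreal (\<Sum>n. K * ?V * q ^ n)"
      using q K by (intro suminf_ennreal2) (auto intro!: summable_mult summable_geometric)
    also have "\<dots> < \<infinity>" by simp
    finally have "(\<integral>\<^sup>+x. (\<Sum>n. ennreal (norm (f (Suc n) x - f n x))) \<partial>cellM L) < \<infinity>"
      by (subst nn_integral_suminf) auto
    then have "(\<integral>\<^sup>+x. (\<Sum>n. ennreal (norm (f (Suc n) x - f n x))) \<partial>cellM L) \<noteq> \<infinity>" by simp
    then have "AE x in cellM L. (\<Sum>n. ennreal (norm (f (Suc n) x - f n x))) \<noteq> \<infinity>"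
      by (intro nn_integral_PInf_AE) auto
    then show ?thesis
      by (auto elim!: eventually_mono intro!: summable_suminf_not_top)
  qed
  then have conv: "AE x in cellM L. convergent (\<lambda>n. f n x)"
  proof (rule AE_mp, intro AE_I2 impI)
    fix x assume "summable (\<lambda>n. norm (f (Suc n) x - f n x))"
    then have "summable (\<lambda>n. f (Suc n) x - f n x)" by (rule summable_norm_cancel)
    then have "convergent (\<lambda>n. \<Sum>i<n. f (Suc i) x - f i x)" by (simp add: summable_iff_convergent)
    moreover have "(\<lambda>n. \<Sum>i<n. f (Suc i) x - f i x) = (\<lambda>n. f n x - f 0 x)"
      by (intro ext sum_lessThan_telescope)
    ultimately have "convergent (\<lambda>n. f n x - f 0 x)" by (simp only:)
    from convergent_add[OF this convergent_const[of "f 0 x"]] show "convergent (\<lambda>n. f n x)" by simp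
  qed
  define g where "g x = lim (\<lambda>n. f n x)" for x
  have [measurable]: "g \<in> borel_measurable (cellM L)" unfolding g_def by measurable
  have lim: "AE x in cellM L. (\<lambda>n. f n x) \<longlonglongrightarrow> g x"
    using conv by (auto simp: g_def convergent_LIMSEQ_iff)
  \<comment> \<open>Fatou's lemma in \<open>m\<close> passes the bound on the distance between
    \<open>f n\<close> and \<open>f (n + m)\<close> to the distance between \<open>f n\<close> and
    the limit, and so also gives square integrability of the difference.\<close>
  have est: "(\<integral>\<^sup>+x. ennreal ((norm (f n x - g x))\<^sup>2) \<partial>cellM L) \<le> ennreal ((K / (1 - q) * q ^ n)\<^sup>2)" for n
  proof -
    have "(\<integral>\<^sup>+x. ennreal ((norm (f n x - g x))\<^sup>2) \<partial>cellM L) =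
        (\<integral>\<^sup>+x. liminf (\<lambda>m. ennreal ((norm (f (n + m) x - f n x))\<^sup>2)) \<partial>cellM L)"
    proof (intro nn_integral_cong_AE, use lim in eventually_elim)
      fix x assume "(\<lambda>n. f n x) \<longlonglongrightarrow> g x"
      then have "(\<lambda>m. f (n + m) x) \<longlonglongrightarrow> g x"
        using LIMSEQ_ignore_initial_segment[of "\<lambda>n. f n x" "g x" n] by (simp add: add.commute)
      then have "(\<lambda>m. ennreal ((norm (f (n + m) x - f n x))\<^sup>2)) \<longlonglongrightarrow> ennreal ((norm (g x - f n x))\<^sup>2)"
        by (intro tendsto_ennrealI tendsto_intros)
      then show "ennreal ((norm (f n x - g x))\<^sup>2) = liminf (\<lambda>m. ennreal ((norm (f (n + m) x - f n x))\<^sup>2))"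
        using lim_imp_Liminf[OF sequentially_bot] by (metis norm_minus_commute)
    qed
    also have "\<dots> \<le> liminf (\<lambda>m. \<integral>\<^sup>+x. ennreal ((norm (f (n + m) x - f n x))\<^sup>2) \<partial>cellM L)"
      by (intro nn_integral_liminf) auto
    also have "\<dots> \<le> liminf (\<lambda>m::nat. ennreal ((K / (1 - q) * q ^ n)\<^sup>2))"
    proof (intro Liminf_mono always_eventually allI)
      fix m
      have "(\<integral>\<^sup>+x. ennreal ((norm (f (n + m) x - f n x))\<^sup>2) \<partial>cellM L) = ennreal ((l2 L (\<lambda>x. f (n + m) x - f n x))\<^sup>2)"
        unfolding l2_power2 using dsq[of "n+m" n] by (intro nn_integral_eq_integral) (auto simp: sq_integrable_def)
      also have "\<dots> \<le> ennreal ((K / (1 - q) * q ^ n)\<^sup>2)"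
        by (intro ennreal_leI power_mono dist) simp
      finally show "(\<integral>\<^sup>+x. ennreal ((norm (f (n + m) x - f n x))\<^sup>2) \<partial>cellM L) \<le> ennreal ((K / (1 - q) * q ^ n)\<^sup>2)" .
    qed
    finally show ?thesis by (simp add: Liminf_const)
  qed
  have d: "sq_integrable L (\<lambda>x. f n x - g x)" for n
    unfolding sq_integrable_def
  proof
    show "integrable (cellM L) (\<lambda>x. (norm (f n x - g x))\<^sup>2)"
      using est[of n] by (intro integrableI_bounded) (auto simp: order_le_less_trans)
  qed measurable
  show ?thesis
  proof
    have "(\<lambda>x. f 0 x - (f 0 x - g x)) = g" by (rule ext) simp
    then show "sq_integrable L g" using sq_integrable_diff[OF sq[of 0] d[of 0]] by (simp only:)
    fix n
    have "(\<integral>\<^sup>+x. ennreal ((norm (f n x - g x))\<^sup>2) \<partial>cellM L) = ennreal ((l2 L (\<lambda>x. f n x - g x))\<^sup>2)"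
      unfolding l2_power2 using d[of n] by (intro nn_integral_eq_integral) (auto simp: sq_integrable_def)
    then have "ennreal ((l2 L (\<lambda>x. f n x - g x))\<^sup>2) \<le> ennreal ((K / (1 - q) * q ^ n)\<^sup>2)"
      using est[of n] by (simp only:)
    then have "(l2 L (\<lambda>x. f n x - g x))\<^sup>2 \<le> (K / (1 - q) * q ^ n)\<^sup>2"
      by (rule ennreal_le_iff[OF zero_le_power2, THEN iffD1])
    moreover have "0 \<le> K / (1 - q) * q ^ n"
      using q K by (intro mult_nonneg_nonneg divide_nonneg_nonneg zero_le_power) linarith+
    ultimately show "l2 L (\<lambda>x. f n x - g x) \<le> K / (1 - q) * q ^ n"
      by (rule power2_le_imp_le)
  qed
qed

section \<open>Trigonometric polynomials\<close>

lemma continuous_sq_integrable: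
  fixes f :: "real^'d \<Rightarrow> 'b::euclidean_space"
  assumes "continuous_on UNIV f"
  shows "sq_integrable L f"
proof -
  have c: "continuous_on (cbox 0 L) f" using assms continuous_on_subset by blast
  have "compact (f ` cbox 0 L)" by (intro compact_continuous_image c compact_cbox)
  then obtain B where "\<And>x. x \<in> cbox 0 L \<Longrightarrow> norm (f x) \<le> B"
    by (meson bounded_iff compact_imp_bounded imageI)
  then show ?thesis
    using continuous_imp_measurable_on_sets_lebesgue[OF c]
    by (intro sq_integrable_bounded[of _ _ B]) (auto simp: cell_def)
qed

lemma integral_cellM_continuous:
  fixes f :: "real^'d \<Rightarrow> 'b::euclidean_space"
  assumes "continuous_on UNIV f"
  shows "(\<integral>x. f x \<partial>cellM L) = integral (cbox 0 L) f"
  using continuous_imp_integrable[OF continuous_on_subset[OF assms subset_UNIV], of 0 L]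
  unfolding cell_def by (intro lebesgue_integral_eq_integral) auto

text \<open>The shifted cell sticks out of the original one by a slab of width \<open>a\<close>;
  cutting at \<open>L $ j\<close> and moving that slab back by one period restores the cell.
  \<open>I s t\<close> is the integral over the box whose \<open>j\<close>-th coordinate runs from
  \<open>s\<close> to \<open>t\<close>, the others as in the cell.\<close>

lemma integral_cell_shift:
  fixes f :: "real^'d \<Rightarrow> 'b::euclidean_space"
  assumes cont: "continuous_on UNIV f" and per: "\<And>x. f (x + axis j (L $ j)) = f x"
    and a: "0 \<le> a" "a \<le> L $ j"
  shows "(\<integral>x. f (x + axis j a) \<partial>cellM L) = (\<integral>x. f x \<partial>cellM L)"
proof -
  define lo :: "real \<Rightarrow> real^'d" where "lo s = (\<chi> i. if i = j then s else 0)" for s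
  define hi :: "real \<Rightarrow> real^'d" where "hi s = (\<chi> i. if i = j then s else L $ i)" for s
  define I where "I s t = integral (cbox (lo s) (hi t)) f" for s t
  have split: "I s t = I s m + I m t" if "s \<le> m" "m \<le> t" for s m t
  proof -
    have "f integrable_on cbox (lo s) (hi t)"
      by (intro integrable_continuous continuous_on_subset[OF cont]) auto
    moreover have "cbox (lo s) (hi t) \<inter> {x. x \<bullet> axis j 1 \<le> m} = cbox (lo s) (hi m)"
      using that by (auto simp: mem_box_cart lo_def hi_def inner_axis split: if_splits) force+
    moreover have "cbox (lo s) (hi t) \<inter> {x. x \<bullet> axis j 1 \<ge> m} = cbox (lo m) (hi t)"
      using that by (auto simp: mem_box_cart lo_def hi_def inner_axis split: if_splits) force+
    ultimately show ?thesis
      unfolding I_def using integral_split[of f "lo s" "hi t" "axis j 1" m] by (simp add: axis_in_Basis_iff)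
  qed
  have shift: "integral (cbox (lo s) (hi t)) (\<lambda>x. f (x + axis j c)) = I (s + c) (t + c)" for s t c
  proof -
    have "lo (s + c) - axis j c = lo s" "hi (t + c) - axis j c = hi t"
      by (auto simp: lo_def hi_def vec_eq_iff axis_def)
    then show ?thesis
      unfolding I_def using integral_shift_cbox[of "lo (s + c)" "axis j c" "hi (t + c)" f] by simp
  qed
  have cell: "cbox (lo 0) (hi (L $ j)) = cbox 0 L"
    by (intro arg_cong2[where f=cbox]) (auto simp: lo_def hi_def vec_eq_iff)
  have "(\<integral>x. f (x + axis j a) \<partial>cellM L) = integral (cbox 0 L) (\<lambda>x. f (x + axis j a))"
    by (intro integral_cellM_continuous continuous_on_compose2[OF cont]) (auto intro!: continuous_intros)
  also have "\<dots> = I a (L $ j + a)"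
    using shift[of 0 "L $ j" a] by (simp add: cell)
  also have "\<dots> = I a (L $ j) + I (L $ j) (L $ j + a)"
    using a by (intro split) auto
  also have "I (L $ j) (L $ j + a) = I 0 a"
    using shift[of 0 a "L $ j"] by (simp add: per I_def add.commute)
  also have "I a (L $ j) + I 0 a = I 0 (L $ j)"
    using split[of 0 a "L $ j"] a by simp
  also have "\<dots> = (\<integral>x. f x \<partial>cellM L)"
    by (simp add: I_def cell integral_cellM_continuous[OF cont])
  finally show ?thesis .
qed

lemma has_real_derivative_along_axis:
  fixes \<psi> :: "real^'d \<Rightarrow> real"
  assumes "\<And>x. \<psi> differentiable (at x)"
  shows "((\<lambda>t. \<psi> (x + axis j t)) has_real_derivative partial j \<psi> (x + axis j t)) (at t within S)"
proof -
  let ?D = "frechet_derivative \<psi> (at (x + axis j t))"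
  have D: "(\<psi> has_derivative ?D) (at (x + axis j t))"
    using assms frechet_derivative_works by blast
  have lin: "linear ?D" using D has_derivative_linear by blast
  have "axis j h = h *\<^sub>R (axis j 1 :: real^'d)" for h :: real
    by (simp add: vec_eq_iff axis_def)
  then have eq: "?D (axis j h) = h * partial j \<psi> (x + axis j t)" for h
    unfolding partial_def using linear_scale[OF lin] by (metis real_scaleR_def)
  have "((\<lambda>t. x + axis j t) has_derivative (\<lambda>h. axis j h)) (at t within S)"
  proof -
    have "bounded_linear (\<lambda>h::real. axis j h :: real^'d)"
      by (simp add: axis_def linear_conv_bounded_linear[symmetric])
        (auto simp: linear_iff vec_eq_iff)
    then show ?thesis
      by (auto intro!: derivative_eq_intros bounded_linear_imp_has_derivative)
  qed
  from has_derivative_compose[OF this D]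
  have "((\<lambda>t. \<psi> (x + axis j t)) has_derivative (\<lambda>h. h * partial j \<psi> (x + axis j t))) (at t within S)"
    by (simp add: eq)
  then show ?thesis
    by (simp only: has_field_derivative_def mult.commute[of _ "partial j \<psi> _"])
qed

text \<open>Difference quotients have integral 0 by translation invariance. The mean value theorem
  dominates them by the maximum of the derivative over the cell enlarged by one period in direction
  \<open>j\<close>; the steps \<open>h n\<close> are at most that period.\<close>

lemma integral_partial_eq_0:
  fixes \<psi> :: "real^'d \<Rightarrow> real"
  assumes L: "0 < L $ j" and diff: "\<And>x. \<psi> differentiable (at x)"
    and per: "\<And>x. \<psi> (x + axis j (L $ j)) = \<psi> x"
    and cont: "continuous_on UNIV (partial j \<psi>)"
  shows "(\<integral>x. partial j \<psi> x \<partial>cellM L) = 0"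
proof -
  have cont': "continuous_on UNIV \<psi>"
    using diff by (simp add: continuous_on_eq_continuous_within differentiable_imp_continuous_within)
  define h where "h n = L $ j / real (Suc n)" for n
  have h: "0 < h n" "h n \<le> L $ j" for n
    using L by (auto simp: h_def field_simps)
  define s where "s n x = (\<psi> (x + axis j (h n)) - \<psi> x) / h n" for n x
  have conts: "continuous_on UNIV (\<lambda>x. \<psi> (x + axis j c))" for c
    by (intro continuous_on_compose2[OF cont']) (auto intro!: continuous_intros)
  have int0: "(\<integral>x. s n x \<partial>cellM L) = 0" for n
  proof -
    have "(\<integral>x. s n x \<partial>cellM L) = ((\<integral>x. \<psi> (x + axis j (h n)) \<partial>cellM L) - (\<integral>x. \<psi> x \<partial>cellM L)) / h n"
      unfolding s_def
      using sq_integrable_integrable[OF continuous_sq_integrable[OF conts, of L "h n"]]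
        sq_integrable_integrable[OF continuous_sq_integrable[OF cont', of L]] by simp
    then show ?thesis
      using integral_cell_shift[OF cont' per, of "h n"] h[of n] by simp
  qed
  have "compact (partial j \<psi> ` cbox 0 (L + axis j (L $ j)))"
    by (intro compact_continuous_image continuous_on_subset[OF cont]) auto
  then obtain B where B: "\<And>x. x \<in> cbox 0 (L + axis j (L $ j)) \<Longrightarrow> norm (partial j \<psi> x) \<le> B"
    by (meson bounded_iff compact_imp_bounded imageI)
  have axis0: "axis j 0 = (0 :: real^'d)" by (simp add: vec_eq_iff axis_def)
  have h0: "(\<lambda>n. h n) \<longlonglongrightarrow> 0"
    unfolding h_def by (rule LIMSEQ_Suc[OF lim_const_over_n[of "L $ j"]])
  have "(\<lambda>n. \<integral>x. s n x \<partial>cellM L) \<longlonglongrightarrow> (\<integral>x. partial j \<psi> x \<partial>cellM L)"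
  proof (rule integral_dominated_convergence[where w="\<lambda>_. B"])
    interpret finite_measure "cellM L" by (rule finite_measure_cell)
    show "integrable (cellM L) (\<lambda>_. B)" by simp
    show "partial j \<psi> \<in> borel_measurable (cellM L)"
      using continuous_sq_integrable[OF cont] by (simp add: sq_integrable_def)
    have "continuous_on UNIV (s n)" for n
      using h(1)[of n] unfolding s_def by (intro continuous_intros conts cont') auto
    then show "s n \<in> borel_measurable (cellM L)" for n
      using continuous_sq_integrable by (auto simp: sq_integrable_def)
    show "AE x in cellM L. (\<lambda>n. s n x) \<longlonglongrightarrow> partial j \<psi> x"
    proof (intro AE_I2)
      fix x
      have "((\<lambda>t. (\<psi> (x + axis j t) - \<psi> x) / t) \<longlongrightarrow> partial j \<psi> x) (at 0)"
        using has_real_derivative_along_axis[OF diff, of x j 0 UNIV]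
        by (simp add: DERIV_def axis0)
      moreover have "filterlim h (at 0) sequentially"
        using h0 h(1) by (auto simp: filterlim_at intro!: always_eventually) (metis less_irrefl)
      ultimately show "(\<lambda>n. s n x) \<longlonglongrightarrow> partial j \<psi> x"
        unfolding s_def by (rule filterlim_compose)
    qed
    show "AE x in cellM L. norm (s n x) \<le> B" for n
    proof (intro AE_I2)
      fix x assume "x \<in> space (cellM L)"
      then have x: "x \<in> cbox 0 L" by (simp add: cell_def)
      obtain t where t: "0 < t" "t < h n" "\<psi> (x + axis j (h n)) - \<psi> (x + axis j 0) = (h n - 0) * partial j \<psi> (x + axis j t)"
        using MVT2[OF h(1)[of n], of "\<lambda>t. \<psi> (x + axis j t)" "\<lambda>t. partial j \<psi> (x + axis j t)"]
          has_real_derivative_along_axis[OF diff, of x j _ UNIV] by blast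
      have "s n x = partial j \<psi> (x + axis j t)"
        using t h(1)[of n] by (simp add: s_def axis0)
      moreover have "x + axis j t \<in> cbox 0 (L + axis j (L $ j))"
      proof -
        have xb: "0 \<le> x $ i \<and> x $ i \<le> L $ i" for i using x by (simp add: mem_box_cart)
        moreover have tj: "t \<le> L $ j" using t h(2)[of n] by linarith
        moreover have "x $ j + t \<le> 2 * L $ j" using xb[of j] tj by linarith
        ultimately show ?thesis using t(1) L
          by (auto simp: mem_box_cart axis_def intro!: add_mono add_nonneg_nonneg)
      qed
      ultimately show "norm (s n x) \<le> B" using B by simp
    qed
  qed
  then show ?thesis using int0 LIMSEQ_unique[OF tendsto_const] by force
qed

section \<open>Fourier modes, Bessel's identity and the Riesz-Fischer theorem\<close>

definition fmode :: "real^'d \<Rightarrow> int^'d \<Rightarrow> real^'d \<Rightarrow> complex" where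
  "fmode L \<xi> x = cis (freq L \<xi> \<bullet> x)"

lemma freq_add: "freq L (\<xi> + \<eta>) = freq L \<xi> + freq L \<eta>"
  and freq_diff: "freq L (\<xi> - \<eta>) = freq L \<xi> - freq L \<eta>"
  and freq_minus: "freq L (- \<xi>) = - freq L \<xi>"
  and freq_0 [simp]: "freq L 0 = 0"
  by (simp_all add: freq_def vec_eq_iff algebra_simps add_divide_distrib diff_divide_distrib)

lemma fmode_add: "fmode L (\<xi> + \<eta>) x = fmode L \<xi> x * fmode L \<eta> x"
  and fmode_diff: "fmode L (\<xi> - \<eta>) x = fmode L \<xi> x * cnj (fmode L \<eta> x)"
  and fmode_minus: "fmode L (- \<xi>) x = cnj (fmode L \<xi> x)"
  and fmode_0 [simp]: "fmode L 0 x = 1"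
  and norm_fmode [simp]: "cmod (fmode L \<xi> x) = 1"
  by (simp_all add: fmode_def freq_add freq_diff freq_minus inner_add_left inner_diff_left cis_mult cis_cnj)

lemma continuous_on_cis_real [continuous_intros]:
  "continuous_on S f \<Longrightarrow> continuous_on S (\<lambda>x. cis (f x))" for f :: "'a::topological_space \<Rightarrow> real"
  unfolding cis_conv_exp by (intro continuous_intros)

lemma continuous_fmode: "continuous_on S (fmode L \<xi>)"
  unfolding fmode_def by (intro continuous_intros)

lemma fmode_shift: "fmode L \<xi> (x + axis j a) = cis (2 * pi * of_int (\<xi> $ j) / L $ j * a) * fmode L \<xi> x"
  by (simp add: fmode_def inner_add_right inner_axis cis_mult freq_def add.commute)

lemma measure_cell_pos:
  assumes "\<And>i. 0 < L $ i" shows "0 < measure lebesgue (cell L)"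
proof -
  have "0 < measure lebesgue (cbox 0 L)"
    using assms content_pos_lt[of 0 L] by (auto simp: Basis_vec_def inner_axis)
  then show ?thesis by (simp add: cell_def)
qed

lemma measure_cellM: "measure (cellM L) (cell L) = measure lebesgue (cell L)"
  by (rule measure_restrict_space) (auto simp: cell_def)

text \<open>A shift by half a wavelength in a direction of nonzero frequency changes the sign of the
  mode but not its integral.\<close>

lemma integral_fmode:
  assumes L: "\<And>i. 0 < L $ i"
  shows "(\<integral>x. fmode L \<xi> x \<partial>cellM L) = (if \<xi> = 0 then of_real (measure lebesgue (cell L)) else 0)"
proof (cases "\<xi> = 0")
  case True
  then show ?thesis by (simp add: measure_cellM scaleR_conv_of_real)
next
  case False
  then obtain j where j: "\<xi> $ j \<noteq> 0" by (auto simp: vec_eq_iff)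
  define a where "a = L $ j / (2 * of_int \<bar>\<xi> $ j\<bar>)"
  have "1 \<le> real_of_int \<bar>\<xi> $ j\<bar>" using j by linarith
  then have a: "0 \<le> a" "a \<le> L $ j" using L[of j] by (auto simp: a_def field_simps)
  have "2 * pi * of_int (\<xi> $ j) / L $ j * a = pi * sgn (of_int (\<xi> $ j))"
    using L[of j] j by (auto simp: a_def sgn_if field_simps abs_if)
  then have "cis (2 * pi * of_int (\<xi> $ j) / L $ j * a) = -1"
    using j by (auto simp: sgn_if complex_eq_iff)
  then have "(\<integral>x. fmode L \<xi> (x + axis j a) \<partial>cellM L) = - (\<integral>x. fmode L \<xi> x \<partial>cellM L)"
    by (simp only: fmode_shift) simp
  moreover have "cis (2 * pi * real_of_int (\<xi> $ j) / L $ j * L $ j) = 1"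
    using L[of j] cis_multiple_2pi[of "of_int (\<xi> $ j)"] by simp
  then have "fmode L \<xi> (x + axis j (L $ j)) = fmode L \<xi> x" for x
    by (simp only: fmode_shift) simp
  ultimately show ?thesis
    using integral_cell_shift[OF continuous_fmode _ a, of L \<xi>] False by simp
qed

lemma fmode_periodic:
  assumes L: "\<And>i. 0 < L $ i"
  shows "fmode L \<xi> (x + axis j (L $ j)) = fmode L \<xi> x"
proof -
  have "cis (2 * pi * real_of_int (\<xi> $ j) / L $ j * L $ j) = 1"
    using L[of j] cis_multiple_2pi[of "of_int (\<xi> $ j)"] by simp
  then show ?thesis by (simp only: fmode_shift) simp
qed

text \<open>Complex-valued version of \<open>fourier_coeff\<close>: partial Fourier sums are
  complex, so they and the limits built from them have coefficients only in this sense.\<close>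

definition cfc :: "real^'d \<Rightarrow> (real^'d \<Rightarrow> complex) \<Rightarrow> int^'d \<Rightarrow> complex" where
  "cfc L f \<xi> = (\<integral>x. f x * cnj (fmode L \<xi> x) \<partial>cellM L) / of_real (measure lebesgue (cell L))"

lemma fourier_coeff_cfc: "fourier_coeff L f = cfc L (\<lambda>x. of_real (f x))"
  by (simp add: fun_eq_iff fourier_coeff_def cfc_def fmode_def cis_cnj)

lemma integrable_mult_fmode:
  fixes f :: "real^'d \<Rightarrow> complex"
  assumes "integrable (cellM L) f"
  shows "integrable (cellM L) (\<lambda>x. f x * cnj (fmode L \<xi> x))"
proof (rule Bochner_Integration.integrable_bound[OF assms])
  have [measurable]: "f \<in> borel_measurable (cellM L)" "fmode L \<xi> \<in> borel_measurable (cellM L)"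
    using assms continuous_sq_integrable[OF continuous_fmode[of UNIV L \<xi>], of L] by (auto simp: sq_integrable_def)
  show "(\<lambda>x. f x * cnj (fmode L \<xi> x)) \<in> borel_measurable (cellM L)"
    using borel_measurable_continuous_on[OF continuous_on_cnj[OF continuous_on_id], of "fmode L \<xi>" "cellM L"]
    by measurable
qed (simp add: norm_mult)

lemma cfc_add:
  assumes "integrable (cellM L) f" "integrable (cellM L) g"
  shows "cfc L (\<lambda>x. f x + g x) \<xi> = cfc L f \<xi> + cfc L g \<xi>"
  using integrable_mult_fmode[OF assms(1)] integrable_mult_fmode[OF assms(2)]
  by (simp add: cfc_def algebra_simps add_divide_distrib)

lemma cfc_cmult: "cfc L (\<lambda>x. c * f x) \<xi> = c * cfc L f \<xi>"
  by (simp add: cfc_def mult.assoc)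

lemma cfc_diff:
  assumes "integrable (cellM L) f" "integrable (cellM L) g"
  shows "cfc L (\<lambda>x. f x - g x) \<xi> = cfc L f \<xi> - cfc L g \<xi>"
  using integrable_mult_fmode[OF assms(1)] integrable_mult_fmode[OF assms(2)]
  by (simp add: cfc_def algebra_simps diff_divide_distrib)

lemma cfc_fmode:
  assumes "\<And>i. 0 < L $ i"
  shows "cfc L (fmode L \<eta>) \<xi> = (if \<eta> = \<xi> then 1 else 0)"
  using integral_fmode[OF assms, of "\<eta> - \<xi>"] measure_cell_pos[OF assms]
  by (auto simp: cfc_def fmode_diff)

definition trig :: "real^'d \<Rightarrow> (int^'d \<Rightarrow> complex) \<Rightarrow> (int^'d) set \<Rightarrow> real^'d \<Rightarrow> complex" where
  "trig L c X x = (\<Sum>\<xi>\<in>X. c \<xi> * fmode L \<xi> x)"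

lemma continuous_trig: "continuous_on S (trig L c X)"
  unfolding trig_def by (intro continuous_intros continuous_fmode)

lemma sq_integrable_trig: "sq_integrable L (trig L c X)"
  by (intro continuous_sq_integrable continuous_trig)

lemma sq_integrable_fmode: "sq_integrable L (fmode L \<xi>)"
  by (intro continuous_sq_integrable continuous_fmode)

lemma sq_integrable_cmult:
  fixes f :: "real^'d \<Rightarrow> complex"
  assumes "sq_integrable L f" shows "sq_integrable L (\<lambda>x. c * f x)"
  by (rule sq_integrable_bounded_linear[OF bounded_linear_mult_right assms])

lemma cfc_trig:
  assumes L: "\<And>i. 0 < L $ i" and "finite X"
  shows "cfc L (trig L c X) \<xi> = (if \<xi> \<in> X then c \<xi> else 0)"
  using \<open>finite X\<close>
proof induction
  case empty
  then show ?case by (simp add: trig_def cfc_def)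
next
  case (insert \<eta> X)
  have "trig L c (insert \<eta> X) = (\<lambda>x. c \<eta> * fmode L \<eta> x + trig L c X x)"
    using insert by (simp add: trig_def fun_eq_iff)
  then have "cfc L (trig L c (insert \<eta> X)) \<xi> = c \<eta> * cfc L (fmode L \<eta>) \<xi> + cfc L (trig L c X) \<xi>"
    by (simp add: cfc_add cfc_cmult sq_integrable_integrable sq_integrable_trig sq_integrable_fmode)
  then show ?case using insert by (auto simp: cfc_fmode[OF L])
qed

text \<open>The residual \<open>r\<close> still has coefficient \<open>c\<close> at a new frequency,
  so subtracting that mode changes its squared norm by -2 V |c|^2 + V |c|^2, where V is the volume
  of the cell.\<close>

lemma Bessel_identity:
  fixes f :: "real^'d \<Rightarrow> complex"
  assumes L: "\<And>i. 0 < L $ i" and f: "sq_integrable L f" and "finite X"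
  shows "(l2 L (\<lambda>x. f x - trig L (cfc L f) X x))\<^sup>2 =
    (l2 L f)\<^sup>2 - measure lebesgue (cell L) * (\<Sum>\<xi>\<in>X. (cmod (cfc L f \<xi>))\<^sup>2)"
  using \<open>finite X\<close>
proof induction
  case empty
  then show ?case by (simp add: trig_def)
next
  case (insert \<xi> X)
  let ?V = "measure lebesgue (cell L)"
  define c where "c = cfc L f \<xi>"
  define r where "r x = f x - trig L (cfc L f) X x" for x
  define g where "g x = - c * fmode L \<xi> x" for x
  have r: "sq_integrable L r" unfolding r_def by (intro sq_integrable_diff f sq_integrable_trig)
  have g: "sq_integrable L g" unfolding g_def by (intro sq_integrable_cmult sq_integrable_fmode)
  have "cfc L r \<xi> = c"
    unfolding r_def c_def using insert f
    by (simp add: cfc_diff cfc_trig[OF L] sq_integrable_integrable sq_integrable_trig)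
  then have int: "(\<integral>x. r x * cnj (fmode L \<xi> x) \<partial>cellM L) = ?V * c"
    using measure_cell_pos[OF L] by (simp add: cfc_def field_simps)
  have "r x \<bullet> g x = - Re (cnj c * (r x * cnj (fmode L \<xi> x)))" for x
    by (simp add: g_def inner_complex_def algebra_simps)
  then have "(\<integral>x. r x \<bullet> g x \<partial>cellM L) = - (\<integral>x. Re (cnj c * (r x * cnj (fmode L \<xi> x))) \<partial>cellM L)"
    by (simp only: Bochner_Integration.integral_minus)
  also have "\<dots> = - Re (\<integral>x. cnj c * (r x * cnj (fmode L \<xi> x)) \<partial>cellM L)"
    using integrable_mult_fmode[OF sq_integrable_integrable[OF r], of \<xi>] by (subst integral_Re) auto
  also have "\<dots> = - ?V * (cmod c)\<^sup>2"
  proof -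
    have "(\<integral>x. cnj c * (r x * cnj (fmode L \<xi> x)) \<partial>cellM L) = cnj c * (?V * c)"
      by (simp add: int)
    also have "\<dots> = complex_of_real (?V * (cmod c)\<^sup>2)"
      using complex_norm_square[of c] by (simp add: mult_ac)
    finally show ?thesis by simp
  qed
  finally have "(\<integral>x. r x \<bullet> g x \<partial>cellM L) = - ?V * (cmod c)\<^sup>2" .
  moreover have "(l2 L g)\<^sup>2 = ?V * (cmod c)\<^sup>2"
    by (simp add: l2_power2 g_def norm_mult measure_cellM)
  moreover have "(\<lambda>x. f x - trig L (cfc L f) (insert \<xi> X) x) = (\<lambda>x. r x + g x)"
    using insert by (simp add: fun_eq_iff r_def g_def trig_def c_def)
  moreover have "(l2 L r)\<^sup>2 = (l2 L f)\<^sup>2 - ?V * (\<Sum>\<xi>\<in>X. (cmod (cfc L f \<xi>))\<^sup>2)"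
    using insert.IH unfolding r_def .
  ultimately show ?case
    using insert l2_power2_add[OF r g] by (simp add: c_def algebra_simps)
qed

lemma Bessel_inequality:
  fixes f :: "real^'d \<Rightarrow> complex"
  assumes L: "\<And>i. 0 < L $ i" and f: "sq_integrable L f" and "finite X"
  shows "measure lebesgue (cell L) * (\<Sum>\<xi>\<in>X. (cmod (cfc L f \<xi>))\<^sup>2) \<le> (l2 L f)\<^sup>2"
  using Bessel_identity[OF assms] zero_le_power2[of "l2 L (\<lambda>x. f x - trig L (cfc L f) X x)"] by linarith

lemma cmod_cfc_le:
  fixes f :: "real^'d \<Rightarrow> complex"
  assumes L: "\<And>i. 0 < L $ i" and f: "sq_integrable L f"
  shows "cmod (cfc L f \<xi>) \<le> l2 L f / sqrt (measure lebesgue (cell L))"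
proof -
  let ?V = "measure lebesgue (cell L)"
  have "(sqrt ?V * cmod (cfc L f \<xi>))\<^sup>2 \<le> (l2 L f)\<^sup>2"
    using Bessel_inequality[OF assms, of "{\<xi>}"] by (simp add: power_mult_distrib)
  then have "sqrt ?V * cmod (cfc L f \<xi>) \<le> l2 L f" by (rule power2_le_imp_le) simp
  then show ?thesis using measure_cell_pos[OF L] by (simp add: field_simps)
qed

lemma l2_trig:
  assumes L: "\<And>i. 0 < L $ i" and "finite X"
  shows "(l2 L (trig L c X))\<^sup>2 = measure lebesgue (cell L) * (\<Sum>\<xi>\<in>X. (cmod (c \<xi>))\<^sup>2)"
proof -
  have "trig L (cfc L (trig L c X)) X = trig L c X"
    using assms by (simp add: fun_eq_iff trig_def[of L "cfc L _"] trig_def[of L c] cfc_trig)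
  then show ?thesis
    using Bessel_identity[OF L sq_integrable_trig[of L c X] \<open>finite X\<close>] assms
    by (simp add: cfc_trig l2_const)
qed

lemma trig_diff_subset:
  assumes "finite Y" "X \<subseteq> Y"
  shows "trig L c Y x - trig L c X x = trig L c (Y - X) x"
  using assms by (simp add: trig_def sum_diff)

lemma cfc_l2_limit:
  fixes w :: "real^'d \<Rightarrow> complex"
  assumes L: "\<And>i. 0 < L $ i" and w: "sq_integrable L w" and f: "\<And>n. sq_integrable L (f n)"
    and lim: "(\<lambda>n. l2 L (\<lambda>x. f n x - w x)) \<longlonglongrightarrow> 0"
  shows "(\<lambda>n. cfc L (f n) \<xi>) \<longlonglongrightarrow> cfc L w \<xi>"
proof -
  let ?V = "sqrt (measure lebesgue (cell L))"
  have "(\<lambda>n. cfc L (f n) \<xi> - cfc L w \<xi>) \<longlonglongrightarrow> 0"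
  proof (rule Lim_null_comparison[OF always_eventually])
    show "\<forall>n. norm (cfc L (f n) \<xi> - cfc L w \<xi>) \<le> l2 L (\<lambda>x. f n x - w x) / ?V"
    proof
      fix n
      have "cfc L (\<lambda>x. f n x - w x) \<xi> = cfc L (f n) \<xi> - cfc L w \<xi>"
        by (intro cfc_diff sq_integrable_integrable f w)
      then show "norm (cfc L (f n) \<xi> - cfc L w \<xi>) \<le> l2 L (\<lambda>x. f n x - w x) / ?V"
        using cmod_cfc_le[OF L sq_integrable_diff[OF f[of n] w], of \<xi>] by simp
    qed
    show "(\<lambda>n. l2 L (\<lambda>x. f n x - w x) / ?V) \<longlonglongrightarrow> 0"
      using tendsto_divide_zero[OF lim] .
  qed
  then show ?thesis using Lim_null by blast
qed

text \<open>The partial sums are taken over increasing finite sets \<open>Y n\<close> whose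
  remaining tail is below 4^-n. Orthogonality then makes consecutive sums 2^-n close up to the
  factor sqrt V, the geometric decay that \<open>l2_complete\<close> asks for.\<close>

lemma Riesz_Fischer_complex:
  fixes L :: "real^'d"
  assumes L: "\<And>i. 0 < L $ i" and c: "(\<lambda>\<xi>. (cmod (c \<xi>))\<^sup>2) summable_on UNIV"
  obtains w where "sq_integrable L w" "\<And>\<xi>. cfc L w \<xi> = c \<xi>"
    "(l2 L w)\<^sup>2 \<le> measure lebesgue (cell L) * (\<Sum>\<^sub>\<infinity>\<xi>. (cmod (c \<xi>))\<^sup>2)"
proof -
  let ?V = "measure lebesgue (cell L)"
  let ?h = "\<lambda>\<xi>. (cmod (c \<xi>))\<^sup>2"
  define s where "s = infsum ?h UNIV"
  have V: "0 < ?V" by (rule measure_cell_pos[OF L])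
  have tail: "sum ?h F + sum ?h X \<le> s" if "finite F" "finite X" "F \<inter> X = {}" for F X
  proof -
    have "sum ?h F + sum ?h X = sum ?h (F \<union> X)" using that by (simp add: sum.union_disjoint)
    also have "\<dots> \<le> s" unfolding s_def using that by (intro finite_sum_le_infsum c) auto
    finally show ?thesis .
  qed
  have "\<exists>X. finite X \<and> s - sum ?h X < (1/4)^n" for n
  proof -
    have "(sum ?h \<longlongrightarrow> s) (finite_subsets_at_top UNIV)"
      unfolding s_def by (rule infsum_tendsto[OF c])
    then have "eventually (\<lambda>X. s - (1/4)^n < sum ?h X) (finite_subsets_at_top UNIV)"
      by (rule order_tendstoD) simp
    then obtain X where "finite X" "s - (1/4)^n < sum ?h X"
      unfolding eventually_finite_subsets_at_top by blast
    then show ?thesis by (intro exI[of _ X]) simp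
  qed
  then obtain X where X: "\<And>n. finite (X n)" "\<And>n. s - sum ?h (X n) < (1/4)^n" by metis
  define Y where "Y n = (\<Union>k\<le>n. X k)" for n
  have Y: "finite (Y n)" "Y n \<subseteq> Y (Suc n)" for n
    unfolding Y_def using X by (simp, intro UN_mono) auto
  have Ys: "s - sum ?h (Y n) < (1/4)^n" for n
  proof -
    have "sum ?h (X n) \<le> sum ?h (Y n)"
      using Y(1) by (intro sum_mono2) (auto simp: Y_def)
    then show ?thesis using X(2)[of n] by linarith
  qed
  define f where "f n = trig L c (Y n)" for n
  have f: "sq_integrable L (f n)" for n unfolding f_def by (rule sq_integrable_trig)
  have step: "l2 L (\<lambda>x. f (Suc n) x - f n x) \<le> sqrt ?V * (1/2)^n" for n
  proof (rule power2_le_imp_le)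
    have "(l2 L (\<lambda>x. f (Suc n) x - f n x))\<^sup>2 = (l2 L (trig L c (Y (Suc n) - Y n)))\<^sup>2"
      using Y by (simp add: f_def trig_diff_subset)
    also have "\<dots> = ?V * sum ?h (Y (Suc n) - Y n)"
      using Y by (intro l2_trig L) auto
    also have "\<dots> \<le> ?V * (1/4)^n"
      using tail[of "Y (Suc n) - Y n" "Y n"] Ys[of n] Y V Diff_disjoint[of "Y n" "Y (Suc n)"]
      by (intro mult_left_mono) (auto simp: Int_commute)
    also have "\<dots> = (sqrt ?V * (1/2)^n)\<^sup>2"
      using V by (simp add: power_mult_distrib power_mult[symmetric] mult.commute[of n])
        (simp add: power_mult power2_eq_square)
    finally show "(l2 L (\<lambda>x. f (Suc n) x - f n x))\<^sup>2 \<le> (sqrt ?V * (1/2)^n)\<^sup>2" .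
  qed simp
  have half: "0 \<le> (1/2::real)" "(1/2::real) < 1" by simp_all
  obtain w where w: "sq_integrable L w" "\<And>n. l2 L (\<lambda>x. f n x - w x) \<le> sqrt ?V / (1 - 1/2) * (1/2)^n"
    using l2_complete[OF f half step] by blast
  have lim: "(\<lambda>n. l2 L (\<lambda>x. f n x - w x)) \<longlonglongrightarrow> 0"
  proof (rule Lim_null_comparison[OF always_eventually])
    show "\<forall>n. norm (l2 L (\<lambda>x. f n x - w x)) \<le> sqrt ?V / (1 - 1/2) * (1/2)^n"
      using w(2) by simp
    show "(\<lambda>n. sqrt ?V / (1 - 1/2) * (1/2)^n) \<longlonglongrightarrow> 0"
      by (intro tendsto_mult_right_zero LIMSEQ_power_zero) simp
  qed
  have coeff: "cfc L w \<xi> = c \<xi>" for \<xi>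
  proof -
    have "(\<lambda>n. cfc L (f n) \<xi>) \<longlonglongrightarrow> c \<xi>"
    proof (cases "\<exists>n. \<xi> \<in> Y n")
      case True
      then obtain n where n: "\<xi> \<in> Y n" by blast
      have "\<xi> \<in> Y m" if "n \<le> m" for m
        using n that by (fastforce simp: Y_def)
      then have "eventually (\<lambda>m. cfc L (f m) \<xi> = c \<xi>) sequentially"
        unfolding f_def using Y by (auto simp: cfc_trig[OF L] eventually_sequentially)
      then show ?thesis by (rule tendsto_eventually)
    next
      \<comment> \<open>A frequency outside every \<open>Y n\<close> lies in all the tails, so the
        square of its coefficient is at most 4^-n for every \<open>n\<close>. It vanishes, as it
        does in all partial sums.\<close>
      case False
      have "?h \<xi> \<le> (1/4)^n" for n
        using tail[of "{\<xi>}" "Y n"] Ys[of n] False Y by auto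
      then have "?h \<xi> \<le> 0"
        by (intro LIMSEQ_le_const[OF LIMSEQ_power_zero[of "1/4::real"]]) auto
      then show ?thesis
        unfolding f_def using Y False by (simp add: cfc_trig[OF L])
    qed
    then show ?thesis
      using cfc_l2_limit[OF L w(1) f lim, of \<xi>] LIMSEQ_unique by blast
  qed
  have "(l2 L w)\<^sup>2 \<le> ?V * s"
  proof -
    have "l2 L w \<le> sqrt (?V * s) + l2 L (\<lambda>x. f n x - w x)" for n
    proof -
      have "l2 L w \<le> l2 L (\<lambda>x. w x - f n x) + l2 L (f n)"
        using l2_triangle[OF sq_integrable_diff[OF w(1) f[of n]] f[of n]] by simp
      moreover have "l2 L (f n) \<le> sqrt (?V * s)"
      proof (rule real_le_rsqrt)
        have "sum ?h (Y n) \<le> s" unfolding s_def by (intro finite_sum_le_infsum c Y) auto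
        then show "(l2 L (f n))\<^sup>2 \<le> ?V * s"
          unfolding f_def using V by (simp add: l2_trig[OF L Y(1)])
      qed
      ultimately show ?thesis by (simp add: l2_minus_commute)
    qed
    moreover have "(\<lambda>n. sqrt (?V * s) + l2 L (\<lambda>x. f n x - w x)) \<longlonglongrightarrow> sqrt (?V * s) + 0"
      by (intro tendsto_intros lim)
    ultimately have "l2 L w \<le> sqrt (?V * s)"
      using LIMSEQ_le_const by fastforce
    moreover have "0 \<le> ?V * s" unfolding s_def using V by (intro mult_nonneg_nonneg infsum_nonneg) auto
    ultimately show ?thesis
      using real_sqrt_pow2 power_mono[of "l2 L w" "sqrt (?V * s)" 2] by simp
  qed
  then show ?thesis using that w(1) coeff by (simp add: s_def)
qed

subsection \<open>Completeness of the trigonometric system\<close>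

inductive_set trig_polys :: "real^'d \<Rightarrow> (real^'d \<Rightarrow> complex) set" for L where
  trig_polys_fmode: "(\<lambda>x. c * fmode L \<xi> x) \<in> trig_polys L"
| trig_polys_add: "f \<in> trig_polys L \<Longrightarrow> g \<in> trig_polys L \<Longrightarrow> (\<lambda>x. f x + g x) \<in> trig_polys L"

lemma trig_polys_const: "(\<lambda>x. c) \<in> trig_polys L"
  using trig_polys_fmode[of c L 0] by simp

lemma trig_polys_mult:
  assumes "f \<in> trig_polys L" "g \<in> trig_polys L"
  shows "(\<lambda>x. f x * g x) \<in> trig_polys L"
  using assms
proof (induction arbitrary: g)
  case (trig_polys_fmode c \<xi>)
  show ?case using trig_polys_fmode.prems
  proof induction
    case (trig_polys_fmode d \<eta>)
    show ?case
      using trig_polys.trig_polys_fmode[of "c * d" L "\<xi> + \<eta>"] by (simp add: fmode_add mult_ac)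
  next
    case (trig_polys_add f g)
    then show ?case
      using trig_polys.trig_polys_add by (simp add: distrib_left)
  qed
next
  case (trig_polys_add f1 f2)
  then show ?case
    using trig_polys.trig_polys_add[OF trig_polys_add.IH(1)[OF trig_polys_add.prems] trig_polys_add.IH(2)[OF trig_polys_add.prems]]
    by (simp add: distrib_right)
qed

lemma trig_polys_sum:
  assumes "\<And>i. i \<in> I \<Longrightarrow> f i \<in> trig_polys L"
  shows "(\<lambda>x. \<Sum>i\<in>I. f i x) \<in> trig_polys L"
  using assms
  by (induction I rule: infinite_finite_induct) (auto intro: trig_polys_const trig_polys_add)

lemma integral_trig_polys_eq_0:
  fixes f :: "real^'d \<Rightarrow> real"
  assumes V: "measure lebesgue (cell L) \<noteq> 0" and f: "integrable (cellM L) f" and 0: "\<And>\<xi>. fourier_coeff L f \<xi> = 0"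
    and p: "p \<in> trig_polys L"
  shows "integrable (cellM L) (\<lambda>x. of_real (f x) * p x) \<and> (\<integral>x. of_real (f x) * p x \<partial>cellM L) = 0"
  using p
proof induction
  case (trig_polys_fmode c \<xi>)
  have int: "integrable (cellM L) (\<lambda>x. complex_of_real (f x) * fmode L \<xi> x)"
    using integrable_mult_fmode[of L "\<lambda>x. of_real (f x)" "- \<xi>"] f by (simp add: fmode_minus)
  have "(\<integral>x. of_real (f x) * fmode L \<xi> x \<partial>cellM L) = 0"
    using 0[of "- \<xi>"] V by (simp add: fourier_coeff_cfc cfc_def fmode_minus)
  then show ?case
    using int by (simp add: mult.left_commute[of _ c])
next
  case (trig_polys_add f g)
  then show ?case by (simp add: distrib_left)
qed

text \<open>Maps the cell to a product of unit circles. Real polynomials on the ambient space pull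
  back to trigonometric polynomials, so the Stone-Weierstrass theorem can be used for ordinary
  polynomials on the compact image.\<close>

definition torus_embed :: "real^'d \<Rightarrow> real^'d \<Rightarrow> complex^'d" where
  "torus_embed L x = (\<chi> j. fmode L (axis j 1) x)"

lemma continuous_torus_embed: "continuous_on S (torus_embed L)"
  unfolding torus_embed_def
  by (intro continuous_on_vec_lambda) (rule continuous_fmode)

lemma trig_polys_of_linear:
  fixes h :: "complex^'d \<Rightarrow> real"
  assumes "bounded_linear h"
  shows "(\<lambda>x. complex_of_real (h (torus_embed L x))) \<in> trig_polys L"
proof -
  have lin: "linear h" using assms bounded_linear.linear by blast
  define a where "a j = h (axis j 1)" for j
  define b where "b j = h (axis j \<i>)" for j
  have h: "h z = (\<Sum>j\<in>UNIV. a j * Re (z $ j) + b j * Im (z $ j))" for z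
  proof -
    have "z = (\<Sum>j\<in>UNIV. Re (z $ j) *\<^sub>R axis j 1 + Im (z $ j) *\<^sub>R axis j \<i>)"
      by (simp add: vec_eq_iff axis_def if_distrib sum.distrib complex_eq_iff cong: if_cong)
    then have "h z = h (\<Sum>j\<in>UNIV. Re (z $ j) *\<^sub>R axis j 1 + Im (z $ j) *\<^sub>R axis j \<i>)" by simp
    also have "\<dots> = (\<Sum>j\<in>UNIV. a j * Re (z $ j) + b j * Im (z $ j))"
      by (simp add: linear_sum[OF lin] linear_add[OF lin] linear_scale[OF lin] a_def b_def mult.commute)
    finally show ?thesis .
  qed
  have ReIm: "complex_of_real (s * Re w + t * Im w) = ((s - \<i> * t) / 2) * w + ((s + \<i> * t) / 2) * cnj w"
    for s t :: real and w
    by (simp add: complex_eq_iff field_simps)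
  have "complex_of_real (h (torus_embed L x)) =
      (\<Sum>j\<in>UNIV. ((a j - \<i> * b j) / 2) * fmode L (axis j 1) x + ((a j + \<i> * b j) / 2) * fmode L (- axis j 1) x)" for x
    unfolding h of_real_sum torus_embed_def
    by (intro sum.cong refl) (simp only: ReIm fmode_minus vec_lambda_beta)
  moreover have "(\<lambda>x. \<Sum>j\<in>UNIV. ((a j - \<i> * b j) / 2) * fmode L (axis j 1) x + ((a j + \<i> * b j) / 2) * fmode L (- axis j 1) x) \<in> trig_polys L"
    by (intro trig_polys_sum trig_polys_add trig_polys_fmode)
  ultimately show ?thesis by simp
qed

lemma trig_polys_of_polynomial:
  assumes "real_polynomial_function h"
  shows "(\<lambda>x. complex_of_real (h (torus_embed L x))) \<in> trig_polys L"
  using assms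
  by induction (auto intro: trig_polys_of_linear trig_polys_const trig_polys_add trig_polys_mult)

text \<open>A polynomial within \<open>e\<close> of \<open>h\<close> on the image of the cell has
  zero integral against \<open>f\<close>, which leaves an error of at most \<open>e\<close> times
  the L^1 norm of \<open>f\<close>.\<close>

lemma integral_continuous_torus_eq_0:
  fixes f :: "real^'d \<Rightarrow> real" and h :: "complex^'d \<Rightarrow> real"
  assumes V: "measure lebesgue (cell L) \<noteq> 0" and f: "integrable (cellM L) f"
    and 0: "\<And>\<xi>. fourier_coeff L f \<xi> = 0"
    and h: "continuous_on UNIV h"
  shows "(\<integral>x. f x * h (torus_embed L x) \<partial>cellM L) = 0"
proof -
  have comp: "compact (torus_embed L ` cell L)"
    unfolding cell_def by (intro compact_continuous_image continuous_torus_embed compact_cbox)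
  have [measurable]: "f \<in> borel_measurable (cellM L)" using f by auto
  have te: "torus_embed L \<in> borel_measurable (cellM L)"
    using continuous_sq_integrable[OF continuous_torus_embed[of UNIV L], of L] by (simp add: sq_integrable_def)
  have hm [measurable]: "(\<lambda>x. h (torus_embed L x)) \<in> borel_measurable (cellM L)"
    using borel_measurable_continuous_on[OF h te] .
  let ?I = "\<integral>x. norm (f x) \<partial>cellM L"
  have "\<bar>\<integral>x. f x * h (torus_embed L x) \<partial>cellM L\<bar> \<le> e * ?I" if e: "0 < e" for e
  proof -
    obtain p where p: "real_polynomial_function p" "\<And>z. z \<in> torus_embed L ` cell L \<Longrightarrow> \<bar>h z - p z\<bar> < e"
      using Stone_Weierstrass_real_polynomial_function[OF comp continuous_on_subset[OF h subset_UNIV] e] by auto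
    have "continuous_on UNIV p" using p(1) continuous_on_polymonial_function real_polynomial_function_eq by blast
    from borel_measurable_continuous_on[OF this te]
    have [measurable]: "(\<lambda>x. p (torus_embed L x)) \<in> borel_measurable (cellM L)" .
    have P: "integrable (cellM L) (\<lambda>x. complex_of_real (f x * p (torus_embed L x)))"
        "(\<integral>x. complex_of_real (f x * p (torus_embed L x)) \<partial>cellM L) = 0"
      using integral_trig_polys_eq_0[OF V f 0 trig_polys_of_polynomial[OF p(1)]] by auto
    have P1: "integrable (cellM L) (\<lambda>x. f x * p (torus_embed L x))"
      using P(1) by (simp only: complex_of_real_integrable_eq)
    have P2: "(\<integral>x. f x * p (torus_embed L x) \<partial>cellM L) = 0"
      using P(2) by (simp only: integral_complex_of_real) simp
    have bd: "norm (f x * (h (torus_embed L x) - p (torus_embed L x))) \<le> e * norm (f x)" if "x \<in> cell L" for x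
      using mult_left_mono[OF less_imp_le[OF p(2)[of "torus_embed L x"]], of "\<bar>f x\<bar>"] that
      by (simp add: abs_mult mult.commute[of e])
    have D: "integrable (cellM L) (\<lambda>x. f x * (h (torus_embed L x) - p (torus_embed L x)))"
      by (rule Bochner_Integration.integrable_bound[of _ "\<lambda>x. e * norm (f x)"])
        (use f bd e in \<open>auto intro!: AE_I2 simp: abs_mult\<close>)
    have "(\<integral>x. f x * h (torus_embed L x) \<partial>cellM L) =
        (\<integral>x. f x * (h (torus_embed L x) - p (torus_embed L x)) + f x * p (torus_embed L x) \<partial>cellM L)"
      by (simp add: algebra_simps)
    also have "\<dots> = (\<integral>x. f x * (h (torus_embed L x) - p (torus_embed L x)) \<partial>cellM L)"
      using D P1 P2 by (simp only: Bochner_Integration.integral_add)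
    finally have "\<bar>\<integral>x. f x * h (torus_embed L x) \<partial>cellM L\<bar> \<le>
        (\<integral>x. norm (f x * (h (torus_embed L x) - p (torus_embed L x))) \<partial>cellM L)"
      using integral_norm_bound[of "cellM L" "\<lambda>x. f x * (h (torus_embed L x) - p (torus_embed L x))"] by simp
    also have "\<dots> \<le> (\<integral>x. e * norm (f x) \<partial>cellM L)"
      using D f bd by (intro integral_mono) (auto simp del: norm_mult real_norm_def)
    finally show ?thesis by simp
  qed
  note le = this
  have "\<bar>\<integral>x. f x * h (torus_embed L x) \<partial>cellM L\<bar> \<le> 0 + e" if "0 < e" for e
  proof -
    have I: "0 \<le> ?I" by simp
    \<comment> \<open>Adding 1 in the denominator keeps the tolerance positive when the L^1 norm is
      0.\<close>
    have "\<bar>\<integral>x. f x * h (torus_embed L x) \<partial>cellM L\<bar> \<le> e / (?I + 1) * ?I"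
      using that I by (intro le divide_pos_pos) linarith+
    moreover have "e / (i + 1) * i \<le> e" if "0 \<le> i" for i
      using that \<open>0 < e\<close> by (simp add: field_simps)
    from this[OF I] have "e / (?I + 1) * ?I \<le> e" .
    ultimately show ?thesis by linarith
  qed
  then have "\<bar>\<integral>x. f x * h (torus_embed L x) \<partial>cellM L\<bar> \<le> 0"
    by (rule field_le_epsilon)
  then show ?thesis by simp
qed

text \<open>Equal images mean that the rescaled coordinates differ by integers. Opposite faces of
  the closed cell do have the same image; taking one of the points in the open box makes each
  difference less than 1 in modulus, hence 0.\<close>

lemma torus_embed_inj:
  assumes L: "\<And>i. 0 < L $ i" and x: "x \<in> box 0 L" and y: "y \<in> cbox 0 L"
    and eq: "torus_embed L x = torus_embed L y"
  shows "x = y"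
proof -
  have "x $ j = y $ j" for j
  proof -
    have f: "freq L (axis j 1) \<bullet> z = 2 * pi * (z $ j / L $ j)" for z
    proof -
      have "freq L (axis j 1) = axis j (2 * pi / L $ j)"
        by (simp add: freq_def vec_eq_iff axis_def)
      then show ?thesis by (simp add: inner_axis')
    qed
    have xj: "0 < x $ j" "x $ j < L $ j" and yj: "0 \<le> y $ j" "y $ j \<le> L $ j"
      using x y by (auto simp: mem_box_cart)
    have "cis (2 * pi * (x $ j / L $ j)) = cis (2 * pi * (y $ j / L $ j))"
      using arg_cong[OF eq, of "\<lambda>v. v $ j"] by (simp add: torus_embed_def fmode_def f)
    then have "cis (2 * pi * (x $ j / L $ j) - 2 * pi * (y $ j / L $ j)) = 1"
      by (simp add: cis_divide[symmetric])
    then obtain n :: int where "2 * pi * (x $ j / L $ j) - 2 * pi * (y $ j / L $ j) = of_int n * 2 * pi"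
      using complex_eq_iff[of "cis _" 1] by (auto simp: cos_one_2pi_int)
    then have "2 * pi * (x $ j / L $ j - y $ j / L $ j) = 2 * pi * of_int n"
      by (simp add: algebra_simps)
    then have n: "x $ j / L $ j - y $ j / L $ j = of_int n" by simp
    moreover have "0 < x $ j / L $ j" "x $ j / L $ j < 1" "0 \<le> y $ j / L $ j" "y $ j / L $ j \<le> 1"
      using xj yj L[of j] by (auto simp: field_simps)
    ultimately have "of_int n < (1::real)" "-1 < (of_int n :: real)" by linarith+
    then have "n = 0" by linarith
    then show ?thesis using n L[of j] by (simp add: field_simps)
  qed
  then show ?thesis by (simp add: vec_eq_iff)
qed

text \<open>The cut-offs min(1, n dist(z, K)), pulled back to the cell, converge pointwise to the
  indicator of \<open>W\<close>: \<open>K\<close> is the closed image of the complement of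
  \<open>W\<close>, and injectivity keeps the images of points of \<open>W\<close> outside
  it.\<close>

lemma integral_open_eq_0:
  fixes f :: "real^'d \<Rightarrow> real"
  assumes L: "\<And>i. 0 < L $ i" and f: "integrable (cellM L) f" and 0: "\<And>\<xi>. fourier_coeff L f \<xi> = 0"
    and W: "open W" "W \<subseteq> box 0 L"
  shows "(\<integral>x. f x * indicator W x \<partial>cellM L) = 0"
proof -
  have V: "measure lebesgue (cell L) \<noteq> 0" using measure_cell_pos[OF L] by simp
  define K where "K = torus_embed L ` (cell L - W)"
  have "compact (cell L - W)" unfolding cell_def by (intro compact_diff compact_cbox W)
  then have K: "closed K" unfolding K_def
    by (intro compact_imp_closed compact_continuous_image continuous_torus_embed)
  have "0 \<in> cell L - W"
    using W(2) L by (auto simp: cell_def mem_box_cart less_imp_le subset_iff)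
  then have Kne: "K \<noteq> {}" by (auto simp: K_def)
  have inK: "torus_embed L x \<in> K \<longleftrightarrow> x \<notin> W" if "x \<in> cell L" for x
    using that torus_embed_inj[OF L] W(2) by (fastforce simp: K_def cell_def)
  define h where "h n z = min 1 (real n * infdist z K)" for n and z :: "complex^'d"
  have hc: "continuous_on UNIV (h n)" for n unfolding h_def by (intro continuous_intros)
  have te: "torus_embed L \<in> borel_measurable (cellM L)"
    using continuous_sq_integrable[OF continuous_torus_embed[of UNIV L], of L] by (simp add: sq_integrable_def)
  have [measurable]: "(\<lambda>x. h n (torus_embed L x)) \<in> borel_measurable (cellM L)" for n
    using borel_measurable_continuous_on[OF hc te] .
  have [measurable]: "f \<in> borel_measurable (cellM L)" using f by auto
  have [measurable]: "W \<in> sets (cellM L)"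
    using W order_trans[OF W(2) box_subset_cbox] by (auto simp: sets_restrict_space_iff cell_def)
  have h01: "0 \<le> h n z" "h n z \<le> 1" for n z by (auto simp: h_def infdist_nonneg)
  have "(\<lambda>n. \<integral>x. f x * h n (torus_embed L x) \<partial>cellM L) \<longlonglongrightarrow> (\<integral>x. f x * indicator W x \<partial>cellM L)"
  proof (rule integral_dominated_convergence[where w="\<lambda>x. norm (f x)"])
    show "AE x in cellM L. (\<lambda>n. f x * h n (torus_embed L x)) \<longlonglongrightarrow> f x * indicator W x"
    proof (intro AE_I2 tendsto_intros)
      fix x assume "x \<in> space (cellM L)"
      then have x: "x \<in> cell L" by simp
      show "(\<lambda>n. h n (torus_embed L x)) \<longlonglongrightarrow> indicator W x"
      proof (cases "x \<in> W")
        case False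
        then have "infdist (torus_embed L x) K = 0" using inK[OF x] by simp
        then show ?thesis using False by (simp add: h_def)
      next
        case True
        then have "torus_embed L x \<notin> K" using inK[OF x] by simp
        then have pos: "0 < infdist (torus_embed L x) K"
          using K Kne in_closed_iff_infdist_zero infdist_nonneg by (metis order_le_less)
        then obtain N where N: "1 < real N * infdist (torus_embed L x) K"
          using ex_less_of_nat_mult by blast
        have "h n (torus_embed L x) = 1" if "N \<le> n" for n
        proof -
          have "real N * infdist (torus_embed L x) K \<le> real n * infdist (torus_embed L x) K"
            using that pos by (intro mult_right_mono) auto
          then show ?thesis using N by (simp add: h_def)
        qed
        then have "eventually (\<lambda>n. h n (torus_embed L x) = 1) sequentially"
          by (auto simp: eventually_sequentially)
        then show ?thesis using True by (auto intro: tendsto_eventually)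
      qed
    qed
    show "AE x in cellM L. norm (f x * h n (torus_embed L x)) \<le> norm (f x)" for n
      using h01 by (auto intro!: AE_I2 mult_left_le simp: abs_mult)
    show "integrable (cellM L) (\<lambda>x. norm (f x))" using f by simp
  qed measurable
  then show ?thesis
    using integral_continuous_torus_eq_0[OF V f 0 hc] LIMSEQ_unique[OF tendsto_const] by force
qed

lemma AE_box_of_cell:
  assumes "AE x in cellM L. x \<in> box 0 L \<longrightarrow> P x"
  shows "AE x in cellM L. P x"
proof -
  have "negligible (cbox 0 L - box 0 L)" by (rule negligible_frontier_interval)
  then have "cbox 0 L - box 0 L \<in> null_sets lebesgue" by (simp add: negligible_iff_null_sets)
  then have "AE x in lebesgue. x \<notin> cbox 0 L - box 0 L" by (rule AE_not_in)
  then have "AE x in cellM L. x \<notin> cbox 0 L - box 0 L"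
    by (subst AE_restrict_space_iff) (auto simp: cell_def elim: eventually_mono)
  moreover have "AE x in cellM L. x \<in> cbox 0 L"
    by (intro AE_I2) (simp add: cell_def)
  ultimately show ?thesis using assms by eventually_elim auto
qed

text \<open>The integral of \<open>f\<close> over the set \<open>A\<close> where it is positive is
  shown to be 0, so \<open>A\<close> must be null. Outer regularity reduces \<open>A\<close> to open
  sets, for which the integral is already known to vanish.\<close>

lemma fourier_coeff_zero_imp_nonpos:
  fixes f :: "real^'d \<Rightarrow> real"
  assumes L: "\<And>i. 0 < L $ i" and f: "integrable (cellM L) f" and 0: "\<And>\<xi>. fourier_coeff L f \<xi> = 0"
  shows "AE x in cellM L. f x \<le> 0"
proof -
  define A where "A = {x \<in> cell L. x \<in> box 0 L \<and> 0 < f x}"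
  have fm [measurable]: "f \<in> borel_measurable (cellM L)" using f by auto
  have "A = {x \<in> space (cellM L). 0 < f x} \<inter> box 0 L" by (auto simp: A_def)
  moreover have "box 0 L \<in> sets (cellM L)"
    using box_subset_cbox[of 0 L] by (auto simp: sets_restrict_space_iff cell_def)
  moreover have "{x \<in> space (cellM L). 0 < f x} \<in> sets (cellM L)" by measurable
  ultimately have Am: "A \<in> sets (cellM L)" by (simp only: sets.Int)
  then have A: "A \<in> sets lebesgue" by (auto simp: sets_restrict_space_iff cell_def)
  have "\<exists>T. open T \<and> A \<subseteq> T \<and> T - A \<in> lmeasurable \<and> emeasure lebesgue (T - A) < ennreal ((1/2)^n)" for n
    using sets_lebesgue_outer_open[OF A, of "(1/2)^n"] by (metis zero_less_power half_gt_zero zero_less_one)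
  then obtain T where T: "\<And>n. open (T n)" "\<And>n. A \<subseteq> T n" "\<And>n. T n - A \<in> lmeasurable"
      "\<And>n. emeasure lebesgue (T n - A) < ennreal ((1/2)^n)"
    by metis
  define W where "W n = T n \<inter> box 0 L" for n
  have W: "open (W n)" "W n \<subseteq> box 0 L" "A \<subseteq> W n" for n
    using T by (auto simp: W_def A_def)
  have Wm [measurable]: "W n \<in> sets (cellM L)" for n
    using W(1)[of n] order_trans[OF W(2) box_subset_cbox] by (auto simp: sets_restrict_space_iff cell_def)
  \<comment> \<open>The excess measures are below 2^-n, so by Borel-Cantelli almost every point lies
    in only finitely many of the sets \<open>T n - A\<close>. Hence the indicators of
    \<open>W n\<close> converge almost everywhere to that of \<open>A\<close>.\<close>
  have "AE x in lebesgue. \<forall>\<^sub>F n in sequentially. x \<in> space lebesgue - (T n - A)"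
  proof (rule borel_cantelli_AE1)
    show "T n - A \<in> sets lebesgue" for n using T(3) by (rule fmeasurableD)
    show "emeasure lebesgue (T n - A) < \<infinity>" for n using T(4)[of n] by (rule order.strict_trans) simp
    show "summable (\<lambda>n. measure lebesgue (T n - A))"
    proof (rule summable_comparison_test)
      show "\<exists>N. \<forall>n\<ge>N. norm (measure lebesgue (T n - A)) \<le> (1/2)^n"
      proof (intro exI allI impI)
        fix n
        show "norm (measure lebesgue (T n - A)) \<le> (1/2)^n"
          using T(4)[of n] T(3)[of n] by (simp add: emeasure_eq_measure2 ennreal_less_iff)
      qed
    qed (simp add: summable_geometric)
  qed
  then have ev: "AE x in cellM L. \<forall>\<^sub>F n in sequentially. x \<notin> T n - A"
    by (subst AE_restrict_space_iff) (auto simp: cell_def elim: eventually_mono)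
  have "(\<lambda>n. \<integral>x. f x * indicator (W n) x \<partial>cellM L) \<longlonglongrightarrow> (\<integral>x. f x * indicator A x \<partial>cellM L)"
  proof (rule integral_dominated_convergence[where w="\<lambda>x. norm (f x)"])
    show "(\<lambda>x. f x * indicator A x) \<in> borel_measurable (cellM L)" using Am by measurable
    show "(\<lambda>x. f x * indicator (W n) x) \<in> borel_measurable (cellM L)" for n by measurable
    show "AE x in cellM L. (\<lambda>n. f x * indicator (W n) x) \<longlonglongrightarrow> f x * indicator A x"
      using ev
    proof eventually_elim
      fix x assume "\<forall>\<^sub>F n in sequentially. x \<notin> T n - A"
      then have "\<forall>\<^sub>F n in sequentially. f x * indicator (W n) x = f x * indicator A x"
      proof (rule eventually_mono)
        fix n assume "x \<notin> T n - A"
        then show "f x * indicator (W n) x = f x * indicator A x"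
          using W(3)[of n] by (auto simp: W_def indicator_def)
      qed
      then show "(\<lambda>n. f x * indicator (W n) x) \<longlonglongrightarrow> f x * indicator A x"
        by (rule tendsto_eventually)
    qed
    show "AE x in cellM L. norm (f x * indicator (W n) x) \<le> norm (f x)" for n
      by (auto intro!: AE_I2 simp: indicator_def)
    show "integrable (cellM L) (\<lambda>x. norm (f x))" using f by simp
  qed
  then have A0: "(\<integral>x. f x * indicator A x \<partial>cellM L) = 0"
    using integral_open_eq_0[OF L f 0 W(1,2)] LIMSEQ_unique[OF tendsto_const] by force
  have "integrable (cellM L) (\<lambda>x. f x * indicator A x)"
    using f Am by (rule integrable_real_mult_indicator[rotated])
  then have "AE x in cellM L. f x * indicator A x = 0"
    using A0 by (subst (asm) integral_nonneg_eq_0_iff_AE) (auto intro!: AE_I2 simp: A_def indicator_def)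
  then have "AE x in cellM L. x \<in> box 0 L \<longrightarrow> f x \<le> 0"
  proof (rule AE_mp, intro AE_I2 impI)
    fix x assume "x \<in> space (cellM L)" "f x * indicator A x = 0" "x \<in> box 0 L"
    then show "f x \<le> 0" by (auto simp: A_def indicator_def split: if_splits)
  qed
  then show ?thesis by (rule AE_box_of_cell)
qed

theorem fourier_coeff_zero_imp_zero:
  fixes f :: "real^'d \<Rightarrow> real"
  assumes L: "\<And>i. 0 < L $ i" and f: "integrable (cellM L) f" and 0: "\<And>\<xi>. fourier_coeff L f \<xi> = 0"
  shows "AE x in cellM L. f x = 0"
proof -
  have "fourier_coeff L (\<lambda>x. - f x) \<xi> = 0" for \<xi>
    using 0[of \<xi>] by (simp add: fourier_coeff_def)
  then have "AE x in cellM L. - f x \<le> 0"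
    using f by (intro fourier_coeff_zero_imp_nonpos[OF L]) auto
  moreover have "AE x in cellM L. f x \<le> 0"
    by (rule fourier_coeff_zero_imp_nonpos[OF assms])
  ultimately show ?thesis by eventually_elim simp
qed

section \<open>Plancherel's theorem and Fourier multipliers\<close>

lemma fourier_coeff_add:
  assumes "sq_integrable L f" "sq_integrable L g"
  shows "fourier_coeff L (\<lambda>x. f x + g x) \<xi> = fourier_coeff L f \<xi> + fourier_coeff L g \<xi>"
  using assms by (simp add: fourier_coeff_cfc cfc_add sq_integrable_integrable)

lemma fourier_coeff_cmult:
  "fourier_coeff L (\<lambda>x. c * f x) \<xi> = of_real c * fourier_coeff L f \<xi>"
  by (simp add: fourier_coeff_cfc cfc_cmult)

lemma fourier_coeff_diff:
  assumes "sq_integrable L f" "sq_integrable L g"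
  shows "fourier_coeff L (\<lambda>x. f x - g x) \<xi> = fourier_coeff L f \<xi> - fourier_coeff L g \<xi>"
  using assms by (simp add: fourier_coeff_cfc cfc_diff sq_integrable_integrable)

lemma fourier_coeff_zero [simp]: "fourier_coeff L (\<lambda>x. 0) \<xi> = 0"
  by (simp add: fourier_coeff_def)

lemma fourier_coeff_sum:
  assumes "\<And>i. i \<in> I \<Longrightarrow> sq_integrable L (f i)"
  shows "fourier_coeff L (\<lambda>x. \<Sum>i\<in>I. f i x) \<xi> = (\<Sum>i\<in>I. fourier_coeff L (f i) \<xi>)"
  using assms
  by (induction I rule: infinite_finite_induct) (auto simp: fourier_coeff_add sq_integrable_sum)

lemma fourier_coeff_uminus_freq: "fourier_coeff L f (- \<xi>) = cnj (fourier_coeff L f \<xi>)"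
  using Bochner_Integration.integral_cnj[of "cellM L" "\<lambda>x. complex_of_real (f x) * cnj (fmode L \<xi> x)"]
  by (simp add: fourier_coeff_cfc cfc_def fmode_minus)

lemma fourier_coeff_cong_AE:
  assumes "sq_integrable L f" "sq_integrable L g" "AE x in cellM L. f x = g x"
  shows "fourier_coeff L f \<xi> = fourier_coeff L g \<xi>"
proof -
  have "(\<integral>x. complex_of_real (f x) * cnj (fmode L \<xi> x) \<partial>cellM L) = (\<integral>x. complex_of_real (g x) * cnj (fmode L \<xi> x) \<partial>cellM L)"
  proof (rule integral_cong_AE)
    have meas: "(\<lambda>x. complex_of_real (h x) * cnj (fmode L \<xi> x)) \<in> borel_measurable (cellM L)"
      if "sq_integrable L h" for h
      by (rule borel_measurable_integrable[OF integrable_mult_fmode]) (use sq_integrable_integrable[OF that] in simp)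
    show "(\<lambda>x. complex_of_real (f x) * cnj (fmode L \<xi> x)) \<in> borel_measurable (cellM L)"
      "(\<lambda>x. complex_of_real (g x) * cnj (fmode L \<xi> x)) \<in> borel_measurable (cellM L)"
      by (rule meas[OF assms(1)], rule meas[OF assms(2)])
    show "AE x in cellM L. complex_of_real (f x) * cnj (fmode L \<xi> x) = complex_of_real (g x) * cnj (fmode L \<xi> x)"
      using assms(3) by eventually_elim simp
  qed
  then show ?thesis by (simp add: fourier_coeff_cfc cfc_def)
qed

lemma sq_integrable_of_real:
  assumes "sq_integrable L f" shows "sq_integrable L (\<lambda>x. complex_of_real (f x))"
  using sq_integrable_bounded_linear[OF bounded_linear_of_real assms] .

lemma l2_of_real: "l2 L (\<lambda>x. complex_of_real (f x)) = l2 L f"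
  by (simp add: l2_def)

locale periodic_cell =
  fixes L :: "real^'d"
  assumes L_pos: "\<And>i. 0 < L $ i"
begin

abbreviation "vol \<equiv> measure lebesgue (cell L)"

lemma vol_pos: "0 < vol"
  by (rule measure_cell_pos[OF L_pos])

lemma fourier_coeff_inject:
  assumes "sq_integrable L f" "sq_integrable L g" "\<And>\<xi>. fourier_coeff L f \<xi> = fourier_coeff L g \<xi>"
  shows "AE x in cellM L. f x = g x"
proof -
  have "AE x in cellM L. f x - g x = 0"
    using assms by (intro fourier_coeff_zero_imp_zero L_pos sq_integrable_integrable sq_integrable_diff)
      (auto simp: fourier_coeff_diff)
  then show ?thesis by simp
qed

lemma Bessel_sum_le:
  assumes "sq_integrable L f" "finite X"
  shows "(\<Sum>\<xi>\<in>X. (cmod (fourier_coeff L f \<xi>))\<^sup>2) \<le> (l2 L f)\<^sup>2 / vol"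
  using Bessel_inequality[OF L_pos sq_integrable_of_real[OF assms(1)] assms(2)] vol_pos
  by (simp add: fourier_coeff_cfc l2_of_real field_simps)

lemma fourier_coeff_summable:
  assumes "sq_integrable L f"
  shows "(\<lambda>\<xi>. (cmod (fourier_coeff L f \<xi>))\<^sup>2) summable_on UNIV"
  by (rule nonneg_bdd_above_summable_on) (auto intro!: bdd_aboveI Bessel_sum_le[OF assms])

text \<open>The real part of the complex solution keeps the coefficients because of the conjugate
  symmetry. Its squared norm is at most the coefficient sum times the volume, and Bessel's
  inequality gives the reverse bound, so the norm is known exactly.\<close>

lemma Riesz_Fischer:
  assumes c: "(\<lambda>\<xi>. (cmod (c \<xi>))\<^sup>2) summable_on UNIV" and sym: "\<And>\<xi>. c (- \<xi>) = cnj (c \<xi>)"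
  obtains w where "sq_integrable L w" "\<And>\<xi>. fourier_coeff L w \<xi> = c \<xi>"
    "((\<lambda>\<xi>. (cmod (c \<xi>))\<^sup>2) has_sum ((l2 L w)\<^sup>2 / vol)) UNIV"
proof -
  obtain z where z: "sq_integrable L z" "\<And>\<xi>. cfc L z \<xi> = c \<xi>"
      "(l2 L z)\<^sup>2 \<le> vol * (\<Sum>\<^sub>\<infinity>\<xi>. (cmod (c \<xi>))\<^sup>2)"
    using Riesz_Fischer_complex[OF L_pos c] by blast
  define w where "w x = Re (z x)" for x
  have w: "sq_integrable L w"
    unfolding w_def by (rule sq_integrable_bounded_linear[OF bounded_linear_Re z(1)])
  have zc: "sq_integrable L (\<lambda>x. cnj (z x))"
    by (rule sq_integrable_bounded_linear[OF bounded_linear_cnj z(1)])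
  have coeff: "fourier_coeff L w \<xi> = c \<xi>" for \<xi>
  proof -
    have "cfc L (\<lambda>x. cnj (z x)) \<xi> = cnj (cfc L z (- \<xi>))"
      using Bochner_Integration.integral_cnj[of "cellM L" "\<lambda>x. z x * fmode L \<xi> x"] by (simp add: cfc_def fmode_minus)
    also have "\<dots> = c \<xi>" by (simp add: z(2) sym)
    finally have cc: "cfc L (\<lambda>x. cnj (z x)) \<xi> = c \<xi>" .
    have "complex_of_real (w x) = 1 / 2 * (z x + cnj (z x))" for x
      by (simp add: w_def complex_eq_iff)
    then have "fourier_coeff L w \<xi> = cfc L (\<lambda>x. 1 / 2 * (z x + cnj (z x))) \<xi>"
      by (simp only: fourier_coeff_cfc)
    also have "\<dots> = 1 / 2 * (cfc L z \<xi> + cfc L (\<lambda>x. cnj (z x)) \<xi>)"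
      unfolding cfc_cmult using z(1) zc by (simp add: cfc_add sq_integrable_integrable)
    finally show ?thesis using cc z(2) by simp
  qed
  let ?s = "\<Sum>\<^sub>\<infinity>\<xi>. (cmod (c \<xi>))\<^sup>2"
  have "l2 L w \<le> l2 L z"
    using w z(1) by (intro l2_mono) (auto simp: w_def abs_Re_le_cmod)
  then have "(l2 L w)\<^sup>2 \<le> (l2 L z)\<^sup>2" by (intro power_mono) auto
  then have "(l2 L w)\<^sup>2 \<le> vol * ?s" using z(3) by linarith
  moreover have "?s \<le> (l2 L w)\<^sup>2 / vol"
    using Bessel_sum_le[OF w] by (intro infsum_le_finite_sums c) (auto simp: coeff)
  ultimately have "?s = (l2 L w)\<^sup>2 / vol" using vol_pos by (simp add: field_simps)
  then show ?thesis using that w coeff has_sum_infsum[OF c] by metis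
qed

text \<open>Riesz-Fischer produces some function with these coefficients for which equality holds;
  completeness of the trigonometric system identifies it with \<open>f\<close>.\<close>

theorem Parseval:
  assumes f: "sq_integrable L f"
  shows "((\<lambda>\<xi>. (cmod (fourier_coeff L f \<xi>))\<^sup>2) has_sum ((l2 L f)\<^sup>2 / vol)) UNIV"
proof -
  obtain w where w: "sq_integrable L w" "\<And>\<xi>. fourier_coeff L w \<xi> = fourier_coeff L f \<xi>"
    "((\<lambda>\<xi>. (cmod (fourier_coeff L f \<xi>))\<^sup>2) has_sum ((l2 L w)\<^sup>2 / vol)) UNIV"
    using Riesz_Fischer[OF fourier_coeff_summable[OF f] fourier_coeff_uminus_freq] by blast
  have "AE x in cellM L. w x = f x" using fourier_coeff_inject[OF w(1) f w(2)] .
  then have "l2 L w = l2 L f" using w(1) f by (intro l2_cong_AE) (auto elim: eventually_mono)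
  then show ?thesis using w(3) by simp
qed

lemma Parseval_sum:
  assumes "\<And>i. i \<in> I \<Longrightarrow> sq_integrable L (f i)"
  shows "((\<lambda>\<xi>. \<Sum>i\<in>I. (cmod (fourier_coeff L (f i) \<xi>))\<^sup>2) has_sum ((\<Sum>i\<in>I. (l2 L (f i))\<^sup>2) / vol)) UNIV"
  using assms
proof (induction I rule: infinite_finite_induct)
  case (insert i I)
  then show ?case
    using has_sum_add[OF Parseval[of "f i"], of "\<lambda>\<xi>. \<Sum>i\<in>I. (cmod (fourier_coeff L (f i) \<xi>))\<^sup>2"]
    by (simp add: add_divide_distrib)
qed auto

text \<open>The Poincare, projection and Korn estimates are all proved one frequency at a time
  through this lemma.\<close>

lemma sum_l2_le_of_fourier:
  assumes "\<And>i. i \<in> I \<Longrightarrow> sq_integrable L (f i)" "\<And>j. j \<in> J \<Longrightarrow> sq_integrable L (g j)"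
    and "\<And>\<xi>. (\<Sum>i\<in>I. (cmod (fourier_coeff L (f i) \<xi>))\<^sup>2) \<le> B * (\<Sum>j\<in>J. (cmod (fourier_coeff L (g j) \<xi>))\<^sup>2)"
  shows "(\<Sum>i\<in>I. (l2 L (f i))\<^sup>2) \<le> B * (\<Sum>j\<in>J. (l2 L (g j))\<^sup>2)"
proof -
  have "(\<Sum>i\<in>I. (l2 L (f i))\<^sup>2) / vol \<le> B * ((\<Sum>j\<in>J. (l2 L (g j))\<^sup>2) / vol)"
    using assms by (intro has_sum_mono[OF Parseval_sum has_sum_cmult_right[OF Parseval_sum]]) auto
  then show ?thesis using vol_pos by (simp add: field_simps)
qed

text \<open>Polarization: when the real cross terms vanish at every frequency, f + g and f - g have
  the same coefficient sums, so Parseval gives them the same total squared norm. The difference of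
  these norms is four times the inner product.\<close>

lemma sum_inner_eq_0_of_fourier:
  assumes f: "\<And>i. i \<in> I \<Longrightarrow> sq_integrable L (f i)" and g: "\<And>i. i \<in> I \<Longrightarrow> sq_integrable L (g i)"
    and 0: "\<And>\<xi>. (\<Sum>i\<in>I. Re (fourier_coeff L (f i) \<xi> * cnj (fourier_coeff L (g i) \<xi>))) = 0"
  shows "(\<Sum>i\<in>I. \<integral>x. f i x * g i x \<partial>cellM L) = 0"
proof -
  have exp: "(\<Sum>i\<in>I. (cmod (fourier_coeff L (\<lambda>x. f i x + s * g i x) \<xi>))\<^sup>2) =
      (\<Sum>i\<in>I. (cmod (fourier_coeff L (f i) \<xi>))\<^sup>2 + (cmod (fourier_coeff L (g i) \<xi>))\<^sup>2)"
    if s: "s\<^sup>2 = 1" for s \<xi>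
  proof -
    have sq: "(cmod (a + of_real s * b))\<^sup>2 = (cmod a)\<^sup>2 + (cmod b)\<^sup>2 + 2 * s * Re (a * cnj b)" for a b
    proof -
      have "(cmod (a + of_real s * b))\<^sup>2 = (cmod a)\<^sup>2 + s\<^sup>2 * (cmod b)\<^sup>2 + 2 * s * Re (a * cnj b)"
        unfolding cmod_power2 by (simp add: power2_eq_square algebra_simps)
      then show ?thesis using s by simp
    qed
    have "(\<Sum>i\<in>I. (cmod (fourier_coeff L (\<lambda>x. f i x + s * g i x) \<xi>))\<^sup>2) =
      (\<Sum>i\<in>I. (cmod (fourier_coeff L (f i) \<xi>))\<^sup>2 + (cmod (fourier_coeff L (g i) \<xi>))\<^sup>2
        + 2 * s * Re (fourier_coeff L (f i) \<xi> * cnj (fourier_coeff L (g i) \<xi>)))"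
      using f g by (intro sum.cong refl)
        (simp only: fourier_coeff_add fourier_coeff_cmult sq_integrable_mult_left sq)
    also have "\<dots> = (\<Sum>i\<in>I. (cmod (fourier_coeff L (f i) \<xi>))\<^sup>2 + (cmod (fourier_coeff L (g i) \<xi>))\<^sup>2)
        + 2 * s * (\<Sum>i\<in>I. Re (fourier_coeff L (f i) \<xi> * cnj (fourier_coeff L (g i) \<xi>)))"
      by (simp only: sum.distrib sum_distrib_left)
    finally show ?thesis by (simp only: 0)
  qed
  have P: "((\<lambda>\<xi>. \<Sum>i\<in>I. (cmod (fourier_coeff L (f i) \<xi>))\<^sup>2 + (cmod (fourier_coeff L (g i) \<xi>))\<^sup>2) has_sum
      ((\<Sum>i\<in>I. (l2 L (\<lambda>x. f i x + s * g i x))\<^sup>2) / vol)) UNIV" if s: "s\<^sup>2 = 1" for s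
    using Parseval_sum[of I "\<lambda>i x. f i x + s * g i x"] f g
    unfolding exp[OF s] by (simp add: sq_integrable_add sq_integrable_mult_left)
  have "(\<Sum>i\<in>I. (l2 L (\<lambda>x. f i x + 1 * g i x))\<^sup>2) / vol = (\<Sum>i\<in>I. (l2 L (\<lambda>x. f i x + (-1) * g i x))\<^sup>2) / vol"
    by (rule has_sum_unique[OF P P]) simp_all
  then have eq: "(\<Sum>i\<in>I. (l2 L (\<lambda>x. f i x + g i x))\<^sup>2) = (\<Sum>i\<in>I. (l2 L (\<lambda>x. f i x + - g i x))\<^sup>2)"
    using vol_pos by simp
  have "(l2 L (\<lambda>x. f i x + g i x))\<^sup>2 - (l2 L (\<lambda>x. f i x + - g i x))\<^sup>2 = 4 * (\<integral>x. f i x * g i x \<partial>cellM L)"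
    if i: "i \<in> I" for i
    using l2_power2_add[OF f[OF i] g[OF i]] l2_power2_add[OF f[OF i] sq_integrable_minus[OF g[OF i]]]
    by simp
  then have "4 * (\<Sum>i\<in>I. \<integral>x. f i x * g i x \<partial>cellM L) =
      (\<Sum>i\<in>I. (l2 L (\<lambda>x. f i x + g i x))\<^sup>2 - (l2 L (\<lambda>x. f i x + - g i x))\<^sup>2)"
    unfolding sum_distrib_left by (intro sum.cong) auto
  then show ?thesis using eq by (simp add: sum_subtractf)
qed

subsection \<open>Fourier sums\<close>

lemma has_fourier_sum_iff_l2:
  "has_fourier_sum L c w \<longleftrightarrow> sq_integrable L w \<and>
    ((\<lambda>X. (l2 L (\<lambda>x. complex_of_real (w x) - trig L c X x))\<^sup>2) \<longlongrightarrow> 0) (finite_subsets_at_top UNIV)"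
  by (simp add: has_fourier_sum_def l2_power2 trig_def fmode_def)

lemma has_fourier_sum_fourier_coeff:
  assumes f: "sq_integrable L f"
  shows "has_fourier_sum L (fourier_coeff L f) f"
  unfolding has_fourier_sum_iff_l2
proof
  let ?S = "\<lambda>X. \<Sum>\<xi>\<in>X. (cmod (fourier_coeff L f \<xi>))\<^sup>2"
  have "((\<lambda>X. (l2 L f)\<^sup>2 - vol * ?S X) \<longlongrightarrow> (l2 L f)\<^sup>2 - vol * ((l2 L f)\<^sup>2 / vol)) (finite_subsets_at_top UNIV)"
    using Parseval[OF f] unfolding has_sum_def by (intro tendsto_intros)
  then have lim: "((\<lambda>X. (l2 L f)\<^sup>2 - vol * ?S X) \<longlongrightarrow> 0) (finite_subsets_at_top UNIV)"
    using vol_pos by simp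
  have "\<forall>\<^sub>F X in finite_subsets_at_top UNIV.
      (l2 L f)\<^sup>2 - vol * ?S X = (l2 L (\<lambda>x. complex_of_real (f x) - trig L (fourier_coeff L f) X x))\<^sup>2"
    using Bessel_identity[OF L_pos sq_integrable_of_real[OF f]]
    by (intro eventually_finite_subsets_at_top_weakI) (simp add: fourier_coeff_cfc l2_of_real)
  from Lim_transform_eventually[OF lim this]
  show "((\<lambda>X. (l2 L (\<lambda>x. complex_of_real (f x) - trig L (fourier_coeff L f) X x))\<^sup>2) \<longlongrightarrow> 0) (finite_subsets_at_top UNIV)" .
qed fact

text \<open>Each coefficient is continuous in L^2 by Bessel's inequality, and every partial sum that
  contains \<open>\<xi>\<close> already has the coefficient \<open>c \<xi>\<close> there.\<close>

lemma has_fourier_sum_imp_coeff: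
  assumes "has_fourier_sum L c w"
  shows "fourier_coeff L w \<xi> = c \<xi>"
proof -
  have w: "sq_integrable L w"
    and lim: "((\<lambda>X. (l2 L (\<lambda>x. complex_of_real (w x) - trig L c X x))\<^sup>2) \<longlongrightarrow> 0) (finite_subsets_at_top UNIV)"
    using assms by (auto simp: has_fourier_sum_iff_l2)
  have "cmod (fourier_coeff L w \<xi> - c \<xi>) \<le> 0 + e" if e: "0 < e" for e
  proof -
    have "\<forall>\<^sub>F X in finite_subsets_at_top UNIV. (l2 L (\<lambda>x. complex_of_real (w x) - trig L c X x))\<^sup>2 < (e * sqrt vol)\<^sup>2"
      by (rule order_tendstoD(2)[OF lim]) (use e vol_pos in simp)
    moreover have "\<forall>\<^sub>F X in finite_subsets_at_top UNIV. finite X \<and> {\<xi>} \<subseteq> X"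
      by (intro eventually_finite_subsets_at_top_finite eventually_conj) (auto simp: eventually_finite_subsets_at_top)
    ultimately have "\<forall>\<^sub>F X in finite_subsets_at_top UNIV. finite X \<and> \<xi> \<in> X \<and> (l2 L (\<lambda>x. complex_of_real (w x) - trig L c X x))\<^sup>2 < (e * sqrt vol)\<^sup>2"
      by eventually_elim auto
    then obtain X where X: "finite X" "\<xi> \<in> X" "(l2 L (\<lambda>x. complex_of_real (w x) - trig L c X x))\<^sup>2 < (e * sqrt vol)\<^sup>2"
      using eventually_happens'[OF finite_subsets_at_top_neq_bot] by blast
    have less: "l2 L (\<lambda>x. complex_of_real (w x) - trig L c X x) < e * sqrt vol"
      using X(3) by (rule power_less_imp_less_base) (use e in simp)
    have "cfc L (\<lambda>x. complex_of_real (w x) - trig L c X x) \<xi> = fourier_coeff L w \<xi> - c \<xi>"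
      using X w by (simp add: cfc_diff sq_integrable_integrable sq_integrable_trig sq_integrable_of_real
          cfc_trig[OF L_pos] fourier_coeff_cfc)
    then have "cmod (fourier_coeff L w \<xi> - c \<xi>) \<le> l2 L (\<lambda>x. complex_of_real (w x) - trig L c X x) / sqrt vol"
      using cmod_cfc_le[OF L_pos sq_integrable_diff[OF sq_integrable_of_real[OF w] sq_integrable_trig[of L c X]], of \<xi>]
      by (simp only:)
    also have "\<dots> < e"
      using less vol_pos by (simp add: pos_divide_less_eq)
    finally show ?thesis by simp
  qed
  then have "cmod (fourier_coeff L w \<xi> - c \<xi>) \<le> 0"
    by (rule field_le_epsilon)
  then show ?thesis by simp
qed

lemma has_fourier_sum_fourier_sum:
  assumes c: "(\<lambda>\<xi>. (cmod (c \<xi>))\<^sup>2) summable_on UNIV" and sym: "\<And>\<xi>. c (- \<xi>) = cnj (c \<xi>)"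
  shows "has_fourier_sum L c (fourier_sum L c)"
proof -
  obtain w where w: "sq_integrable L w" "\<And>\<xi>. fourier_coeff L w \<xi> = c \<xi>"
    using Riesz_Fischer[OF assms] by blast
  then have "fourier_coeff L w = c" by auto
  then have "has_fourier_sum L c w" using has_fourier_sum_fourier_coeff[OF w(1)] by simp
  then show ?thesis unfolding fourier_sum_def by (rule someI[of "has_fourier_sum L c"])
qed

definition mult :: "(int^'d \<Rightarrow> complex) \<Rightarrow> (real^'d \<Rightarrow> real) \<Rightarrow> real^'d \<Rightarrow> real" where
  "mult k f = fourier_sum L (\<lambda>\<xi>. k \<xi> * fourier_coeff L f \<xi>)"

definition multiplier :: "(int^'d \<Rightarrow> complex) \<Rightarrow> bool" where
  "multiplier k \<longleftrightarrow> (\<forall>\<xi>. k (- \<xi>) = cnj (k \<xi>)) \<and> (\<exists>B. \<forall>\<xi>. cmod (k \<xi>) \<le> B)"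

lemma cmod_combination_le:
  fixes z :: "'i \<Rightarrow> complex"
  assumes B: "\<And>j. j \<in> J \<Longrightarrow> cmod (k j) \<le> B"
  shows "(cmod (\<Sum>j\<in>J. k j * z j))\<^sup>2 \<le> (of_nat (card J) * B\<^sup>2) * (\<Sum>j\<in>J. (cmod (z j))\<^sup>2)"
proof -
  have "cmod (k j) \<le> \<bar>B\<bar>" if "j \<in> J" for j
    using B[OF that] by linarith
  then have "cmod (\<Sum>j\<in>J. k j * z j) \<le> (\<Sum>j\<in>J. \<bar>B\<bar> * cmod (z j))"
    by (intro sum_norm_le) (auto simp: norm_mult intro!: mult_right_mono)
  then have "(cmod (\<Sum>j\<in>J. k j * z j))\<^sup>2 \<le> (\<Sum>j\<in>J. \<bar>B\<bar> * cmod (z j))\<^sup>2"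
    by (intro power_mono) auto
  also have "\<dots> \<le> (\<Sum>j\<in>J. 1\<^sup>2) * (\<Sum>j\<in>J. (\<bar>B\<bar> * cmod (z j))\<^sup>2)"
    using Cauchy_Schwarz_ineq_sum[of "\<lambda>_. 1" "\<lambda>j. \<bar>B\<bar> * cmod (z j)" J] by simp
  also have "\<dots> = (of_nat (card J) * B\<^sup>2) * (\<Sum>j\<in>J. (cmod (z j))\<^sup>2)"
    by (simp add: power_mult_distrib sum_distrib_left mult_ac)
  finally show ?thesis .
qed

lemma combination_summable:
  assumes f: "\<And>j. j \<in> J \<Longrightarrow> sq_integrable L (f j)" and B: "\<And>\<xi> j. j \<in> J \<Longrightarrow> cmod (k \<xi> j) \<le> B"
  shows "(\<lambda>\<xi>. (cmod (\<Sum>j\<in>J. k \<xi> j * fourier_coeff L (f j) \<xi>))\<^sup>2) summable_on UNIV"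
proof -
  have "(\<lambda>\<xi>. (of_nat (card J) * B\<^sup>2) * (\<Sum>j\<in>J. (cmod (fourier_coeff L (f j) \<xi>))\<^sup>2)) summable_on UNIV"
    unfolding summable_on_def by (rule exI, rule has_sum_cmult_right, rule Parseval_sum, rule f)
  then show ?thesis
    by (rule summable_on_comparison_test[OF _ cmod_combination_le[OF B]]) simp_all
qed

lemma mult_props:
  assumes k: "multiplier k" and f: "sq_integrable L f"
  shows sq_integrable_mult: "sq_integrable L (mult k f)"
    and fourier_coeff_mult: "fourier_coeff L (mult k f) \<xi> = k \<xi> * fourier_coeff L f \<xi>"
proof -
  obtain B where B: "\<And>\<xi>. cmod (k \<xi>) \<le> B" using k by (auto simp: multiplier_def)
  have "has_fourier_sum L (\<lambda>\<xi>. k \<xi> * fourier_coeff L f \<xi>) (mult k f)"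
    unfolding mult_def
    using combination_summable[of "{()}" "\<lambda>_. f" "\<lambda>\<xi> _. k \<xi>" B] B f k
    by (intro has_fourier_sum_fourier_sum) (auto simp: multiplier_def fourier_coeff_uminus_freq)
  then show "sq_integrable L (mult k f)" "fourier_coeff L (mult k f) \<xi> = k \<xi> * fourier_coeff L f \<xi>"
    using has_fourier_sum_imp_coeff by (auto simp: has_fourier_sum_def)
qed

end

section \<open>Weak gradients in Fourier space\<close>

lemma trig_wave_has_derivative:
  fixes w :: "real^'d"
  shows "((\<lambda>x. a * cos (w \<bullet> x) + b * sin (w \<bullet> x)) has_derivative
    (\<lambda>h. (b * cos (w \<bullet> x) - a * sin (w \<bullet> x)) * (w \<bullet> h))) (at x)"
  by (auto intro!: derivative_eq_intros simp: algebra_simps)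

lemma partial_trig_wave:
  fixes w :: "real^'d"
  shows "partial j (\<lambda>x. a * cos (w \<bullet> x) + b * sin (w \<bullet> x)) =
    (\<lambda>x. (b * w $ j) * cos (w \<bullet> x) + (- a * w $ j) * sin (w \<bullet> x))"
  unfolding partial_def fun_eq_iff
  by (simp add: frechet_derivative_at[OF trig_wave_has_derivative, symmetric] inner_axis algebra_simps)

text \<open>Coinduction needs a class closed under partial derivatives: the waves with fixed
  \<open>w\<close> and arbitrary amplitudes.\<close>

lemma smooth_trig_wave:
  fixes w :: "real^'d"
  shows "smooth (\<lambda>x. a * cos (w \<bullet> x) + b * sin (w \<bullet> x))"
proof (coinduction arbitrary: a b rule: smooth.coinduct)
  case smooth
  have "(\<lambda>x. a * cos (w \<bullet> x) + b * sin (w \<bullet> x)) differentiable at x" for x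
    using trig_wave_has_derivative differentiable_def by blast
  moreover have "\<exists>a' b'. partial j (\<lambda>x. a * cos (w \<bullet> x) + b * sin (w \<bullet> x)) = (\<lambda>x. a' * cos (w \<bullet> x) + b' * sin (w \<bullet> x))" for j
    unfolding partial_trig_wave by blast
  ultimately show ?case by blast
qed

lemma smooth_differentiable: "smooth f \<Longrightarrow> f differentiable at x"
  by (auto elim: smooth.cases)

lemma smooth_partial: "smooth f \<Longrightarrow> smooth (partial j f)"
  by (auto elim: smooth.cases)

lemma smooth_continuous: "smooth f \<Longrightarrow> continuous_on UNIV f"
  by (simp add: continuous_on_eq_continuous_within differentiable_imp_continuous_within smooth_differentiable)

lemma partial_mult:
  assumes "f differentiable at x" "g differentiable at x"
  shows "partial j (\<lambda>x. f x * g x) x = f x * partial j g x + partial j f x * g x"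
proof -
  have "((\<lambda>x. f x * g x) has_derivative
      (\<lambda>h. f x * frechet_derivative g (at x) h + frechet_derivative f (at x) h * g x)) (at x)"
    using assms by (intro has_derivative_mult) (auto simp: frechet_derivative_works)
  from frechet_derivative_at[OF this] show ?thesis
    unfolding partial_def by metis
qed

lemma l2_vec:
  fixes f :: "real^'d \<Rightarrow> real^'m"
  assumes "sq_integrable L f"
  shows "(l2 L f)\<^sup>2 = (\<Sum>i\<in>UNIV. (l2 L (\<lambda>x. f x $ i))\<^sup>2)"
proof -
  have "sq_integrable L (\<lambda>x. f x $ i)" for i
    using assms sq_integrable_componentwise by blast
  then have "integrable (cellM L) (\<lambda>x. (f x $ i)\<^sup>2)" for i
    by (simp add: sq_integrable_def)
  moreover have "(norm (f x))\<^sup>2 = (\<Sum>i\<in>UNIV. (f x $ i)\<^sup>2)" for x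
    unfolding norm_vec_def L2_set_def by (simp add: sum_nonneg)
  ultimately show ?thesis
    by (simp add: l2_power2)
qed

lemma l2_mat:
  fixes f :: "real^'d \<Rightarrow> real^'n^'m"
  assumes f: "sq_integrable L f"
  shows "(l2 L f)\<^sup>2 = (\<Sum>i\<in>UNIV. \<Sum>j\<in>UNIV. (l2 L (\<lambda>x. f x $ i $ j))\<^sup>2)"
proof -
  have s: "sq_integrable L (\<lambda>x. f x $ i)" for i
    by (rule sq_integrable_bounded_linear[OF bounded_linear_vec_nth f])
  then have "integrable (cellM L) (\<lambda>x. (norm (f x $ i))\<^sup>2)" for i
    by (simp add: sq_integrable_def)
  moreover have "(norm (f x))\<^sup>2 = (\<Sum>i\<in>UNIV. (norm (f x $ i))\<^sup>2)" for x
    unfolding norm_vec_def[of "f x"] L2_set_def by (simp add: sum_nonneg)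
  ultimately have "(l2 L f)\<^sup>2 = (\<Sum>i\<in>UNIV. (l2 L (\<lambda>x. f x $ i))\<^sup>2)"
    by (simp add: l2_power2)
  then show ?thesis using l2_vec[OF s] by simp
qed

lemma cmod_sum_scaled_le:
  fixes a :: "'i \<Rightarrow> real" and z :: "'i \<Rightarrow> complex"
  shows "(cmod (\<Sum>j\<in>J. of_real (a j) * z j))\<^sup>2 \<le> (\<Sum>j\<in>J. (a j)\<^sup>2) * (\<Sum>j\<in>J. (cmod (z j))\<^sup>2)"
proof -
  have "cmod (\<Sum>j\<in>J. of_real (a j) * z j) \<le> (\<Sum>j\<in>J. \<bar>a j\<bar> * cmod (z j))"
    by (intro sum_norm_le) (simp add: norm_mult)
  then have "(cmod (\<Sum>j\<in>J. of_real (a j) * z j))\<^sup>2 \<le> (\<Sum>j\<in>J. \<bar>a j\<bar> * cmod (z j))\<^sup>2"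
    by (intro power_mono) auto
  also have "\<dots> \<le> (\<Sum>j\<in>J. \<bar>a j\<bar>\<^sup>2) * (\<Sum>j\<in>J. (cmod (z j))\<^sup>2)"
    by (rule Cauchy_Schwarz_ineq_sum)
  finally show ?thesis by simp
qed

lemma inner_self_sum: "(w::real^'d) \<bullet> w = (\<Sum>j\<in>UNIV. (w $ j)\<^sup>2)"
  by (simp add: inner_vec_def power2_eq_square)

context periodic_cell
begin

lemma integrable_mult_wave:
  assumes "sq_integrable L f"
  shows "integrable (cellM L) (\<lambda>x. f x * cos (w \<bullet> x))" "integrable (cellM L) (\<lambda>x. f x * sin (w \<bullet> x))"
  by (intro sq_integrable_mult_integrable assms continuous_sq_integrable continuous_intros)+

text \<open>The test functions of the weak formulation are real, so a coefficient is split into the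
  cosine and sine integrals which they control.\<close>

lemma fourier_coeff_cos_sin:
  assumes "sq_integrable L f"
  shows "fourier_coeff L f \<xi> = (of_real (\<integral>x. f x * cos (freq L \<xi> \<bullet> x) \<partial>cellM L)
    - \<i> * of_real (\<integral>x. f x * sin (freq L \<xi> \<bullet> x) \<partial>cellM L)) / of_real vol"
proof -
  have "complex_of_real (f x) * cis (- (freq L \<xi> \<bullet> x)) =
      complex_of_real (f x * cos (freq L \<xi> \<bullet> x)) - \<i> * complex_of_real (f x * sin (freq L \<xi> \<bullet> x))" for x
    by (simp add: complex_eq_iff)
  then have "(\<integral>x. complex_of_real (f x) * cis (- (freq L \<xi> \<bullet> x)) \<partial>cellM L) =
      (\<integral>x. complex_of_real (f x * cos (freq L \<xi> \<bullet> x)) - \<i> * complex_of_real (f x * sin (freq L \<xi> \<bullet> x)) \<partial>cellM L)"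
    by (simp only:)
  also have "\<dots> = (\<integral>x. complex_of_real (f x * cos (freq L \<xi> \<bullet> x)) \<partial>cellM L)
      - (\<integral>x. \<i> * complex_of_real (f x * sin (freq L \<xi> \<bullet> x)) \<partial>cellM L)"
    using integrable_mult_wave[OF assms, of "freq L \<xi>"]
    by (intro Bochner_Integration.integral_diff integrable_mult_right) (simp_all only: complex_of_real_integrable_eq)
  finally show ?thesis
    unfolding fourier_coeff_def by (simp only: integral_complex_of_real integral_mult_right_zero)
qed

text \<open>The amplitudes (1, 0) and (0, 1) give the cosine and the sine integral. Stated for any
  pair that satisfies integration by parts against waves, the lemma covers weak gradients as well as
  classical derivatives of test functions.\<close>

lemma fourier_coeff_of_ibp:
  assumes u: "sq_integrable L u" and g: "sq_integrable L g"
    and ibp: "\<And>a b. (\<integral>x. u x * partial j (\<lambda>x. a * cos (freq L \<xi> \<bullet> x) + b * sin (freq L \<xi> \<bullet> x)) x \<partial>cellM L) =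
      - (\<integral>x. g x * (a * cos (freq L \<xi> \<bullet> x) + b * sin (freq L \<xi> \<bullet> x)) \<partial>cellM L)"
  shows "fourier_coeff L g \<xi> = \<i> * of_real (freq L \<xi> $ j) * fourier_coeff L u \<xi>"
proof -
  have "(\<integral>x. g x * cos (freq L \<xi> \<bullet> x) \<partial>cellM L) = freq L \<xi> $ j * (\<integral>x. u x * sin (freq L \<xi> \<bullet> x) \<partial>cellM L)"
    using ibp[of 1 0] unfolding partial_trig_wave by (simp add: mult.left_commute[of "u _"])
  moreover have "(\<integral>x. g x * sin (freq L \<xi> \<bullet> x) \<partial>cellM L) = - freq L \<xi> $ j * (\<integral>x. u x * cos (freq L \<xi> \<bullet> x) \<partial>cellM L)"
    using ibp[of 0 1] unfolding partial_trig_wave by (simp add: mult.left_commute[of "u _"])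
  ultimately show ?thesis
    unfolding fourier_coeff_cos_sin[OF u] fourier_coeff_cos_sin[OF g]
    by (simp add: complex_eq_iff)
qed

lemma periodic_trig_wave:
  "periodic L (\<lambda>x. a * cos (freq L \<xi> \<bullet> x) + b * sin (freq L \<xi> \<bullet> x))"
proof -
  have "cis (freq L \<xi> \<bullet> (x + axis j (L $ j))) = cis (freq L \<xi> \<bullet> x)" for x j
    using fmode_periodic[OF L_pos, of \<xi> x j] by (simp add: fmode_def)
  then have "cos (freq L \<xi> \<bullet> (x + axis j (L $ j))) = cos (freq L \<xi> \<bullet> x)"
    "sin (freq L \<xi> \<bullet> (x + axis j (L $ j))) = sin (freq L \<xi> \<bullet> x)" for x j
    by (simp_all add: complex_eq_iff)
  then show ?thesis by (simp add: periodic_def)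
qed

text \<open>The derivative of the periodic product of \<open>\<phi>\<close> with a wave has integral
  0, which is the integration by parts that \<open>fourier_coeff_of_ibp\<close> asks for.\<close>

lemma fourier_coeff_partial:
  assumes \<phi>: "smooth \<phi>" "periodic L \<phi>"
  shows "fourier_coeff L (partial j \<phi>) \<xi> = \<i> * of_real (freq L \<xi> $ j) * fourier_coeff L \<phi> \<xi>"
proof (rule fourier_coeff_of_ibp)
  show "sq_integrable L \<phi>" "sq_integrable L (partial j \<phi>)"
    using \<phi> by (auto intro!: continuous_sq_integrable smooth_continuous smooth_partial)
  fix a b
  let ?\<chi> = "\<lambda>x. a * cos (freq L \<xi> \<bullet> x) + b * sin (freq L \<xi> \<bullet> x)"
  have \<chi>: "smooth ?\<chi>" "periodic L ?\<chi>" by (rule smooth_trig_wave periodic_trig_wave)+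
  have p: "partial j (\<lambda>x. \<phi> x * ?\<chi> x) = (\<lambda>x. \<phi> x * partial j ?\<chi> x + partial j \<phi> x * ?\<chi> x)"
    by (intro ext partial_mult smooth_differentiable \<phi> \<chi>)
  have c: "continuous_on UNIV \<phi>" "continuous_on UNIV ?\<chi>" "continuous_on UNIV (partial j \<phi>)" "continuous_on UNIV (partial j ?\<chi>)"
    by (rule smooth_continuous[OF \<phi>(1)], rule smooth_continuous[OF \<chi>(1)],
        rule smooth_continuous[OF smooth_partial[OF \<phi>(1)]], rule smooth_continuous[OF smooth_partial[OF \<chi>(1)]])
  have "(\<integral>x. partial j (\<lambda>x. \<phi> x * ?\<chi> x) x \<partial>cellM L) = 0"
  proof (rule integral_partial_eq_0)
    show "0 < L $ j" by (rule L_pos)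
    show "(\<lambda>x. \<phi> x * ?\<chi> x) differentiable at x" for x
      by (intro differentiable_mult smooth_differentiable \<phi> \<chi>)
    show "\<phi> (x + axis j (L $ j)) * ?\<chi> (x + axis j (L $ j)) = \<phi> x * ?\<chi> x" for x
      using \<phi>(2) \<chi>(2) by (simp only: periodic_def)
    show "continuous_on UNIV (partial j (\<lambda>x. \<phi> x * ?\<chi> x))"
      unfolding p by (intro continuous_on_add continuous_on_mult c)
  qed
  moreover have "integrable (cellM L) (\<lambda>x. \<phi> x * partial j ?\<chi> x)" "integrable (cellM L) (\<lambda>x. partial j \<phi> x * ?\<chi> x)"
    by (intro sq_integrable_mult_integrable continuous_sq_integrable c)+
  ultimately show "(\<integral>x. \<phi> x * partial j ?\<chi> x \<partial>cellM L) = - (\<integral>x. partial j \<phi> x * ?\<chi> x \<partial>cellM L)"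
    unfolding p by (simp only: Bochner_Integration.integral_add)
qed

theorem weak_grad_iff_fourier:
  fixes u :: "real^'d \<Rightarrow> real^'m"
  assumes u: "sq_integrable L u" and G: "sq_integrable L G"
  shows "weak_grad L u G \<longleftrightarrow> (\<forall>i j \<xi>. fourier_coeff L (\<lambda>x. G x $ i $ j) \<xi> =
    \<i> * of_real (freq L \<xi> $ j) * fourier_coeff L (\<lambda>x. u x $ i) \<xi>)"
proof -
  have ui: "sq_integrable L (\<lambda>x. u x $ i)" for i using u sq_integrable_componentwise by blast
  have Gi: "sq_integrable L (\<lambda>x. G x $ i $ j)" for i j by (rule sq_integrable_nth2[OF G])
  show ?thesis
  proof
    assume W: "weak_grad L u G"
    show "\<forall>i j \<xi>. fourier_coeff L (\<lambda>x. G x $ i $ j) \<xi> = \<i> * of_real (freq L \<xi> $ j) * fourier_coeff L (\<lambda>x. u x $ i) \<xi>"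
    proof (intro allI fourier_coeff_of_ibp[OF ui Gi])
      fix i j \<xi> a b
      let ?\<chi> = "\<lambda>x. a * cos (freq L \<xi> \<bullet> x) + b * sin (freq L \<xi> \<bullet> x)"
      have "smooth ?\<chi> \<and> periodic L ?\<chi>" using smooth_trig_wave periodic_trig_wave by blast
      then show "(\<integral>x. u x $ i * partial j ?\<chi> x \<partial>cellM L) = - (\<integral>x. G x $ i $ j * ?\<chi> x \<partial>cellM L)"
        using W unfolding weak_grad_def by blast
    qed
  next
    assume F: "\<forall>i j \<xi>. fourier_coeff L (\<lambda>x. G x $ i $ j) \<xi> = \<i> * of_real (freq L \<xi> $ j) * fourier_coeff L (\<lambda>x. u x $ i) \<xi>"
    show "weak_grad L u G"
      unfolding weak_grad_def
    proof (intro conjI G allI impI, elim conjE)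
      fix \<phi> i j assume \<phi>: "smooth \<phi>" "periodic L \<phi>"
      have sq: "sq_integrable L \<phi>" "sq_integrable L (partial j \<phi>)"
        using \<phi> by (auto intro!: continuous_sq_integrable smooth_continuous smooth_partial)
      \<comment> \<open>The two integrals of the weak formulation become one sum over a two-element
        index set, so that the polarized Parseval identity applies. Moving the factor i times a real
        frequency across the conjugation changes its sign, and the two real parts cancel.\<close>
      have "(\<Sum>b\<in>{True, False}. \<integral>x. (if b then u x $ i else G x $ i $ j) * (if b then partial j \<phi> x else \<phi> x) \<partial>cellM L) = 0"
      proof (rule sum_inner_eq_0_of_fourier)
        fix \<xi>
        have "Re (x * cnj (\<i> * of_real w * y)) + Re (\<i> * of_real w * x * cnj y) = 0" for x y w
          by (simp add: algebra_simps)
        then show "(\<Sum>b\<in>{True, False}. Re (fourier_coeff L (\<lambda>x. if b then u x $ i else G x $ i $ j) \<xi> *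
            cnj (fourier_coeff L (\<lambda>x. if b then partial j \<phi> x else \<phi> x) \<xi>))) = 0"
          by (simp add: F fourier_coeff_partial[OF \<phi>])
        show "sq_integrable L (\<lambda>x. if b then u x $ i else G x $ i $ j)" for b
          by (cases b) (simp_all add: ui Gi)
        show "sq_integrable L (\<lambda>x. if b then partial j \<phi> x else \<phi> x)" for b
          by (cases b) (simp_all add: sq)
      qed
      then show "(\<integral>x. u x $ i * partial j \<phi> x \<partial>cellM L) = - (\<integral>x. G x $ i $ j * \<phi> x \<partial>cellM L)"
        by simp
    qed
  qed
qed

lemma weak_grad_grad: "u \<in> H1_per L \<Longrightarrow> weak_grad L u (grad L u)"
  unfolding H1_per_def grad_def by (metis (mono_tags, lifting) mem_Collect_eq someI_ex)

lemma sq_integrable_grad: "u \<in> H1_per L \<Longrightarrow> sq_integrable L (grad L u)"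
  using weak_grad_grad by (auto simp: weak_grad_def)

lemma sq_integrable_H1: "u \<in> H1_per L \<Longrightarrow> sq_integrable L u"
  by (simp add: H1_per_def)

lemma fourier_coeff_grad:
  assumes "u \<in> H1_per L"
  shows "fourier_coeff L (\<lambda>x. grad L u x $ i $ j) \<xi> = \<i> * of_real (freq L \<xi> $ j) * fourier_coeff L (\<lambda>x. u x $ i) \<xi>"
  using weak_grad_iff_fourier[OF sq_integrable_H1[OF assms] sq_integrable_grad[OF assms]] weak_grad_grad[OF assms] by simp

lemma fourier_coeff_0_freq: "fourier_coeff L f 0 = of_real ((\<integral>x. f x \<partial>cellM L) / vol)"
  by (simp add: fourier_coeff_def)

lemma integral_eq_0_iff_fourier:
  fixes u :: "real^'d \<Rightarrow> real^'m"
  assumes u: "sq_integrable L u"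
  shows "(\<integral>x. u x \<partial>cellM L) = 0 \<longleftrightarrow> (\<forall>i. fourier_coeff L (\<lambda>x. u x $ i) 0 = 0)"
proof -
  have "(\<integral>x. u x \<partial>cellM L) $ i = (\<integral>x. u x $ i \<partial>cellM L)" for i
    using integral_bounded_linear[OF bounded_linear_vec_nth sq_integrable_integrable[OF u], of i] by simp
  then show ?thesis using vol_pos by (simp add: fourier_coeff_0_freq vec_eq_iff)
qed

subsection \<open>The projection onto gradient fields and the potential\<close>

text \<open>At frequency 0 the division by 0 yields 0, so constant fields are projected to 0 and the
  projected fields have mean zero.\<close>

definition grad_proj :: "'d \<Rightarrow> 'd \<Rightarrow> int^'d \<Rightarrow> complex" where
  "grad_proj j l \<xi> = of_real (freq L \<xi> $ j * freq L \<xi> $ l / (freq L \<xi> \<bullet> freq L \<xi>))"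

text \<open>Symbol of the divergence followed by the inverse Laplacian. Its value at frequency 0 is
  0, which selects the displacement of mean zero.\<close>

definition potential :: "int^'d \<Rightarrow> 'd \<Rightarrow> complex" where
  "potential \<xi> j = - \<i> * of_real (freq L \<xi> $ j / (freq L \<xi> \<bullet> freq L \<xi>))"

lemma multiplier_grad_proj: "multiplier (grad_proj j l)"
  unfolding multiplier_def
proof
  show "\<forall>\<xi>. grad_proj j l (- \<xi>) = cnj (grad_proj j l \<xi>)"
    by (simp add: grad_proj_def freq_minus)
  have "\<bar>w $ j * w $ l / (w \<bullet> w)\<bar> \<le> 1" for w :: "real^'d"
  proof -
    have "\<bar>w $ j\<bar> * \<bar>w $ l\<bar> \<le> norm w * norm w"
      by (intro mult_mono component_le_norm_cart) auto
    then show ?thesis by (cases "w = 0") (simp_all add: abs_mult dot_square_norm power2_eq_square divide_le_eq_1)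
  qed
  then show "\<exists>B. \<forall>\<xi>. cmod (grad_proj j l \<xi>) \<le> B"
    unfolding grad_proj_def by (intro exI[of _ 1] allI) (simp only: norm_of_real)
qed

text \<open>The sum dominates its largest term, which is the maximum of 1 / |w|^2 over the nonzero
  frequencies w.\<close>

definition poincare :: real where
  "poincare = (\<Sum>j\<in>UNIV. (L $ j / (2 * pi))\<^sup>2)"

lemma poincare_nonneg: "0 \<le> poincare"
  by (simp add: poincare_def sum_nonneg)

lemma inverse_freq_le_poincare: "1 / (freq L \<xi> \<bullet> freq L \<xi>) \<le> poincare"
proof (cases "\<xi> = 0")
  case True
  then show ?thesis using poincare_nonneg by simp
next
  case False
  then obtain j where j: "\<xi> $ j \<noteq> 0" by (auto simp: vec_eq_iff)
  have "1 \<le> \<bar>real_of_int (\<xi> $ j)\<bar>" using j by linarith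
  then have "2 * pi / L $ j \<le> \<bar>freq L \<xi> $ j\<bar>"
    using L_pos[of j] by (simp add: freq_def abs_mult divide_right_mono)
  then have "(2 * pi / L $ j)\<^sup>2 \<le> \<bar>freq L \<xi> $ j\<bar>\<^sup>2"
    using L_pos[of j] by (intro power_mono) (auto simp: less_imp_le)
  then have "(2 * pi / L $ j)\<^sup>2 \<le> (freq L \<xi> $ j)\<^sup>2" by simp
  also have "\<dots> \<le> freq L \<xi> \<bullet> freq L \<xi>"
    unfolding inner_self_sum by (intro member_le_sum) auto
  finally have le: "(2 * pi / L $ j)\<^sup>2 \<le> freq L \<xi> \<bullet> freq L \<xi>" .
  moreover have "0 < (2 * pi / L $ j)\<^sup>2" using L_pos[of j] by simp
  ultimately have "1 / (freq L \<xi> \<bullet> freq L \<xi>) \<le> 1 / (2 * pi / L $ j)\<^sup>2"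
    by (intro divide_left_mono mult_pos_pos) linarith+
  also have "\<dots> = (L $ j / (2 * pi))\<^sup>2" by (simp add: power_divide)
  also have "\<dots> \<le> poincare" unfolding poincare_def by (intro member_le_sum) auto
  finally show ?thesis .
qed

lemma potential_uminus: "potential (- \<xi>) j = cnj (potential \<xi> j)"
  by (simp add: potential_def freq_minus)

lemma sum_potential_sq: "(\<Sum>j\<in>UNIV. (freq L \<xi> $ j / (freq L \<xi> \<bullet> freq L \<xi>))\<^sup>2) = 1 / (freq L \<xi> \<bullet> freq L \<xi>)"
proof -
  have "(\<Sum>j\<in>UNIV. (freq L \<xi> $ j / (freq L \<xi> \<bullet> freq L \<xi>))\<^sup>2) = (freq L \<xi> \<bullet> freq L \<xi>) / (freq L \<xi> \<bullet> freq L \<xi>)\<^sup>2"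
    by (simp add: power_divide inner_self_sum flip: sum_divide_distrib)
  then show ?thesis by (simp add: power2_eq_square)
qed

lemma cmod_potential_sum_le:
  "(cmod (\<Sum>j\<in>UNIV. potential \<xi> j * z j))\<^sup>2 \<le> 1 / (freq L \<xi> \<bullet> freq L \<xi>) * (\<Sum>j\<in>UNIV. (cmod (z j))\<^sup>2)"
proof -
  have "(\<Sum>j\<in>UNIV. potential \<xi> j * z j) = - \<i> * (\<Sum>j\<in>UNIV. of_real (freq L \<xi> $ j / (freq L \<xi> \<bullet> freq L \<xi>)) * z j)"
    by (simp add: potential_def sum_distrib_left mult.assoc)
  then have "cmod (\<Sum>j\<in>UNIV. potential \<xi> j * z j) = cmod (\<Sum>j\<in>UNIV. of_real (freq L \<xi> $ j / (freq L \<xi> \<bullet> freq L \<xi>)) * z j)"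
    by (simp add: norm_mult)
  then show ?thesis
    using cmod_sum_scaled_le[of "\<lambda>j. freq L \<xi> $ j / (freq L \<xi> \<bullet> freq L \<xi>)" z UNIV]
    by (simp only: sum_potential_sq)
qed

text \<open>The projection factors as the gradient of the potential; this ties the multiplier of the
  iteration to that of the output layer.\<close>

lemma sum_grad_proj: "(\<Sum>j\<in>UNIV. grad_proj j l \<xi> * z j) = \<i> * of_real (freq L \<xi> $ l) * (\<Sum>j\<in>UNIV. potential \<xi> j * z j)"
  unfolding sum_distrib_left
  by (intro sum.cong refl) (simp add: grad_proj_def potential_def mult_ac)

lemma sum_grad_proj_le:
  "(\<Sum>l\<in>UNIV. (cmod (\<Sum>j\<in>UNIV. grad_proj j l \<xi> * z j))\<^sup>2) \<le> (\<Sum>j\<in>UNIV. (cmod (z j))\<^sup>2)"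
proof -
  let ?w = "freq L \<xi>"
  have "(\<Sum>l\<in>UNIV. (cmod (\<Sum>j\<in>UNIV. grad_proj j l \<xi> * z j))\<^sup>2) =
      (?w \<bullet> ?w) * (cmod (\<Sum>j\<in>UNIV. potential \<xi> j * z j))\<^sup>2"
    by (simp add: sum_grad_proj norm_mult power_mult_distrib inner_self_sum flip: sum_distrib_right)
  also have "\<dots> \<le> (?w \<bullet> ?w) * (1 / (?w \<bullet> ?w) * (\<Sum>j\<in>UNIV. (cmod (z j))\<^sup>2))"
    by (intro mult_left_mono cmod_potential_sum_le) auto
  also have "\<dots> \<le> (\<Sum>j\<in>UNIV. (cmod (z j))\<^sup>2)"
    by (auto simp: sum_nonneg)
  finally show ?thesis .
qed

definition proj :: "(real^'d \<Rightarrow> real^'d^'m) \<Rightarrow> real^'d \<Rightarrow> real^'d^'m" where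
  "proj T x = (\<chi> i l. \<Sum>j\<in>UNIV. mult (grad_proj j l) (\<lambda>x. T x $ i $ j) x)"

lemma
  assumes T: "sq_integrable L T"
  shows sq_integrable_proj: "sq_integrable L (proj T)"
    and fourier_coeff_proj: "fourier_coeff L (\<lambda>x. proj T x $ i $ l) \<xi> =
      (\<Sum>j\<in>UNIV. grad_proj j l \<xi> * fourier_coeff L (\<lambda>x. T x $ i $ j) \<xi>)"
proof -
  have m: "sq_integrable L (mult (grad_proj j l) (\<lambda>x. T x $ i $ j))" for i j l
    by (intro sq_integrable_mult multiplier_grad_proj sq_integrable_nth2 T)
  show "sq_integrable L (proj T)"
    by (rule sq_integrable_componentwise2) (simp add: proj_def sq_integrable_sum m)
  show "fourier_coeff L (\<lambda>x. proj T x $ i $ l) \<xi> =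
      (\<Sum>j\<in>UNIV. grad_proj j l \<xi> * fourier_coeff L (\<lambda>x. T x $ i $ j) \<xi>)"
    by (simp add: proj_def fourier_coeff_sum m fourier_coeff_mult multiplier_grad_proj sq_integrable_nth2 T)
qed

text \<open>Holds for arbitrary square integrable \<open>D\<close>, whose divergence-free part the
  potential ignores. This generality yields the H^1 boundedness of the output layer on all channel
  fields; applied to a difference of gradients, it turns their L^2 error into an H^1 error of the
  displacements.\<close>

lemma potential_H1:
  fixes w :: "real^'d \<Rightarrow> real^'m" and D :: "real^'d \<Rightarrow> real^'d^'m"
  assumes w: "sq_integrable L w" and D: "sq_integrable L D"
    and coeff: "\<And>i \<xi>. fourier_coeff L (\<lambda>x. w x $ i) \<xi> = (\<Sum>j\<in>UNIV. potential \<xi> j * fourier_coeff L (\<lambda>x. D x $ i $ j) \<xi>)"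
  shows "w \<in> H1_per0 L" "weak_grad L w (proj D)" "H1_norm L w \<le> sqrt (poincare + 1) * l2 L D"
proof -
  have pD: "sq_integrable L (proj D)" by (rule sq_integrable_proj[OF D])
  show wg: "weak_grad L w (proj D)"
    unfolding weak_grad_iff_fourier[OF w pD] by (simp add: fourier_coeff_proj[OF D] coeff sum_grad_proj)
  then have H1: "w \<in> H1_per L" using w by (auto simp: H1_per_def)
  have "fourier_coeff L (\<lambda>x. w x $ i) 0 = 0" for i
    by (simp add: coeff potential_def)
  then show "w \<in> H1_per0 L"
    using H1 integral_eq_0_iff_fourier[OF w] by (simp add: H1_per0_def)
  have wi: "sq_integrable L (\<lambda>x. w x $ i)" for i using w sq_integrable_componentwise by blast
  have le0: "(l2 L w)\<^sup>2 \<le> poincare * (l2 L D)\<^sup>2"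
  proof -
    have "(\<Sum>i\<in>UNIV. (l2 L (\<lambda>x. w x $ i))\<^sup>2) \<le> poincare * (\<Sum>p\<in>UNIV \<times> UNIV. (l2 L (\<lambda>x. D x $ fst p $ snd p))\<^sup>2)"
    proof (rule sum_l2_le_of_fourier)
      fix \<xi>
      have "(\<Sum>i\<in>UNIV. (cmod (fourier_coeff L (\<lambda>x. w x $ i) \<xi>))\<^sup>2) \<le>
          (\<Sum>i\<in>UNIV. poincare * (\<Sum>j\<in>UNIV. (cmod (fourier_coeff L (\<lambda>x. D x $ i $ j) \<xi>))\<^sup>2))"
        unfolding coeff
        by (intro sum_mono order_trans[OF cmod_potential_sum_le] mult_right_mono inverse_freq_le_poincare sum_nonneg) auto
      then show "(\<Sum>i\<in>UNIV. (cmod (fourier_coeff L (\<lambda>x. w x $ i) \<xi>))\<^sup>2) \<le>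
          poincare * (\<Sum>p\<in>UNIV \<times> UNIV. (cmod (fourier_coeff L (\<lambda>x. D x $ fst p $ snd p) \<xi>))\<^sup>2)"
        by (simp add: sum.cartesian_product case_prod_beta flip: sum_distrib_left)
    qed (auto intro: wi sq_integrable_nth2 D)
    then show ?thesis
      by (simp add: l2_vec[OF w] l2_mat[OF D] sum.cartesian_product case_prod_beta)
  qed
  have le1: "(l2 L (grad L w))\<^sup>2 \<le> 1 * (l2 L D)\<^sup>2"
  proof -
    have gw: "sq_integrable L (grad L w)" by (rule sq_integrable_grad[OF H1])
    have "(\<Sum>p\<in>UNIV \<times> UNIV. (l2 L (\<lambda>x. grad L w x $ fst p $ snd p))\<^sup>2) \<le> 1 * (\<Sum>p\<in>UNIV \<times> UNIV. (l2 L (\<lambda>x. D x $ fst p $ snd p))\<^sup>2)"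
    proof (rule sum_l2_le_of_fourier)
      fix \<xi>
      have "(\<Sum>i\<in>UNIV. \<Sum>l\<in>UNIV. (cmod (fourier_coeff L (\<lambda>x. grad L w x $ i $ l) \<xi>))\<^sup>2) \<le>
          (\<Sum>i\<in>UNIV. \<Sum>j\<in>UNIV. (cmod (fourier_coeff L (\<lambda>x. D x $ i $ j) \<xi>))\<^sup>2)"
        unfolding fourier_coeff_grad[OF H1] coeff sum_grad_proj[symmetric]
        by (intro sum_mono sum_grad_proj_le)
      then show "(\<Sum>p\<in>UNIV \<times> UNIV. (cmod (fourier_coeff L (\<lambda>x. grad L w x $ fst p $ snd p) \<xi>))\<^sup>2) \<le>
          1 * (\<Sum>p\<in>UNIV \<times> UNIV. (cmod (fourier_coeff L (\<lambda>x. D x $ fst p $ snd p) \<xi>))\<^sup>2)"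
        by (simp add: sum.cartesian_product case_prod_beta)
    qed (auto intro: gw sq_integrable_nth2 D)
    then show ?thesis
      by (simp add: l2_mat[OF gw] l2_mat[OF D] sum.cartesian_product case_prod_beta)
  qed
  have "H1_norm L w = sqrt ((l2 L w)\<^sup>2 + (l2 L (grad L w))\<^sup>2)"
    by (simp add: H1_norm_def l2_power2)
  also have "\<dots> \<le> sqrt ((poincare + 1) * (l2 L D)\<^sup>2)"
    unfolding distrib_right by (rule real_sqrt_le_mono[OF add_mono[OF le0 le1]])
  also have "\<dots> = sqrt (poincare + 1) * l2 L D" by (simp add: real_sqrt_mult)
  finally show "H1_norm L w \<le> sqrt (poincare + 1) * l2 L D" .
qed

end

section \<open>The corrector equation\<close>

definition sym_part :: "real^'d^'d \<Rightarrow> real^'d^'d" where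
  "sym_part A = (1/2) *\<^sub>R (A + transpose A)"

definition admissible :: "real \<Rightarrow> real \<Rightarrow> ((real^'d^'d) \<Rightarrow>\<^sub>L (real^'d^'d)) \<Rightarrow> bool" where
  "admissible \<alpha>m \<alpha>p T \<longleftrightarrow> T \<in> sym_sym \<and> (\<forall>A\<in>sym_mats.
     \<alpha>m * (norm A)\<^sup>2 \<le> A \<bullet> blinfun_apply T A \<and> A \<bullet> blinfun_apply T A \<le> \<alpha>p * (norm A)\<^sup>2)"

lemma transpose_add: "transpose (A + B) = transpose A + transpose (B :: real^'n^'m)"
  and transpose_diff: "transpose (A - B) = transpose A - transpose B"
  and transpose_scaleR: "transpose (c *\<^sub>R A) = c *\<^sub>R transpose A"
  by (simp_all add: transpose_def vec_eq_iff)

lemma sym_part_add: "sym_part (A + B) = sym_part A + sym_part B"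
  and sym_part_diff: "sym_part (A - B) = sym_part A - sym_part B"
  by (simp_all add: sym_part_def transpose_add transpose_diff scaleR_add_right[symmetric] scaleR_diff_right[symmetric] del: scaleR_add_right)

lemma sym_part_in [simp]: "sym_part A \<in> sym_mats"
  by (simp add: sym_part_def sym_mats_def transpose_def vec_eq_iff)

lemma sym_part_of_sym: "A \<in> sym_mats \<Longrightarrow> sym_part A = A"
  by (simp add: sym_part_def sym_mats_def flip: scaleR_2)

lemma sym_mats_add: "A \<in> sym_mats \<Longrightarrow> B \<in> sym_mats \<Longrightarrow> A + B \<in> sym_mats"
  and sym_mats_scaleR: "A \<in> sym_mats \<Longrightarrow> c *\<^sub>R A \<in> sym_mats"
  by (auto simp: sym_mats_def transpose_def vec_eq_iff)

lemma inner_matrix: "(A::real^'n^'m) \<bullet> B = (\<Sum>i\<in>UNIV. \<Sum>j\<in>UNIV. A $ i $ j * B $ i $ j)"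
  by (simp add: inner_vec_def)

lemma inner_transpose: "transpose A \<bullet> B = A \<bullet> transpose (B :: real^'n^'m)"
  unfolding inner_matrix transpose_def by (subst sum.swap) simp

lemma inner_sym_part: "B \<in> sym_mats \<Longrightarrow> sym_part A \<bullet> B = A \<bullet> B"
  by (simp add: sym_part_def inner_add_left inner_transpose sym_mats_def)

text \<open>The representation vanishes on skew matrices, so a stress may be computed from the full
  gradient in place of the strain.\<close>

lemma sym_sym_apply_sym_part:
  assumes "T \<in> sym_sym"
  shows "blinfun_apply T (sym_part A) = blinfun_apply T A"
proof -
  have "transpose (A - sym_part A) = - (A - sym_part A)"
    by (simp add: sym_part_def transpose_def vec_eq_iff add_divide_distrib)
  then have "blinfun_apply T (A - sym_part A) = 0"
    using assms by (simp add: sym_sym_def)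
  then show ?thesis by (simp add: blinfun.diff_right)
qed

lemma sym_sym_apply_in:
  assumes "T \<in> sym_sym"
  shows "blinfun_apply T A \<in> sym_mats"
  using assms sym_sym_apply_sym_part[OF assms, of A] sym_part_in[of A] unfolding sym_sym_def by fastforce

lemma admissible_coercive:
  assumes "admissible \<alpha>m \<alpha>p T"
  shows "\<alpha>m * (norm (sym_part A))\<^sup>2 \<le> A \<bullet> blinfun_apply T A"
proof -
  have T: "T \<in> sym_sym" using assms by (simp add: admissible_def)
  have "A \<bullet> blinfun_apply T A = sym_part A \<bullet> blinfun_apply T (sym_part A)"
    by (simp add: inner_sym_part sym_sym_apply_in[OF T] sym_sym_apply_sym_part[OF T])
  then show ?thesis using assms by (simp add: admissible_def)
qed

text \<open>Positivity of the quadratic form at \<open>X - T X / \<alpha>p\<close>, where \<open>X\<close> is the symmetric part of \<open>A\<close>.\<close>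

lemma admissible_norm_sq:
  assumes adm: "admissible \<alpha>m \<alpha>p T" and \<alpha>: "0 < \<alpha>m" "\<alpha>m < \<alpha>p"
  shows "(norm (blinfun_apply T A))\<^sup>2 \<le> \<alpha>p * (A \<bullet> blinfun_apply T A)"
proof -
  have T: "T \<in> sym_sym" using adm by (simp add: admissible_def)
  define X where "X = sym_part A"
  define Y where "Y = blinfun_apply T X"
  define t where "t = - (1 / \<alpha>p)"
  have X: "X \<in> sym_mats" by (simp add: X_def)
  have Y: "Y \<in> sym_mats" unfolding Y_def by (rule sym_sym_apply_in[OF T])
  have XY: "X \<bullet> blinfun_apply T Y = Y \<bullet> Y"
    using T X Y unfolding sym_sym_def Y_def by (metis (mono_tags, lifting) mem_Collect_eq)
  have "0 \<le> \<alpha>m * (norm (X + t *\<^sub>R Y))\<^sup>2" using \<alpha> by simp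
  also have "\<dots> \<le> (X + t *\<^sub>R Y) \<bullet> blinfun_apply T (X + t *\<^sub>R Y)"
    using adm sym_mats_add[OF X sym_mats_scaleR[OF Y]] by (simp add: admissible_def)
  also have "\<dots> = X \<bullet> Y + 2 * t * (norm Y)\<^sup>2 + t\<^sup>2 * (Y \<bullet> blinfun_apply T Y)"
    unfolding power2_norm_eq_inner
    by (simp add: blinfun.add_right blinfun.scaleR_right inner_add_left inner_add_right XY
        power2_eq_square inner_commute[of Y X] algebra_simps flip: Y_def)
  also have "\<dots> \<le> X \<bullet> Y + 2 * t * (norm Y)\<^sup>2 + t\<^sup>2 * (\<alpha>p * (norm Y)\<^sup>2)"
    using adm Y by (intro add_left_mono mult_left_mono) (auto simp: admissible_def)
  also have "\<dots> = X \<bullet> Y - (norm Y)\<^sup>2 / \<alpha>p"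
    using \<alpha> by (simp add: t_def power2_eq_square field_simps)
  finally have "(norm Y)\<^sup>2 \<le> \<alpha>p * (X \<bullet> Y)" using \<alpha> by (simp add: field_simps)
  moreover have "Y = blinfun_apply T A" by (simp add: Y_def X_def sym_sym_apply_sym_part[OF T])
  moreover have "X \<bullet> Y = A \<bullet> Y" unfolding X_def by (rule inner_sym_part[OF Y])
  ultimately show ?thesis by simp
qed

lemma admissible_norm_le:
  assumes adm: "admissible \<alpha>m \<alpha>p T" and \<alpha>: "0 < \<alpha>m" "\<alpha>m < \<alpha>p"
  shows "norm (blinfun_apply T A) \<le> \<alpha>p * norm A"
proof (cases "blinfun_apply T A = 0")
  case False
  have "norm (blinfun_apply T A) * norm (blinfun_apply T A) \<le> \<alpha>p * (A \<bullet> blinfun_apply T A)"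
    using admissible_norm_sq[OF assms] by (simp add: power2_eq_square)
  also have "\<dots> \<le> \<alpha>p * (norm A * norm (blinfun_apply T A))"
    using \<alpha> by (intro mult_left_mono norm_cauchy_schwarz) auto
  finally show ?thesis using False by (simp add: mult.assoc[symmetric])
qed (use \<alpha> in auto)

text \<open>In the expansion of the square, the bound on |T A|^2 gives back half of the cross term
  and leaves -(A : T A) / \<open>\<alpha>p\<close>, which coercivity estimates by the symmetric
  part. The step length 1 / \<open>\<alpha>p\<close> is the minimizer of -2 t + t^2
  \<open>\<alpha>p\<close>.\<close>

lemma admissible_contraction:
  assumes adm: "admissible \<alpha>m \<alpha>p T" and \<alpha>: "0 < \<alpha>m" "\<alpha>m < \<alpha>p"
  shows "(norm (A - (1 / \<alpha>p) *\<^sub>R blinfun_apply T A))\<^sup>2 \<le> (norm A)\<^sup>2 - \<alpha>m / \<alpha>p * (norm (sym_part A))\<^sup>2"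
proof -
  let ?B = "blinfun_apply T A"
  have "(norm (A - (1 / \<alpha>p) *\<^sub>R ?B))\<^sup>2 = (norm A)\<^sup>2 - 2 / \<alpha>p * (A \<bullet> ?B) + (1 / \<alpha>p)\<^sup>2 * (norm ?B)\<^sup>2"
    unfolding power2_norm_eq_inner
    by (simp add: inner_diff_left inner_diff_right inner_commute power2_eq_square algebra_simps)
  also have "\<dots> \<le> (norm A)\<^sup>2 - 2 / \<alpha>p * (A \<bullet> ?B) + (1 / \<alpha>p)\<^sup>2 * (\<alpha>p * (A \<bullet> ?B))"
    by (intro add_left_mono mult_left_mono admissible_norm_sq[OF assms]) auto
  also have "\<dots> = (norm A)\<^sup>2 - (A \<bullet> ?B) / \<alpha>p"
    using \<alpha> by (simp add: power2_eq_square field_simps)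
  also have "\<dots> \<le> (norm A)\<^sup>2 - \<alpha>m * (norm (sym_part A))\<^sup>2 / \<alpha>p"
    using \<alpha> by (intro diff_left_mono divide_right_mono admissible_coercive[OF adm]) auto
  finally show ?thesis by simp
qed

section \<open>Measurability and size of the stress field\<close>

lemma stiffness_admissible:
  assumes "C \<in> stiffness_fields L \<alpha>m \<alpha>p"
  shows "AE x in cellM L. admissible \<alpha>m \<alpha>p (C x)"
proof -
  have "AE x in cellM L. \<forall>A\<in>sym_mats.
        \<alpha>m * (norm A)\<^sup>2 \<le> A \<bullet> blinfun_apply (C x) A \<and>
        A \<bullet> blinfun_apply (C x) A \<le> \<alpha>p * (norm A)\<^sup>2"
    using assms by (simp add: stiffness_fields_def)
  moreover have "AE x in cellM L. C x \<in> sym_sym"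
    using assms by (intro AE_I2) (simp add: stiffness_fields_def)
  ultimately show ?thesis by eventually_elim (simp add: admissible_def)
qed

lemma matrix_expansion: "(A::real^'n^'m) = (\<Sum>k\<in>UNIV. \<Sum>l\<in>UNIV. A $ k $ l *\<^sub>R axis k (axis l 1))"
proof -
  have "(\<Sum>k\<in>UNIV. \<Sum>l\<in>UNIV. A $ k $ l *\<^sub>R axis k (axis l 1)) $ i $ j = A $ i $ j" for i j
  proof -
    have "(\<Sum>l\<in>UNIV. (A $ k $ l *\<^sub>R axis k (axis l (1::real)) :: real^'n^'m) $ i $ j) = (if k = i then A $ i $ j else 0)" for k
      by (auto simp: axis_def if_distrib[of "\<lambda>v. v $ j"] if_distrib[of "\<lambda>c. _ * c"] cong: if_cong)
    then show ?thesis by simp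
  qed
  then show ?thesis by (simp add: vec_eq_iff)
qed

lemma blinfun_matrix_expansion:
  fixes T :: "(real^'n^'m) \<Rightarrow>\<^sub>L 'b::real_normed_vector"
  shows "blinfun_apply T A = (\<Sum>k\<in>UNIV. \<Sum>l\<in>UNIV. A $ k $ l *\<^sub>R blinfun_apply T (axis k (axis l 1)))"
  by (subst matrix_expansion[of A]) (simp only: blinfun.sum_right blinfun.scaleR_right)

lemma measurable_blinfun_apply_const:
  fixes C :: "real^'d \<Rightarrow> 'a::real_normed_vector \<Rightarrow>\<^sub>L 'b::real_normed_vector"
  assumes "C \<in> borel_measurable M"
  shows "(\<lambda>x. blinfun_apply (C x) A) \<in> borel_measurable M"
proof -
  have "continuous_on UNIV (\<lambda>T :: 'a \<Rightarrow>\<^sub>L 'b. blinfun_apply T A)"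
    by (intro linear_continuous_on blinfun.bounded_linear_left)
  from borel_measurable_continuous_on[OF this assms] show ?thesis .
qed

lemma sq_integrable_stiffness:
  assumes C: "C \<in> stiffness_fields L \<alpha>m \<alpha>p" and \<alpha>: "0 < \<alpha>m" "\<alpha>m < \<alpha>p" and A: "sq_integrable L A"
  shows "sq_integrable L (\<lambda>x. blinfun_apply (C x) (A x))"
proof (rule sq_integrable_bound[OF _ sq_integrable_scaleR[OF A, of \<alpha>p]])
  have Cm: "(\<lambda>x. blinfun_apply (C x) B) \<in> borel_measurable (cellM L)" for B
    using C by (intro measurable_blinfun_apply_const) (simp add: stiffness_fields_def)
  have Am: "(\<lambda>x. A x $ k $ l) \<in> borel_measurable (cellM L)" for k l
    using sq_integrable_nth2[OF A] by (simp add: sq_integrable_def)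
  \<comment> \<open>Expanding the argument in matrix units separates the two dependences on
    \<open>x\<close>: measurable scalars times values of \<open>C x\<close> at fixed
    matrices.\<close>
  have "(\<lambda>x. \<Sum>k\<in>UNIV. \<Sum>l\<in>UNIV. A x $ k $ l *\<^sub>R blinfun_apply (C x) (axis k (axis l 1))) \<in> borel_measurable (cellM L)"
    by (intro borel_measurable_sum borel_measurable_scaleR Cm Am)
  then show "(\<lambda>x. blinfun_apply (C x) (A x)) \<in> borel_measurable (cellM L)"
    by (subst blinfun_matrix_expansion)
  show "AE x in cellM L. norm (blinfun_apply (C x) (A x)) \<le> norm (\<alpha>p *\<^sub>R A x)"
    using stiffness_admissible[OF C]
    by eventually_elim (use admissible_norm_le \<alpha> in fastforce)
qed

lemma sq_integrable_sym_part:
  assumes "sq_integrable L D" shows "sq_integrable L (\<lambda>x. sym_part (D x))"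
proof -
  have "bounded_linear (sym_part :: real^'d^'d \<Rightarrow> _)"
    unfolding linear_conv_bounded_linear[symmetric]
    by (auto simp: linear_iff sym_part_add) (simp add: sym_part_def transpose_scaleR algebra_simps)
  then show ?thesis by (rule sq_integrable_bounded_linear[OF _ assms])
qed

context periodic_cell
begin

text \<open>Gradients are recognized as the fields fixed by the projection, on Fourier coefficients
  and without naming a potential. The condition passes to differences and across null sets, and
  every projected field satisfies it.\<close>

definition gradient_type :: "(real^'d \<Rightarrow> real^'d^'m) \<Rightarrow> bool" where
  "gradient_type D \<longleftrightarrow> sq_integrable L D \<and> (\<forall>i l \<xi>. fourier_coeff L (\<lambda>x. D x $ i $ l) \<xi> =
     (\<Sum>j\<in>UNIV. grad_proj j l \<xi> * fourier_coeff L (\<lambda>x. D x $ i $ j) \<xi>))"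

lemma sum_freq_grad_proj: "(\<Sum>j\<in>UNIV. of_real (freq L \<xi> $ j) * grad_proj m j \<xi>) = of_real (freq L \<xi> $ m)"
proof (cases "freq L \<xi> = 0")
  case False
  have "(\<Sum>j\<in>UNIV. freq L \<xi> $ j * (freq L \<xi> $ m * freq L \<xi> $ j / (freq L \<xi> \<bullet> freq L \<xi>))) = freq L \<xi> $ m"
  proof -
    have "(\<Sum>j\<in>UNIV. freq L \<xi> $ j * (freq L \<xi> $ m * freq L \<xi> $ j / (freq L \<xi> \<bullet> freq L \<xi>))) =
        freq L \<xi> $ m * (\<Sum>j\<in>UNIV. (freq L \<xi> $ j)\<^sup>2) / (freq L \<xi> \<bullet> freq L \<xi>)"
      unfolding sum_distrib_left sum_divide_distrib by (intro sum.cong refl) (simp add: power2_eq_square)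
    then show ?thesis using False by (simp add: inner_self_sum[of "freq L \<xi>", symmetric])
  qed
  then show ?thesis
    unfolding grad_proj_def of_real_mult[symmetric] of_real_sum[symmetric] by simp
qed (simp add: grad_proj_def)

lemma grad_proj_idem: "(\<Sum>j\<in>UNIV. grad_proj j l \<xi> * grad_proj m j \<xi>) = grad_proj m l \<xi>"
proof -
  let ?w = "freq L \<xi>"
  have "(\<Sum>j\<in>UNIV. grad_proj j l \<xi> * grad_proj m j \<xi>) =
      of_real (?w $ l / (?w \<bullet> ?w)) * (\<Sum>j\<in>UNIV. of_real (?w $ j) * grad_proj m j \<xi>)"
    unfolding sum_distrib_left by (intro sum.cong refl) (simp add: grad_proj_def[of _ l])
  also have "\<dots> = grad_proj m l \<xi>" by (simp only: sum_freq_grad_proj) (simp add: grad_proj_def)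
  finally show ?thesis .
qed

lemma gradient_type_proj:
  assumes T: "sq_integrable L T" shows "gradient_type (proj T)"
  unfolding gradient_type_def
proof (intro conjI allI)
  show "sq_integrable L (proj T)" by (rule sq_integrable_proj[OF T])
  fix i l \<xi>
  have "(\<Sum>j\<in>UNIV. grad_proj j l \<xi> * (\<Sum>m\<in>UNIV. grad_proj m j \<xi> * fourier_coeff L (\<lambda>x. T x $ i $ m) \<xi>)) =
      (\<Sum>m\<in>UNIV. (\<Sum>j\<in>UNIV. grad_proj j l \<xi> * grad_proj m j \<xi>) * fourier_coeff L (\<lambda>x. T x $ i $ m) \<xi>)"
    unfolding sum_distrib_left sum_distrib_right by (subst sum.swap) (simp add: mult.assoc)
  then show "fourier_coeff L (\<lambda>x. proj T x $ i $ l) \<xi> =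
      (\<Sum>j\<in>UNIV. grad_proj j l \<xi> * fourier_coeff L (\<lambda>x. proj T x $ i $ j) \<xi>)"
    by (simp add: fourier_coeff_proj[OF T] grad_proj_idem)
qed

lemma gradient_type_0: "gradient_type (\<lambda>_. 0)"
  by (simp add: gradient_type_def)

lemma gradient_type_diff:
  assumes "gradient_type D" "gradient_type H"
  shows "gradient_type (\<lambda>x. D x - H x)"
  unfolding gradient_type_def
proof (intro conjI allI)
  have sq: "sq_integrable L D" "sq_integrable L H" using assms by (simp_all only: gradient_type_def)
  then show "sq_integrable L (\<lambda>x. D x - H x)" by (rule sq_integrable_diff)
  have diff: "fourier_coeff L (\<lambda>x. (D x - H x) $ i $ l) \<xi> =
      fourier_coeff L (\<lambda>x. D x $ i $ l) \<xi> - fourier_coeff L (\<lambda>x. H x $ i $ l) \<xi>" for i l \<xi>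
    using sq by (simp add: fourier_coeff_diff sq_integrable_nth2)
  fix i l \<xi>
  have "fourier_coeff L (\<lambda>x. D x $ i $ l) \<xi> - fourier_coeff L (\<lambda>x. H x $ i $ l) \<xi> =
      (\<Sum>j\<in>UNIV. grad_proj j l \<xi> * fourier_coeff L (\<lambda>x. D x $ i $ j) \<xi>) -
      (\<Sum>j\<in>UNIV. grad_proj j l \<xi> * fourier_coeff L (\<lambda>x. H x $ i $ j) \<xi>)"
    using assms unfolding gradient_type_def by metis
  then show "fourier_coeff L (\<lambda>x. (D x - H x) $ i $ l) \<xi> =
      (\<Sum>j\<in>UNIV. grad_proj j l \<xi> * fourier_coeff L (\<lambda>x. (D x - H x) $ i $ j) \<xi>)"
    unfolding diff by (simp only: right_diff_distrib sum_subtractf)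
qed

lemma gradient_type_grad:
  assumes "u \<in> H1_per L" shows "gradient_type (grad L u)"
  unfolding gradient_type_def fourier_coeff_grad[OF assms]
proof (intro conjI allI sq_integrable_grad[OF assms])
  fix i l \<xi>
  have "(\<Sum>j\<in>UNIV. grad_proj j l \<xi> * (\<i> * of_real (freq L \<xi> $ j) * fourier_coeff L (\<lambda>x. u x $ i) \<xi>)) =
     \<i> * fourier_coeff L (\<lambda>x. u x $ i) \<xi> * (\<Sum>j\<in>UNIV. of_real (freq L \<xi> $ j) * grad_proj l j \<xi>)"
    unfolding sum_distrib_left by (intro sum.cong refl) (simp add: grad_proj_def mult_ac)
  also have "\<dots> = \<i> * of_real (freq L \<xi> $ l) * fourier_coeff L (\<lambda>x. u x $ i) \<xi>"
    by (simp only: sum_freq_grad_proj) simp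
  finally show "\<i> * of_real (freq L \<xi> $ l) * fourier_coeff L (\<lambda>x. u x $ i) \<xi> =
      (\<Sum>j\<in>UNIV. grad_proj j l \<xi> * (\<i> * of_real (freq L \<xi> $ j) * fourier_coeff L (\<lambda>x. u x $ i) \<xi>))"
    by (rule sym)
qed

lemma l2_mat_le_of_fourier:
  fixes A :: "real^'d \<Rightarrow> real^'n^'m" and B :: "real^'d \<Rightarrow> real^'k^'l"
  assumes A: "sq_integrable L A" and B: "sq_integrable L B"
    and le: "\<And>\<xi>. (\<Sum>i\<in>UNIV. \<Sum>j\<in>UNIV. (cmod (fourier_coeff L (\<lambda>x. A x $ i $ j) \<xi>))\<^sup>2) \<le>
      c * (\<Sum>i\<in>UNIV. \<Sum>j\<in>UNIV. (cmod (fourier_coeff L (\<lambda>x. B x $ i $ j) \<xi>))\<^sup>2)"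
  shows "(l2 L A)\<^sup>2 \<le> c * (l2 L B)\<^sup>2"
proof -
  have "(\<Sum>p\<in>UNIV \<times> UNIV. (l2 L (\<lambda>x. A x $ fst p $ snd p))\<^sup>2) \<le> c * (\<Sum>p\<in>UNIV \<times> UNIV. (l2 L (\<lambda>x. B x $ fst p $ snd p))\<^sup>2)"
  proof (rule sum_l2_le_of_fourier)
    fix \<xi>
    show "(\<Sum>p\<in>UNIV \<times> UNIV. (cmod (fourier_coeff L (\<lambda>x. A x $ fst p $ snd p) \<xi>))\<^sup>2) \<le>
        c * (\<Sum>p\<in>UNIV \<times> UNIV. (cmod (fourier_coeff L (\<lambda>x. B x $ fst p $ snd p) \<xi>))\<^sup>2)"
      using le[of \<xi>] by (simp add: sum.cartesian_product case_prod_beta)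
  qed (auto intro: sq_integrable_nth2 A B)
  then show ?thesis
    by (simp add: l2_mat[OF A] l2_mat[OF B] sum.cartesian_product case_prod_beta)
qed

lemma l2_proj_diff_le:
  fixes A B :: "real^'d \<Rightarrow> real^'d^'m"
  assumes A: "sq_integrable L A" and B: "sq_integrable L B"
  shows "l2 L (\<lambda>x. proj A x - proj B x) \<le> l2 L (\<lambda>x. A x - B x)"
proof -
  have "(l2 L (\<lambda>x. proj A x - proj B x))\<^sup>2 \<le> 1 * (l2 L (\<lambda>x. A x - B x))\<^sup>2"
  proof (rule l2_mat_le_of_fourier)
    fix \<xi>
    have eq: "fourier_coeff L (\<lambda>x. (proj A x - proj B x) $ i $ l) \<xi> =
        (\<Sum>j\<in>UNIV. grad_proj j l \<xi> * fourier_coeff L (\<lambda>x. (A x - B x) $ i $ j) \<xi>)" for i l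
      using A B by (simp add: fourier_coeff_diff sq_integrable_nth2 sq_integrable_proj fourier_coeff_proj
          right_diff_distrib sum_subtractf)
    show "(\<Sum>i\<in>UNIV. \<Sum>l\<in>UNIV. (cmod (fourier_coeff L (\<lambda>x. (proj A x - proj B x) $ i $ l) \<xi>))\<^sup>2) \<le>
        1 * (\<Sum>i\<in>UNIV. \<Sum>j\<in>UNIV. (cmod (fourier_coeff L (\<lambda>x. (A x - B x) $ i $ j) \<xi>))\<^sup>2)"
      unfolding eq mult_1 by (intro sum_mono sum_grad_proj_le)
  qed (intro sq_integrable_diff sq_integrable_proj A B)+
  then show ?thesis unfolding mult_1 by (rule power2_le_imp_le) simp
qed

text \<open>At each frequency w a gradient has coefficients \<open>z i j\<close> = i w_j a_i.
  Averaging with the transpose keeps half of the squared norm and adds half of the cross term, which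
  is |sum_i w_i a_i|^2, the squared modulus of the divergence coefficient, and hence
  nonnegative.\<close>

lemma Korn:
  fixes D :: "real^'d \<Rightarrow> real^'d^'d"
  assumes "gradient_type D"
  shows "(l2 L D)\<^sup>2 \<le> 2 * (l2 L (\<lambda>x. sym_part (D x)))\<^sup>2"
proof (rule l2_mat_le_of_fourier)
  have D: "sq_integrable L D" and proj: "\<And>i l \<xi>. fourier_coeff L (\<lambda>x. D x $ i $ l) \<xi> =
     (\<Sum>j\<in>UNIV. grad_proj j l \<xi> * fourier_coeff L (\<lambda>x. D x $ i $ j) \<xi>)"
    using assms unfolding gradient_type_def by blast+
  show "sq_integrable L D" "sq_integrable L (\<lambda>x. sym_part (D x))"
    by (rule D, rule sq_integrable_sym_part[OF D])
  fix \<xi>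
  define z where "z i j = fourier_coeff L (\<lambda>x. D x $ i $ j) \<xi>" for i j
  define w where "w = freq L \<xi>"
  define a where "a i = (\<Sum>j\<in>UNIV. potential \<xi> j * z i j)" for i
  have z: "z i j = \<i> * of_real (w $ j) * a i" for i j
    unfolding z_def proj[of i j] sum_grad_proj by (simp add: a_def z_def w_def)
  have s: "fourier_coeff L (\<lambda>x. sym_part (D x) $ i $ j) \<xi> = (z i j + z j i) / 2" for i j
  proof -
    have "fourier_coeff L (\<lambda>x. 1 / 2 * (D x $ i $ j + D x $ j $ i)) \<xi> = of_real (1 / 2) * (z i j + z j i)"
      unfolding fourier_coeff_cmult z_def using D by (simp add: fourier_coeff_add sq_integrable_nth2)
    then show ?thesis by (simp add: sym_part_def transpose_def)
  qed
  have half: "n \<le> 2 * s" if "s = (n + n) / 4 + r / 2" "0 \<le> r" for n r s :: real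
    using that by simp
  have nonneg: "0 \<le> Re (y * cnj y)" for y by simp
  have sq: "(cmod ((x + y) / 2))\<^sup>2 = ((cmod x)\<^sup>2 + (cmod y)\<^sup>2) / 4 + Re (x * cnj y) / 2" for x y
    unfolding cmod_power2 by (simp add: power2_eq_square field_simps)
  have "(\<Sum>i\<in>UNIV. \<Sum>j\<in>UNIV. Re (z i j * cnj (z j i))) = Re (\<Sum>i\<in>UNIV. \<Sum>j\<in>UNIV. (of_real (w $ i) * a i) * cnj (of_real (w $ j) * a j))"
    by (simp add: z Re_sum mult_ac)
  also have "\<dots> = Re ((\<Sum>i\<in>UNIV. of_real (w $ i) * a i) * cnj (\<Sum>i\<in>UNIV. of_real (w $ i) * a i))"
    by (simp only: sum_product cnj_sum)
  also have "\<dots> \<ge> 0" by (rule nonneg)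
  finally have pos: "0 \<le> (\<Sum>i\<in>UNIV. \<Sum>j\<in>UNIV. Re (z i j * cnj (z j i)))" .
  have "(\<Sum>i\<in>UNIV. \<Sum>j\<in>UNIV. (cmod ((z i j + z j i) / 2))\<^sup>2) =
      ((\<Sum>i\<in>UNIV. \<Sum>j\<in>UNIV. (cmod (z i j))\<^sup>2) + (\<Sum>i\<in>UNIV. \<Sum>j\<in>UNIV. (cmod (z j i))\<^sup>2)) / 4
      + (\<Sum>i\<in>UNIV. \<Sum>j\<in>UNIV. Re (z i j * cnj (z j i))) / 2"
    unfolding sq by (simp only: sum.distrib sum_divide_distrib add_divide_distrib)
  also have "(\<Sum>i\<in>UNIV. \<Sum>j\<in>UNIV. (cmod (z j i))\<^sup>2) = (\<Sum>i\<in>UNIV. \<Sum>j\<in>UNIV. (cmod (z i j))\<^sup>2)"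
    by (rule sum.swap)
  finally have "2 * (\<Sum>i\<in>UNIV. \<Sum>j\<in>UNIV. (cmod ((z i j + z j i) / 2))\<^sup>2) \<ge> (\<Sum>i\<in>UNIV. \<Sum>j\<in>UNIV. (cmod (z i j))\<^sup>2)"
    using pos by (rule half)
  then show "(\<Sum>i\<in>UNIV. \<Sum>j\<in>UNIV. (cmod (fourier_coeff L (\<lambda>x. D x $ i $ j) \<xi>))\<^sup>2) \<le>
      2 * (\<Sum>i\<in>UNIV. \<Sum>j\<in>UNIV. (cmod (fourier_coeff L (\<lambda>x. sym_part (D x) $ i $ j) \<xi>))\<^sup>2)"
    by (simp only: s z_def[symmetric])
qed

text \<open>The pointwise contraction gains a multiple of the symmetric part only; after
  integration, Korn's inequality makes this a gain of half that multiple of the full norm.\<close>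

lemma l2_contraction:
  fixes D :: "real^'d \<Rightarrow> real^'d^'d"
  assumes C: "C \<in> stiffness_fields L \<alpha>m \<alpha>p" and \<alpha>: "0 < \<alpha>m" "\<alpha>m < \<alpha>p" and D: "gradient_type D"
  shows "l2 L (\<lambda>x. D x - (1 / \<alpha>p) *\<^sub>R blinfun_apply (C x) (D x)) \<le> sqrt (1 - \<alpha>m / (2 * \<alpha>p)) * l2 L D"
proof -
  have sD: "sq_integrable L D" using D by (simp only: gradient_type_def)
  have sS: "sq_integrable L (\<lambda>x. sym_part (D x))" by (rule sq_integrable_sym_part[OF sD])
  have sA: "sq_integrable L (\<lambda>x. D x - (1 / \<alpha>p) *\<^sub>R blinfun_apply (C x) (D x))"
    by (intro sq_integrable_diff sq_integrable_scaleR sq_integrable_stiffness[OF C \<alpha>] sD)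
  have "(l2 L (\<lambda>x. D x - (1 / \<alpha>p) *\<^sub>R blinfun_apply (C x) (D x)))\<^sup>2 \<le>
      (\<integral>x. (norm (D x))\<^sup>2 - \<alpha>m / \<alpha>p * (norm (sym_part (D x)))\<^sup>2 \<partial>cellM L)"
    unfolding l2_power2
  proof (rule integral_mono_AE)
    show "AE x in cellM L. (norm (D x - (1 / \<alpha>p) *\<^sub>R blinfun_apply (C x) (D x)))\<^sup>2 \<le>
        (norm (D x))\<^sup>2 - \<alpha>m / \<alpha>p * (norm (sym_part (D x)))\<^sup>2"
      using stiffness_admissible[OF C] by eventually_elim (rule admissible_contraction[OF _ \<alpha>])
  qed (use sA sD sS in \<open>simp_all add: sq_integrable_def\<close>)
  also have "\<dots> = (l2 L D)\<^sup>2 - \<alpha>m / \<alpha>p * (l2 L (\<lambda>x. sym_part (D x)))\<^sup>2"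
    unfolding l2_power2 using sD sS by (simp add: sq_integrable_def)
  also have "\<dots> \<le> (l2 L D)\<^sup>2 - \<alpha>m / \<alpha>p * ((l2 L D)\<^sup>2 / 2)"
    using Korn[OF D] \<alpha> by (intro diff_left_mono mult_left_mono) auto
  also have "\<dots> = (1 - \<alpha>m / (2 * \<alpha>p)) * (l2 L D)\<^sup>2"
    by (simp add: algebra_simps)
  finally have "l2 L (\<lambda>x. D x - (1 / \<alpha>p) *\<^sub>R blinfun_apply (C x) (D x)) \<le> sqrt ((1 - \<alpha>m / (2 * \<alpha>p)) * (l2 L D)\<^sup>2)"
    by (rule real_le_rsqrt)
  then show ?thesis by (simp add: real_sqrt_mult)
qed

lemma l2_cong_AE_eq:
  assumes "sq_integrable L f" "sq_integrable L g" "AE x in cellM L. f x = g x"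
  shows "l2 L f = l2 L g"
  using assms by (intro l2_cong_AE) (auto elim: eventually_mono)

text \<open>\<open>G\<close> is the gradient of the solution; \<open>M\<close> is an approximation of the stress \<open>C : (e + H)\<close>.\<close>

lemma iteration_step:
  fixes G H M :: "real^'d \<Rightarrow> real^'d^'d"
  assumes C: "C \<in> stiffness_fields L \<alpha>m \<alpha>p" and \<alpha>: "0 < \<alpha>m" "\<alpha>m < \<alpha>p"
    and G: "gradient_type G" and H: "gradient_type H" and M: "sq_integrable L M"
    and fixp: "AE x in cellM L. proj (\<lambda>x. G x - (1 / \<alpha>p) *\<^sub>R blinfun_apply (C x) (e + G x)) x = G x"
  shows "l2 L (\<lambda>x. proj (\<lambda>x. H x - (1 / \<alpha>p) *\<^sub>R M x) x - G x) \<le>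
    sqrt (1 - \<alpha>m / (2 * \<alpha>p)) * l2 L (\<lambda>x. H x - G x)
    + 1 / \<alpha>p * l2 L (\<lambda>x. M x - blinfun_apply (C x) (e + H x))"
proof -
  have sG: "sq_integrable L G" and sH: "sq_integrable L H" using G H by (simp_all only: gradient_type_def)
  have CG: "sq_integrable L (\<lambda>x. blinfun_apply (C x) (e + G x))"
    and CH: "sq_integrable L (\<lambda>x. blinfun_apply (C x) (e + H x))"
    by (intro sq_integrable_stiffness[OF C \<alpha>] sq_integrable_add sq_integrable_const sG sH)+
  define A where "A x = H x - (1 / \<alpha>p) *\<^sub>R M x" for x
  define B where "B x = G x - (1 / \<alpha>p) *\<^sub>R blinfun_apply (C x) (e + G x)" for x
  define D where "D x = H x - G x" for x
  have gD: "gradient_type D" unfolding D_def by (rule gradient_type_diff[OF H G])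
  then have sD: "sq_integrable L D" by (simp only: gradient_type_def)
  have sA: "sq_integrable L A" and sB: "sq_integrable L B"
    unfolding A_def B_def by (intro sq_integrable_diff sq_integrable_scaleR sG sH M CG)+
  have "l2 L (\<lambda>x. proj A x - G x) = l2 L (\<lambda>x. proj A x - proj B x)"
    using fixp by (intro l2_cong_AE_eq sq_integrable_diff sq_integrable_proj sA sB sG)
      (auto simp: B_def[abs_def] elim: eventually_mono)
  also have "\<dots> \<le> l2 L (\<lambda>x. A x - B x)" by (rule l2_proj_diff_le[OF sA sB])
  also have "(\<lambda>x. A x - B x) = (\<lambda>x. (D x - (1 / \<alpha>p) *\<^sub>R blinfun_apply (C x) (D x))
      + (- 1 / \<alpha>p) *\<^sub>R (M x - blinfun_apply (C x) (e + H x)))"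
    by (simp add: fun_eq_iff A_def B_def D_def blinfun.add_right blinfun.diff_right algebra_simps)
  also have "l2 L \<dots> \<le> l2 L (\<lambda>x. D x - (1 / \<alpha>p) *\<^sub>R blinfun_apply (C x) (D x))
      + l2 L (\<lambda>x. (- 1 / \<alpha>p) *\<^sub>R (M x - blinfun_apply (C x) (e + H x)))"
    by (intro l2_triangle sq_integrable_diff sq_integrable_scaleR sq_integrable_stiffness[OF C \<alpha>] sD M CH)
  also have "\<dots> \<le> sqrt (1 - \<alpha>m / (2 * \<alpha>p)) * l2 L D
      + 1 / \<alpha>p * l2 L (\<lambda>x. M x - blinfun_apply (C x) (e + H x))"
    unfolding l2_scaleR using \<alpha> by (intro add_mono l2_contraction[OF C \<alpha> gD]) auto
  finally show ?thesis unfolding A_def D_def by simp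
qed

lemma contraction_factor:
  assumes "0 < \<alpha>m" "\<alpha>m < (\<alpha>p::real)"
  shows "0 \<le> sqrt (1 - \<alpha>m / (2 * \<alpha>p))" "sqrt (1 - \<alpha>m / (2 * \<alpha>p)) < 1"
proof -
  have "0 < \<alpha>m / (2 * \<alpha>p)" "\<alpha>m / (2 * \<alpha>p) < 1" using assms by (auto simp: field_simps)
  then show "0 \<le> sqrt (1 - \<alpha>m / (2 * \<alpha>p))" "sqrt (1 - \<alpha>m / (2 * \<alpha>p)) < 1" by auto
qed

lemma mat_fourier_inject:
  fixes A B :: "real^'d \<Rightarrow> real^'n^'m"
  assumes A: "sq_integrable L A" and B: "sq_integrable L B"
    and eq: "\<And>i l \<xi>. fourier_coeff L (\<lambda>x. A x $ i $ l) \<xi> = fourier_coeff L (\<lambda>x. B x $ i $ l) \<xi>"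
  shows "AE x in cellM L. A x = B x"
proof -
  have "AE x in cellM L. A x $ i $ l = B x $ i $ l" for i l
    by (intro fourier_coeff_inject sq_integrable_nth2 A B eq)
  then have "AE x in cellM L. \<forall>i l. A x $ i $ l = B x $ i $ l"
    by (simp add: AE_all_countable)
  then show ?thesis by eventually_elim (simp add: vec_eq_iff)
qed

lemma proj_gradient_type:
  assumes D: "gradient_type D"
  shows "AE x in cellM L. proj D x = D x"
proof -
  have sD: "sq_integrable L D" using D by (simp only: gradient_type_def)
  show ?thesis
  proof (rule mat_fourier_inject[OF sq_integrable_proj[OF sD] sD])
    show "fourier_coeff L (\<lambda>x. proj D x $ i $ l) \<xi> = fourier_coeff L (\<lambda>x. D x $ i $ l) \<xi>" for i l \<xi>
      using D unfolding gradient_type_def fourier_coeff_proj[OF sD] by metis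
  qed
qed

lemma gradient_type_cong_AE:
  assumes A: "gradient_type A" and B: "sq_integrable L B" and eq: "AE x in cellM L. A x = B x"
  shows "gradient_type B"
proof -
  have sA: "sq_integrable L A" using A by (simp only: gradient_type_def)
  have coeff: "fourier_coeff L (\<lambda>x. A x $ i $ l) \<xi> = fourier_coeff L (\<lambda>x. B x $ i $ l) \<xi>" for i l \<xi>
    using eq by (intro fourier_coeff_cong_AE sq_integrable_nth2 sA B) (auto elim: eventually_mono)
  show ?thesis using A B unfolding gradient_type_def coeff by blast
qed

text \<open>Banach's fixed point argument carried out on representatives modulo null sets:
  \<open>l2_complete\<close> supplies the limit of the geometrically convergent iterates.\<close>

lemma fixed_point_exists:
  assumes C: "C \<in> stiffness_fields L \<alpha>m \<alpha>p" and \<alpha>: "0 < \<alpha>m" "\<alpha>m < \<alpha>p"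
  obtains G where "gradient_type G"
    "AE x in cellM L. proj (\<lambda>x. G x - (1 / \<alpha>p) *\<^sub>R blinfun_apply (C x) (e + G x)) x = G x"
proof -
  define q where "q = sqrt (1 - \<alpha>m / (2 * \<alpha>p))"
  have q: "0 \<le> q" "q < 1" unfolding q_def by (rule contraction_factor[OF \<alpha>])+
  define F where "F H x = H x - (1 / \<alpha>p) *\<^sub>R blinfun_apply (C x) (e + H x)" for H :: "real^'d \<Rightarrow> real^'d^'d" and x
  have sF: "sq_integrable L (F H)" if "sq_integrable L H" for H
    unfolding F_def
    by (intro sq_integrable_diff sq_integrable_scaleR sq_integrable_stiffness[OF C \<alpha>] sq_integrable_add sq_integrable_const that)
  have lip: "l2 L (\<lambda>x. proj (F H) x - proj (F K) x) \<le> q * l2 L (\<lambda>x. H x - K x)"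
    if H: "gradient_type H" and K: "gradient_type K" for H K
  proof -
    have s: "sq_integrable L H" "sq_integrable L K" using H K by (simp_all only: gradient_type_def)
    have "l2 L (\<lambda>x. proj (F H) x - proj (F K) x) \<le> l2 L (\<lambda>x. F H x - F K x)"
      by (intro l2_proj_diff_le sF s)
    also have "(\<lambda>x. F H x - F K x) = (\<lambda>x. (H x - K x) - (1 / \<alpha>p) *\<^sub>R blinfun_apply (C x) (H x - K x))"
      by (simp add: fun_eq_iff F_def blinfun.add_right blinfun.diff_right algebra_simps)
    also have "l2 L \<dots> \<le> q * l2 L (\<lambda>x. H x - K x)"
      unfolding q_def by (rule l2_contraction[OF C \<alpha> gradient_type_diff[OF H K]])
    finally show ?thesis .
  qed
  define g where "g = rec_nat (\<lambda>_. 0) (\<lambda>_ H. proj (F H))"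
  have g_Suc: "g (Suc n) = proj (F (g n))" for n by (simp add: g_def)
  have g: "gradient_type (g n)" for n
  proof (induction n)
    case 0
    then show ?case by (simp add: g_def gradient_type_0)
  next
    case (Suc n)
    then have "sq_integrable L (g n)" by (simp only: gradient_type_def)
    then show ?case unfolding g_Suc by (intro gradient_type_proj sF)
  qed
  have sg: "sq_integrable L (g n)" for n using g[of n] by (simp only: gradient_type_def)
  define c where "c = l2 L (\<lambda>x. g (Suc 0) x - g 0 x)"
  have step: "l2 L (\<lambda>x. g (Suc n) x - g n x) \<le> c * q ^ n" for n
  proof (induction n)
    case (Suc n)
    have "l2 L (\<lambda>x. g (Suc (Suc n)) x - g (Suc n) x) = l2 L (\<lambda>x. proj (F (g (Suc n))) x - proj (F (g n)) x)"
      by (simp only: g_Suc)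
    also have "\<dots> \<le> q * l2 L (\<lambda>x. g (Suc n) x - g n x)" by (rule lip[OF g g])
    also have "\<dots> \<le> q * (c * q ^ n)" using Suc q by (intro mult_left_mono)
    finally show ?case by (simp add: mult_ac)
  qed (simp add: c_def)
  obtain G where sG: "sq_integrable L G" and lim: "\<And>n. l2 L (\<lambda>x. g n x - G x) \<le> c / (1 - q) * q ^ n"
    using l2_complete[OF sg q step] by blast
  have "(\<lambda>n. c / (1 - q) * q ^ n) \<longlonglongrightarrow> 0"
    using q by (intro tendsto_mult_right_zero LIMSEQ_power_zero) simp
  then have lim0: "(\<lambda>n. l2 L (\<lambda>x. g n x - G x)) \<longlonglongrightarrow> 0"
    by (rule Lim_null_comparison[rotated]) (use lim in simp)
  \<comment> \<open>A criterion used twice, for \<open>proj G\<close> and for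
    \<open>proj (F G)\<close>: a field whose distance to \<open>G\<close> is controlled by the
    distances of two consecutive iterates to \<open>G\<close> equals \<open>G\<close> almost
    everywhere.\<close>
  have small: "AE x in cellM L. A x = G x"
    if A: "sq_integrable L A" and le: "\<And>n. l2 L (\<lambda>x. A x - G x) \<le> k * (l2 L (\<lambda>x. g n x - G x) + l2 L (\<lambda>x. g (Suc n) x - G x))" for A k
  proof -
    have "(\<lambda>n. k * (l2 L (\<lambda>x. g n x - G x) + l2 L (\<lambda>x. g (Suc n) x - G x))) \<longlonglongrightarrow> k * (0 + 0)"
      by (intro tendsto_intros lim0 LIMSEQ_Suc[OF lim0])
    then have "l2 L (\<lambda>x. A x - G x) \<le> k * (0 + 0)"
      by (rule LIMSEQ_le_const) (use le in blast)
    then have "l2 L (\<lambda>x. A x - G x) = 0" using l2_nonneg[of L "\<lambda>x. A x - G x"] by simp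
    then show ?thesis using l2_eq_0_iff[OF sq_integrable_diff[OF A sG]] by simp
  qed
  have "AE x in cellM L. proj G x = G x"
  proof (rule small[OF sq_integrable_proj[OF sG], of 2])
    fix n
    have "l2 L (\<lambda>x. proj G x - g (Suc n) x) = l2 L (\<lambda>x. proj G x - proj (g (Suc n)) x)"
      using proj_gradient_type[OF g[of "Suc n"]]
      by (intro l2_cong_AE_eq sq_integrable_diff sq_integrable_proj sG sg) (auto elim: eventually_mono)
    also have "\<dots> \<le> l2 L (\<lambda>x. G x - g (Suc n) x)"
      by (intro l2_proj_diff_le sG sg)
    also have "\<dots> = l2 L (\<lambda>x. g (Suc n) x - G x)" by (rule l2_minus_commute)
    finally have "l2 L (\<lambda>x. proj G x - G x) \<le> l2 L (\<lambda>x. g (Suc n) x - G x) + l2 L (\<lambda>x. g (Suc n) x - G x)"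
      using l2_triangle_diff[OF sq_integrable_proj[OF sG] sg[of "Suc n"] sG] by linarith
    then show "l2 L (\<lambda>x. proj G x - G x) \<le> 2 * (l2 L (\<lambda>x. g n x - G x) + l2 L (\<lambda>x. g (Suc n) x - G x))"
      using l2_nonneg[of L "\<lambda>x. g n x - G x"] unfolding distrib_left mult_2 by linarith
  qed
  from gradient_type_cong_AE[OF gradient_type_proj[OF sG] sG this]
  have G: "gradient_type G" .
  have "AE x in cellM L. proj (F G) x = G x"
  proof (rule small[OF sq_integrable_proj[OF sF[OF sG]], of 1])
    fix n
    have "l2 L (\<lambda>x. proj (F G) x - g (Suc n) x) \<le> q * l2 L (\<lambda>x. G x - g n x)"
      unfolding g_Suc by (rule lip[OF G g])
    also have "\<dots> \<le> 1 * l2 L (\<lambda>x. G x - g n x)"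
      using q by (intro mult_right_mono) auto
    also have "l2 L (\<lambda>x. G x - g n x) = l2 L (\<lambda>x. g n x - G x)" by (rule l2_minus_commute)
    finally show "l2 L (\<lambda>x. proj (F G) x - G x) \<le> 1 * (l2 L (\<lambda>x. g n x - G x) + l2 L (\<lambda>x. g (Suc n) x - G x))"
      using l2_triangle_diff[OF sq_integrable_proj[OF sF[OF sG]] sg[of "Suc n"] sG] unfolding mult_1 by linarith
  qed
  then show ?thesis using that[OF G] unfolding F_def by blast
qed

section \<open>The corrector as the potential of the fixed point, and its uniqueness\<close>

lemma multiplier_potential: "multiplier (\<lambda>\<xi>. potential \<xi> j)"
  unfolding multiplier_def
proof (intro conjI allI exI)
  fix \<xi>
  show "potential (- \<xi>) j = cnj (potential \<xi> j)" by (rule potential_uminus)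
  let ?w = "freq L \<xi>"
  have "(cmod (potential \<xi> j))\<^sup>2 = (?w $ j / (?w \<bullet> ?w))\<^sup>2"
    unfolding potential_def norm_mult norm_of_real by (simp add: power_divide)
  also have "\<dots> \<le> (\<Sum>j\<in>UNIV. (?w $ j / (?w \<bullet> ?w))\<^sup>2)" by (intro member_le_sum) auto
  also have "\<dots> \<le> poincare" unfolding sum_potential_sq by (rule inverse_freq_le_poincare)
  finally show "cmod (potential \<xi> j) \<le> sqrt poincare" by (rule real_le_rsqrt)
qed

definition potential_field :: "(real^'d \<Rightarrow> real^'d^'m) \<Rightarrow> real^'d \<Rightarrow> real^'m" where
  "potential_field D x = (\<chi> i. \<Sum>j\<in>UNIV. mult (\<lambda>\<xi>. potential \<xi> j) (\<lambda>x. D x $ i $ j) x)"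

lemma
  assumes D: "sq_integrable L D"
  shows sq_integrable_potential_field: "sq_integrable L (potential_field D)"
    and fourier_coeff_potential_field: "fourier_coeff L (\<lambda>x. potential_field D x $ i) \<xi> =
      (\<Sum>j\<in>UNIV. potential \<xi> j * fourier_coeff L (\<lambda>x. D x $ i $ j) \<xi>)"
proof -
  have m: "sq_integrable L (mult (\<lambda>\<xi>. potential \<xi> j) (\<lambda>x. D x $ i $ j))" for i j
    by (intro sq_integrable_mult multiplier_potential sq_integrable_nth2 D)
  show "sq_integrable L (potential_field D)"
    unfolding sq_integrable_componentwise by (simp add: potential_field_def sq_integrable_sum m)
  show "fourier_coeff L (\<lambda>x. potential_field D x $ i) \<xi> =
      (\<Sum>j\<in>UNIV. potential \<xi> j * fourier_coeff L (\<lambda>x. D x $ i $ j) \<xi>)"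
    by (simp add: potential_field_def fourier_coeff_sum m fourier_coeff_mult multiplier_potential sq_integrable_nth2 D)
qed

lemma grad_potential_field:
  assumes D: "gradient_type D"
  shows "potential_field D \<in> H1_per0 L" "AE x in cellM L. grad L (potential_field D) x = D x"
proof -
  have sD: "sq_integrable L D" using D by (simp only: gradient_type_def)
  note H1 = potential_H1[OF sq_integrable_potential_field[OF sD] sD fourier_coeff_potential_field[OF sD]]
  show "potential_field D \<in> H1_per0 L" by (rule H1(1))
  then have u: "potential_field D \<in> H1_per L" by (simp add: H1_per0_def)
  show "AE x in cellM L. grad L (potential_field D) x = D x"
  proof (rule mat_fourier_inject[OF sq_integrable_grad[OF u] sD])
    fix i l \<xi>
    have "fourier_coeff L (\<lambda>x. D x $ i $ l) \<xi> = (\<Sum>j\<in>UNIV. grad_proj j l \<xi> * fourier_coeff L (\<lambda>x. D x $ i $ j) \<xi>)"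
      using D unfolding gradient_type_def by blast
    then show "fourier_coeff L (\<lambda>x. grad L (potential_field D) x $ i $ l) \<xi> = fourier_coeff L (\<lambda>x. D x $ i $ l) \<xi>"
      by (simp only: fourier_coeff_grad[OF u] fourier_coeff_potential_field[OF sD] sum_grad_proj)
  qed
qed

lemma H1_per0_diff:
  fixes u v :: "real^'d \<Rightarrow> real^'m"
  assumes u: "u \<in> H1_per0 L" and v: "v \<in> H1_per0 L"
  shows "(\<lambda>x. u x - v x) \<in> H1_per0 L"
    "AE x in cellM L. grad L (\<lambda>x. u x - v x) x = grad L u x - grad L v x"
proof -
  have uv: "u \<in> H1_per L" "v \<in> H1_per L" using u v by (auto simp: H1_per0_def)
  have s: "sq_integrable L u" "sq_integrable L v" using uv by (auto simp: sq_integrable_H1)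
  have si: "sq_integrable L (\<lambda>x. u x $ i)" "sq_integrable L (\<lambda>x. v x $ i)" for i
    using s sq_integrable_componentwise by blast+
  have g: "sq_integrable L (grad L u)" "sq_integrable L (grad L v)" using uv by (auto simp: sq_integrable_grad)
  have sd: "sq_integrable L (\<lambda>x. u x - v x)" "sq_integrable L (\<lambda>x. grad L u x - grad L v x)"
    by (intro sq_integrable_diff s g)+
  have "weak_grad L (\<lambda>x. u x - v x) (\<lambda>x. grad L u x - grad L v x)"
    unfolding weak_grad_iff_fourier[OF sd]
    using g uv by (simp add: fourier_coeff_diff si sq_integrable_nth2 fourier_coeff_grad right_diff_distrib)
  then have d: "(\<lambda>x. u x - v x) \<in> H1_per L" using sd by (auto simp: H1_per_def)
  then show "(\<lambda>x. u x - v x) \<in> H1_per0 L"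
    using u v by (simp add: H1_per0_def sq_integrable_integrable s)
  show "AE x in cellM L. grad L (\<lambda>x. u x - v x) x = grad L u x - grad L v x"
  proof (rule mat_fourier_inject[OF sq_integrable_grad[OF d] sd(2)])
    fix i l \<xi>
    show "fourier_coeff L (\<lambda>x. grad L (\<lambda>x. u x - v x) x $ i $ l) \<xi> = fourier_coeff L (\<lambda>x. (grad L u x - grad L v x) $ i $ l) \<xi>"
      using g uv by (simp add: fourier_coeff_grad[OF d] fourier_coeff_diff si sq_integrable_nth2 fourier_coeff_grad right_diff_distrib)
  qed
qed

lemma freq_eq_0_iff: "freq L \<xi> = 0 \<longleftrightarrow> \<xi> = 0"
  using L_pos by (auto simp: freq_def vec_eq_iff less_imp_neq[symmetric])

text \<open>At each frequency and in each row, the cross term is i times a coefficient of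
  \<open>v\<close> times the conjugate of the divergence sum of \<open>T\<close>, which is
  0.\<close>

lemma grad_orthogonal_divergence_free:
  fixes v :: "real^'d \<Rightarrow> real^'m"
  assumes v: "v \<in> H1_per L" and T: "sq_integrable L T"
    and div: "\<And>i \<xi>. (\<Sum>j\<in>UNIV. of_real (freq L \<xi> $ j) * fourier_coeff L (\<lambda>x. T x $ i $ j) \<xi>) = 0"
  shows "(\<integral>x. grad L v x \<bullet> T x \<partial>cellM L) = 0"
proof -
  have g: "sq_integrable L (grad L v)" by (rule sq_integrable_grad[OF v])
  have "(\<Sum>p\<in>UNIV \<times> UNIV. \<integral>x. grad L v x $ fst p $ snd p * T x $ fst p $ snd p \<partial>cellM L) = 0"
  proof (rule sum_inner_eq_0_of_fourier)
    fix \<xi>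
    have "(\<Sum>j\<in>UNIV. fourier_coeff L (\<lambda>x. grad L v x $ i $ j) \<xi> * cnj (fourier_coeff L (\<lambda>x. T x $ i $ j) \<xi>)) =
        \<i> * fourier_coeff L (\<lambda>x. v x $ i) \<xi> * cnj (\<Sum>j\<in>UNIV. of_real (freq L \<xi> $ j) * fourier_coeff L (\<lambda>x. T x $ i $ j) \<xi>)" for i
      unfolding cnj_sum sum_distrib_left fourier_coeff_grad[OF v] by (intro sum.cong refl) simp
    then have "(\<Sum>j\<in>UNIV. fourier_coeff L (\<lambda>x. grad L v x $ i $ j) \<xi> * cnj (fourier_coeff L (\<lambda>x. T x $ i $ j) \<xi>)) = 0" for i
      by (simp only: div) simp
    then have "Re (\<Sum>i\<in>UNIV. \<Sum>j\<in>UNIV. fourier_coeff L (\<lambda>x. grad L v x $ i $ j) \<xi> * cnj (fourier_coeff L (\<lambda>x. T x $ i $ j) \<xi>)) = 0"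
      by (simp only: sum.neutral_const) simp
    then show "(\<Sum>p\<in>UNIV \<times> UNIV. Re (fourier_coeff L (\<lambda>x. grad L v x $ fst p $ snd p) \<xi> *
        cnj (fourier_coeff L (\<lambda>x. T x $ fst p $ snd p) \<xi>))) = 0"
      unfolding Re_sum by (simp only: sum.cartesian_product split_def)
  qed (auto intro: sq_integrable_nth2 g T)
  moreover have "(\<integral>x. grad L v x \<bullet> T x \<partial>cellM L) =
      (\<Sum>i\<in>UNIV. \<Sum>j\<in>UNIV. \<integral>x. grad L v x $ i $ j * T x $ i $ j \<partial>cellM L)"
    unfolding inner_matrix
    by (simp add: sq_integrable_mult_integrable sq_integrable_nth2 g T)
  ultimately show ?thesis by (simp add: sum.cartesian_product case_prod_beta)
qed

text \<open>Since \<open>G\<close> is fixed by the projection, the fixed point equation leaves the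
  projected stress equal to 0. The frequency vector is fixed by the projection matrix, so
  contracting it with the stress is the same as contracting it with the projected stress.\<close>

lemma stress_divergence_free:
  assumes C: "C \<in> stiffness_fields L \<alpha>m \<alpha>p" and \<alpha>: "0 < \<alpha>m" "\<alpha>m < \<alpha>p" and G: "gradient_type G"
    and fixp: "AE x in cellM L. proj (\<lambda>x. G x - (1 / \<alpha>p) *\<^sub>R blinfun_apply (C x) (e + G x)) x = G x"
  shows "(\<Sum>j\<in>UNIV. of_real (freq L \<xi> $ j) * fourier_coeff L (\<lambda>x. blinfun_apply (C x) (e + G x) $ i $ j) \<xi>) = 0"
proof -
  define T where "T x = blinfun_apply (C x) (e + G x)" for x
  have sG: "sq_integrable L G" using G by (simp only: gradient_type_def)
  have sT: "sq_integrable L T" unfolding T_def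
    by (intro sq_integrable_stiffness[OF C \<alpha>] sq_integrable_add sq_integrable_const sG)
  define A where "A x = G x - (1 / \<alpha>p) *\<^sub>R T x" for x
  have sA: "sq_integrable L A" unfolding A_def by (intro sq_integrable_diff sq_integrable_scaleR sG sT)
  let ?g = "\<lambda>j. fourier_coeff L (\<lambda>x. G x $ i $ j) \<xi>" and ?t = "\<lambda>j. fourier_coeff L (\<lambda>x. T x $ i $ j) \<xi>"
  have A: "fourier_coeff L (\<lambda>x. A x $ i $ j) \<xi> = ?g j - of_real (1 / \<alpha>p) * ?t j" for j
  proof -
    have "(\<lambda>x. A x $ i $ j) = (\<lambda>x. G x $ i $ j - 1 / \<alpha>p * T x $ i $ j)" by (simp add: A_def fun_eq_iff)
    then show ?thesis
      by (simp only: fourier_coeff_cmult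
          fourier_coeff_diff[OF sq_integrable_nth2[OF sG] sq_integrable_mult_left[OF sq_integrable_nth2[OF sT]]])
  qed
  have proj0: "(\<Sum>j\<in>UNIV. grad_proj j l \<xi> * ?t j) = 0" for l
  proof -
    have "fourier_coeff L (\<lambda>x. proj A x $ i $ l) \<xi> = ?g l"
      using fixp by (intro fourier_coeff_cong_AE sq_integrable_nth2 sq_integrable_proj sA sG)
        (auto simp: A_def[abs_def] T_def elim: eventually_mono)
    moreover have "?g l = (\<Sum>j\<in>UNIV. grad_proj j l \<xi> * ?g j)"
      using G unfolding gradient_type_def by blast
    ultimately have "(\<Sum>j\<in>UNIV. grad_proj j l \<xi> * (?g j - of_real (1 / \<alpha>p) * ?t j)) = (\<Sum>j\<in>UNIV. grad_proj j l \<xi> * ?g j)"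
      by (simp only: fourier_coeff_proj[OF sA] A)
    then have "of_real (1 / \<alpha>p) * (\<Sum>j\<in>UNIV. grad_proj j l \<xi> * ?t j) = 0"
      by (simp add: right_diff_distrib sum_subtractf sum_distrib_left mult_ac)
    then show ?thesis using \<alpha> by simp
  qed
  have "(\<Sum>j\<in>UNIV. of_real (freq L \<xi> $ j) * ?t j) =
      (\<Sum>j\<in>UNIV. \<Sum>l\<in>UNIV. of_real (freq L \<xi> $ l) * grad_proj j l \<xi> * ?t j)"
    by (simp only: sum_freq_grad_proj sum_distrib_right[symmetric])
  also have "\<dots> = (\<Sum>l\<in>UNIV. of_real (freq L \<xi> $ l) * (\<Sum>j\<in>UNIV. grad_proj j l \<xi> * ?t j))"
    by (subst sum.swap) (simp only: sum_distrib_left mult.assoc)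
  also have "\<dots> = 0" by (simp add: proj0)
  finally show ?thesis unfolding T_def .
qed

lemma sym_grad_eq: "sym_grad L u x = sym_part (grad L u x)"
  by (simp add: sym_grad_def sym_part_def)

lemma sq_integrable_sym_grad:
  "u \<in> H1_per L \<Longrightarrow> sq_integrable L (sym_grad L u)"
  unfolding sym_grad_eq[abs_def] by (intro sq_integrable_sym_part sq_integrable_grad)

lemma H1_per0_zero_grad:
  assumes v: "v \<in> H1_per0 L" and 0: "AE x in cellM L. grad L v x = 0"
  shows "AE x in cellM L. v x = 0"
proof -
  have v1: "v \<in> H1_per L" and m: "(\<integral>x. v x \<partial>cellM L) = 0" using v by (auto simp: H1_per0_def)
  have sv: "sq_integrable L v" by (rule sq_integrable_H1[OF v1])
  have "fourier_coeff L (\<lambda>x. v x $ i) \<xi> = 0" for i \<xi>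
  proof (cases "\<xi> = 0")
    case True
    then show ?thesis using m integral_eq_0_iff_fourier[OF sv] by simp
  next
    case False
    then have "freq L \<xi> \<noteq> 0" by (simp only: freq_eq_0_iff not_False_eq_True)
    then obtain j where j: "freq L \<xi> $ j \<noteq> 0" by (auto simp: vec_eq_iff)
    have "fourier_coeff L (\<lambda>x. grad L v x $ i $ j) \<xi> = fourier_coeff L (\<lambda>x. 0) \<xi>"
      using 0 by (intro fourier_coeff_cong_AE sq_integrable_nth2 sq_integrable_grad[OF v1]) (auto elim: eventually_mono)
    then show ?thesis using j by (simp add: fourier_coeff_grad[OF v1])
  qed
  moreover have "sq_integrable L (\<lambda>x. v x $ i)" for i
    using sv sq_integrable_componentwise by blast
  ultimately have "AE x in cellM L. v x $ i = 0" for i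
    by (intro fourier_coeff_inject) simp_all
  then have "AE x in cellM L. \<forall>i. v x $ i = 0" by (simp add: AE_all_countable)
  then show ?thesis by eventually_elim (simp add: vec_eq_iff)
qed

text \<open>Symmetry of the stress lets the full gradient of the test field replace its symmetric
  part, and the tensor ignores the skew part of \<open>G\<close>. What remains is the orthogonality
  of gradients to divergence-free fields.\<close>

lemma corrector_solution_potential_field:
  assumes C: "C \<in> stiffness_fields L \<alpha>m \<alpha>p" and \<alpha>: "0 < \<alpha>m" "\<alpha>m < \<alpha>p" and G: "gradient_type G"
    and fixp: "AE x in cellM L. proj (\<lambda>x. G x - (1 / \<alpha>p) *\<^sub>R blinfun_apply (C x) (e + G x)) x = G x"
  shows "corrector_solution L e C (potential_field G)"
  unfolding corrector_solution_def
proof (intro conjI ballI)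
  let ?u = "potential_field G"
  show u0: "?u \<in> H1_per0 L" by (rule grad_potential_field[OF G])
  then have u: "?u \<in> H1_per L" by (simp add: H1_per0_def)
  have sG: "sq_integrable L G" using G by (simp only: gradient_type_def)
  fix v :: "real^'d \<Rightarrow> real^'d" assume "v \<in> H1_per0 L"
  then have v: "v \<in> H1_per L" by (simp add: H1_per0_def)
  have sT: "sq_integrable L (\<lambda>x. blinfun_apply (C x) (e + G x))"
    by (intro sq_integrable_stiffness[OF C \<alpha>] sq_integrable_add sq_integrable_const sG)
  have sT': "sq_integrable L (\<lambda>x. blinfun_apply (C x) (e + sym_grad L ?u x))"
    by (intro sq_integrable_stiffness[OF C \<alpha>] sq_integrable_add sq_integrable_const sq_integrable_sym_grad u)
  have "(\<integral>x. sym_grad L v x \<bullet> blinfun_apply (C x) (e + sym_grad L ?u x) \<partial>cellM L) =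
      (\<integral>x. grad L v x \<bullet> blinfun_apply (C x) (e + G x) \<partial>cellM L)"
  proof (rule integral_cong_AE)
    show "(\<lambda>x. sym_grad L v x \<bullet> blinfun_apply (C x) (e + sym_grad L ?u x)) \<in> borel_measurable (cellM L)"
      by (intro borel_measurable_integrable sq_integrable_inner_integrable sq_integrable_sym_grad v sT')
    show "(\<lambda>x. grad L v x \<bullet> blinfun_apply (C x) (e + G x)) \<in> borel_measurable (cellM L)"
      by (intro borel_measurable_integrable sq_integrable_inner_integrable sq_integrable_grad v sT)
    show "AE x in cellM L. sym_grad L v x \<bullet> blinfun_apply (C x) (e + sym_grad L ?u x) =
        grad L v x \<bullet> blinfun_apply (C x) (e + G x)"
      using grad_potential_field(2)[OF G] stiffness_admissible[OF C]
    proof eventually_elim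
      fix x assume eq: "grad L ?u x = G x" and "admissible \<alpha>m \<alpha>p (C x)"
      then have sy: "C x \<in> sym_sym" by (simp add: admissible_def)
      have "blinfun_apply (C x) (e + sym_grad L ?u x) = blinfun_apply (C x) (e + G x)"
        by (simp add: sym_grad_eq eq blinfun.add_right sym_sym_apply_sym_part[OF sy])
      then show "sym_grad L v x \<bullet> blinfun_apply (C x) (e + sym_grad L ?u x) =
          grad L v x \<bullet> blinfun_apply (C x) (e + G x)"
        by (simp only: sym_grad_eq[of v] inner_sym_part[OF sym_sym_apply_in[OF sy]])
    qed
  qed
  also have "\<dots> = 0"
    by (intro grad_orthogonal_divergence_free v sT stress_divergence_free[OF C \<alpha> G fixp])
  finally show "(\<integral>x. sym_grad L v x \<bullet> blinfun_apply (C x) (e + sym_grad L ?u x) \<partial>cellM L) = 0" .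
qed

text \<open>Both equations are tested with the difference \<open>v\<close>. Coercivity makes its
  symmetric gradient vanish, Korn's inequality its gradient, and the mean condition \<open>v\<close>
  itself.\<close>

lemma corrector_solution_unique:
  assumes C: "C \<in> stiffness_fields L \<alpha>m \<alpha>p" and \<alpha>: "0 < \<alpha>m" "\<alpha>m < \<alpha>p"
    and u: "corrector_solution L e C u" and w: "corrector_solution L e C w"
  shows "AE x in cellM L. w x = u x"
proof -
  have u0: "u \<in> H1_per0 L" and w0: "w \<in> H1_per0 L" using u w by (auto simp: corrector_solution_def)
  define v where "v x = w x - u x" for x
  have v0: "v \<in> H1_per0 L" and gv: "AE x in cellM L. grad L v x = grad L w x - grad L u x"
    using H1_per0_diff[OF w0 u0] unfolding v_def[abs_def] by auto
  have h: "u \<in> H1_per L" "w \<in> H1_per L" "v \<in> H1_per L" using u0 w0 v0 by (auto simp: H1_per0_def)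
  have sS: "sq_integrable L (sym_grad L v)" by (rule sq_integrable_sym_grad[OF h(3)])
  have s: "sq_integrable L (\<lambda>x. blinfun_apply (C x) (e + sym_grad L w x))"
      "sq_integrable L (\<lambda>x. blinfun_apply (C x) (e + sym_grad L u x))"
    by (intro sq_integrable_stiffness[OF C \<alpha>] sq_integrable_add sq_integrable_const sq_integrable_sym_grad h)+
  have "\<alpha>m * (l2 L (sym_grad L v))\<^sup>2 = (\<integral>x. \<alpha>m * (norm (sym_grad L v x))\<^sup>2 \<partial>cellM L)"
    by (simp add: l2_power2)
  also have "\<dots> \<le> (\<integral>x. sym_grad L v x \<bullet> blinfun_apply (C x) (e + sym_grad L w x)
      - sym_grad L v x \<bullet> blinfun_apply (C x) (e + sym_grad L u x) \<partial>cellM L)"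
  proof (rule integral_mono_AE)
    show "integrable (cellM L) (\<lambda>x. \<alpha>m * (norm (sym_grad L v x))\<^sup>2)"
      using sS by (simp add: sq_integrable_def)
    show "integrable (cellM L) (\<lambda>x. sym_grad L v x \<bullet> blinfun_apply (C x) (e + sym_grad L w x)
      - sym_grad L v x \<bullet> blinfun_apply (C x) (e + sym_grad L u x))"
      by (intro Bochner_Integration.integrable_diff sq_integrable_inner_integrable sS s)
    show "AE x in cellM L. \<alpha>m * (norm (sym_grad L v x))\<^sup>2 \<le> sym_grad L v x \<bullet> blinfun_apply (C x) (e + sym_grad L w x)
      - sym_grad L v x \<bullet> blinfun_apply (C x) (e + sym_grad L u x)"
      using gv stiffness_admissible[OF C]
    proof eventually_elim
      fix x assume eq: "grad L v x = grad L w x - grad L u x" and adm: "admissible \<alpha>m \<alpha>p (C x)"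
      have "sym_grad L v x \<bullet> blinfun_apply (C x) (e + sym_grad L w x)
          - sym_grad L v x \<bullet> blinfun_apply (C x) (e + sym_grad L u x) =
          sym_grad L v x \<bullet> blinfun_apply (C x) (sym_grad L v x)"
        by (simp add: sym_grad_eq eq sym_part_diff blinfun.add_right blinfun.diff_right inner_add_right inner_diff_right)
      then show "\<alpha>m * (norm (sym_grad L v x))\<^sup>2 \<le> sym_grad L v x \<bullet> blinfun_apply (C x) (e + sym_grad L w x)
          - sym_grad L v x \<bullet> blinfun_apply (C x) (e + sym_grad L u x)"
        using admissible_coercive[OF adm, of "sym_grad L v x"]
        by (simp add: sym_part_of_sym sym_grad_eq)
    qed
  qed
  also have "\<dots> = (\<integral>x. sym_grad L v x \<bullet> blinfun_apply (C x) (e + sym_grad L w x) \<partial>cellM L)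
      - (\<integral>x. sym_grad L v x \<bullet> blinfun_apply (C x) (e + sym_grad L u x) \<partial>cellM L)"
    by (intro Bochner_Integration.integral_diff sq_integrable_inner_integrable sS s)
  also have "\<dots> = 0"
    using u w v0 by (simp add: corrector_solution_def)
  finally have "(l2 L (sym_grad L v))\<^sup>2 \<le> 0" using \<alpha> by (simp add: mult_le_0_iff)
  moreover have "(l2 L (grad L v))\<^sup>2 \<le> 2 * (l2 L (sym_grad L v))\<^sup>2"
    unfolding sym_grad_eq[abs_def] by (rule Korn[OF gradient_type_grad[OF h(3)]])
  ultimately have "(l2 L (grad L v))\<^sup>2 \<le> 0" by linarith
  then have "l2 L (grad L v) = 0" by simp
  then have "AE x in cellM L. grad L v x = 0"
    using l2_eq_0_iff[OF sq_integrable_grad[OF h(3)]] by simp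
  then have "AE x in cellM L. v x = 0" by (rule H1_per0_zero_grad[OF v0])
  then show ?thesis by (simp add: v_def)
qed

lemma solution_op_props:
  assumes C: "C \<in> stiffness_fields L \<alpha>m \<alpha>p" and \<alpha>: "0 < \<alpha>m" "\<alpha>m < \<alpha>p" and G: "gradient_type G"
    and fixp: "AE x in cellM L. proj (\<lambda>x. G x - (1 / \<alpha>p) *\<^sub>R blinfun_apply (C x) (e + G x)) x = G x"
  shows unique_solution_op: "unique_corrector_solution L e C (solution_op L e C)"
    and solution_op_potential_field: "AE x in cellM L. solution_op L e C x = potential_field G x"
proof -
  have sol: "corrector_solution L e C (potential_field G)"
    by (rule corrector_solution_potential_field[OF assms])
  then have "unique_corrector_solution L e C (potential_field G)"
    using corrector_solution_unique[OF C \<alpha>] by (simp add: unique_corrector_solution_def)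
  then show u: "unique_corrector_solution L e C (solution_op L e C)"
    unfolding solution_op_def by (rule someI[of "unique_corrector_solution L e C"])
  then show "AE x in cellM L. solution_op L e C x = potential_field G x"
    by (intro corrector_solution_unique[OF C \<alpha> sol]) (simp add: unique_corrector_solution_def)
qed

text \<open>\<open>iteration_step\<close> is applied to the zero field with zero approximate stress.
  The step returns 0, so the errors before and after it are both the norm of \<open>G\<close>, and
  the stress error is the norm of C : e, at most \<open>\<alpha>p\<close> |e| sqrt V; the factor
  \<open>\<alpha>p\<close> cancels. This bounds the initial error of the iteration.\<close>

lemma gradient_a_priori:
  assumes C: "C \<in> stiffness_fields L \<alpha>m \<alpha>p" and \<alpha>: "0 < \<alpha>m" "\<alpha>m < \<alpha>p" and G: "gradient_type G"
    and fixp: "AE x in cellM L. proj (\<lambda>x. G x - (1 / \<alpha>p) *\<^sub>R blinfun_apply (C x) (e + G x)) x = G x"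
  shows "(1 - sqrt (1 - \<alpha>m / (2 * \<alpha>p))) * l2 L G \<le> norm e * sqrt vol"
proof -
  let ?q = "sqrt (1 - \<alpha>m / (2 * \<alpha>p))"
  have sG: "sq_integrable L G" using G by (simp only: gradient_type_def)
  have "AE x in cellM L. proj (\<lambda>_. 0 :: real^'d^'d) x = 0"
    by (rule proj_gradient_type[OF gradient_type_0])
  then have "l2 L (\<lambda>x. proj (\<lambda>_. 0) x - G x) = l2 L (\<lambda>x. - G x)"
    by (intro l2_cong_AE_eq sq_integrable_diff sq_integrable_minus sq_integrable_proj sG sq_integrable_const)
      (auto elim: eventually_mono)
  then have "l2 L G = l2 L (\<lambda>x. proj (\<lambda>x. 0 - (1 / \<alpha>p) *\<^sub>R 0) x - G x)" by simp
  also have "\<dots> \<le> ?q * l2 L (\<lambda>x. 0 - G x) + 1 / \<alpha>p * l2 L (\<lambda>x. 0 - blinfun_apply (C x) (e + 0))"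
    by (rule iteration_step[OF C \<alpha> G gradient_type_0 sq_integrable_const fixp])
  also have "\<dots> = ?q * l2 L G + 1 / \<alpha>p * l2 L (\<lambda>x. blinfun_apply (C x) e)" by simp
  also have "l2 L (\<lambda>x. blinfun_apply (C x) e) \<le> (\<alpha>p * norm e) * sqrt vol"
  proof (rule l2_le_of_AE_bound)
    show "sq_integrable L (\<lambda>x. blinfun_apply (C x) e)"
      by (rule sq_integrable_stiffness[OF C \<alpha> sq_integrable_const])
    show "AE x in cellM L. norm (blinfun_apply (C x) e) \<le> \<alpha>p * norm e"
      using stiffness_admissible[OF C] by eventually_elim (rule admissible_norm_le[OF _ \<alpha>])
  qed
  finally have "l2 L G \<le> ?q * l2 L G + 1 / \<alpha>p * ((\<alpha>p * norm e) * sqrt vol)"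
    using \<alpha> by (simp add: divide_right_mono)
  then show ?thesis using \<alpha> by (simp add: algebra_simps)
qed

lemma H1_error_le:
  fixes w s :: "real^'d \<Rightarrow> real^'d" and G H :: "real^'d \<Rightarrow> real^'d^'d"
  assumes w: "sq_integrable L w" and s: "sq_integrable L s" and H: "sq_integrable L H" and G: "sq_integrable L G"
    and coeff: "\<And>i \<xi>. fourier_coeff L (\<lambda>x. w x $ i) \<xi> = (\<Sum>j\<in>UNIV. potential \<xi> j * fourier_coeff L (\<lambda>x. H x $ i $ j) \<xi>)"
    and sG: "AE x in cellM L. s x = potential_field G x"
  shows "H1_norm L (\<lambda>x. w x - s x) \<le> sqrt (poincare + 1) * l2 L (\<lambda>x. H x - G x)"
proof (rule potential_H1(3)[OF sq_integrable_diff[OF w s] sq_integrable_diff[OF H G]])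
  fix i \<xi>
  have si: "sq_integrable L (\<lambda>x. w x $ i)" "sq_integrable L (\<lambda>x. s x $ i)" "sq_integrable L (\<lambda>x. potential_field G x $ i)"
    using w s sq_integrable_potential_field[OF G] sq_integrable_componentwise by blast+
  have "fourier_coeff L (\<lambda>x. s x $ i) \<xi> = fourier_coeff L (\<lambda>x. potential_field G x $ i) \<xi>"
    using sG by (intro fourier_coeff_cong_AE si) (auto elim: eventually_mono)
  then show "fourier_coeff L (\<lambda>x. (w x - s x) $ i) \<xi> =
      (\<Sum>j\<in>UNIV. potential \<xi> j * fourier_coeff L (\<lambda>x. (H x - G x) $ i $ j) \<xi>)"
    using si H G by (simp add: fourier_coeff_diff coeff fourier_coeff_potential_field sq_integrable_nth2
        right_diff_distrib sum_subtractf)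
qed

end

section \<open>Operators realized by Fourier neural operators\<close>

text \<open>The compilation into networks depends on the activation only through its continuity and
  this growth bound, which keeps activated channels square integrable.\<close>

locale activated_cell = periodic_cell L for L :: "real^'d" +
  fixes \<sigma> :: "real \<Rightarrow> real"
  assumes act_continuous: "continuous_on UNIV \<sigma>" and act_le: "\<And>t. \<bar>\<sigma> t\<bar> \<le> \<bar>t\<bar>"
begin

definition bounded_symbol :: "(int^'d \<Rightarrow> 'i \<Rightarrow> nat \<Rightarrow> complex) \<Rightarrow> bool" where
  "bounded_symbol K \<longleftrightarrow> conj_symmetric K \<and> (\<exists>B. \<forall>\<xi> i j. cmod (K \<xi> i j) \<le> B)"

lemma conv_has_fourier_sum:
  assumes K: "bounded_symbol K" and v: "L2_field L n v"
  shows "has_fourier_sum L (conv_coeff L n K v i) (\<lambda>x. conv L n K v x i)"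
proof -
  obtain B where B: "\<And>\<xi> i j. cmod (K \<xi> i j) \<le> B" and sym: "conj_symmetric K"
    using K by (auto simp: bounded_symbol_def)
  have "has_fourier_sum L (conv_coeff L n K v i) (fourier_sum L (conv_coeff L n K v i))"
  proof (rule has_fourier_sum_fourier_sum)
    show "(\<lambda>\<xi>. (cmod (conv_coeff L n K v i \<xi>))\<^sup>2) summable_on UNIV"
      unfolding conv_coeff_def using v B by (intro combination_summable[where B=B]) (auto simp: L2_field_def)
    show "conv_coeff L n K v i (- \<xi>) = cnj (conv_coeff L n K v i \<xi>)" for \<xi>
      using sym by (simp add: conv_coeff_def conj_symmetric_def fourier_coeff_uminus_freq)
  qed
  then show ?thesis by (simp add: conv_def[abs_def])
qed

lemma bounded_symbol_conv_bounded_L2: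
  assumes K: "bounded_symbol K"
  shows "conv_bounded_L2 L n m K"
proof -
  obtain B where B: "\<And>\<xi> i j. cmod (K \<xi> i j) \<le> B"
    using K by (auto simp: bounded_symbol_def)
  define c where "c = of_nat m * (of_nat n * B\<^sup>2)"
  have "L2_norm_field L m (conv L n K v) \<le> sqrt c * L2_norm_field L n v" if v: "L2_field L n v" for v
  proof -
    note F = conv_has_fourier_sum[OF K v]
    have "(\<Sum>i<m. (l2 L (\<lambda>x. conv L n K v x i))\<^sup>2) \<le> c * (\<Sum>j<n. (l2 L (\<lambda>x. v x j))\<^sup>2)"
    proof (rule sum_l2_le_of_fourier)
      show "sq_integrable L (\<lambda>x. conv L n K v x i)" for i
        using F[of i] by (simp add: has_fourier_sum_def)
      show "sq_integrable L (\<lambda>x. v x j)" if "j \<in> {..<n}" for j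
        using v that by (simp add: L2_field_def)
      fix \<xi>
      have "(cmod (conv_coeff L n K v i \<xi>))\<^sup>2 \<le> (of_nat n * B\<^sup>2) * (\<Sum>j<n. (cmod (fourier_coeff L (\<lambda>x. v x j) \<xi>))\<^sup>2)" for i
        using cmod_combination_le[of "{..<n}" "K \<xi> i" B "\<lambda>j. fourier_coeff L (\<lambda>x. v x j) \<xi>"] B
        by (simp add: conv_coeff_def)
      then have "(\<Sum>i<m. (cmod (conv_coeff L n K v i \<xi>))\<^sup>2) \<le> (\<Sum>i<m. (of_nat n * B\<^sup>2) * (\<Sum>j<n. (cmod (fourier_coeff L (\<lambda>x. v x j) \<xi>))\<^sup>2))"
        by (intro sum_mono)
      then show "(\<Sum>i<m. (cmod (fourier_coeff L (\<lambda>x. conv L n K v x i) \<xi>))\<^sup>2) \<le>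
          c * (\<Sum>j<n. (cmod (fourier_coeff L (\<lambda>x. v x j) \<xi>))\<^sup>2)"
        by (simp add: has_fourier_sum_imp_coeff[OF F] c_def mult.assoc)
    qed
    then have "sqrt (\<Sum>i<m. (l2 L (\<lambda>x. conv L n K v x i))\<^sup>2) \<le> sqrt (c * (\<Sum>j<n. (l2 L (\<lambda>x. v x j))\<^sup>2))"
      by simp
    then show ?thesis
      by (simp add: L2_norm_field_def l2_power2 real_sqrt_mult)
  qed
  then show ?thesis
    unfolding conv_bounded_L2_def using conv_has_fourier_sum[OF K] by blast
qed

lemma sq_integrable_act:
  fixes f :: "real^'d \<Rightarrow> real"
  assumes f: "sq_integrable L f"
  shows "sq_integrable L (\<lambda>x. \<sigma> (f x))"
proof (rule sq_integrable_bound[OF _ f])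
  show "(\<lambda>x. \<sigma> (f x)) \<in> borel_measurable (cellM L)"
    using f by (intro borel_measurable_continuous_on[OF act_continuous]) (simp add: sq_integrable_def)
qed (use act_le in auto)

text \<open>A bounded symbol stands in for the operator bound of \<open>fno_layer\<close>: it
  implies that bound for any numbers of channels and survives padding by zero entries.\<close>

definition simple_layer :: "nat \<Rightarrow> ((real^'d \<Rightarrow> nat \<Rightarrow> real) \<Rightarrow> real^'d \<Rightarrow> nat \<Rightarrow> real) \<Rightarrow> bool" where
  "simple_layer dv A \<longleftrightarrow> (\<exists>I W b K. I \<subseteq> {..<dv} \<and> L2_field L dv b \<and> bounded_symbol K \<and>
     A = layer_map \<sigma> L dv I W b K)"

lemma simple_layer_imp_fno_layer:
  assumes "simple_layer dv A" shows "fno_layer \<sigma> L dv A"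
proof -
  obtain I W b K where A: "I \<subseteq> {..<dv}" "L2_field L dv b" "bounded_symbol K" "A = layer_map \<sigma> L dv I W b K"
    using assms by (auto simp: simple_layer_def)
  have "L2_field L dv (A v)" if v: "L2_field L dv v" for v
    unfolding L2_field_def
  proof (intro allI impI)
    fix i assume i: "i < dv"
    have "sq_integrable L (\<lambda>x. (\<Sum>j<dv. W i j * v x j) + b x i + conv L dv K v x i)"
      using v A(2) i conv_has_fourier_sum[OF A(3) v, of i]
      by (intro sq_integrable_add sq_integrable_sum sq_integrable_mult_left)
        (auto simp: L2_field_def has_fourier_sum_def)
    then show "sq_integrable L (\<lambda>x. A v x i)"
      using i sq_integrable_act by (cases "i \<in> I") (simp_all add: A(4) layer_map_def activate_def)
  qed
  then show ?thesis
    unfolding fno_layer_def using A bounded_symbol_conv_bounded_L2[OF A(3)]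
    by (intro exI[of _ I] exI[of _ W] exI[of _ b] exI[of _ K]) (simp add: bounded_symbol_def)
qed

section \<open>Layers acting on a growing list of channels\<close>

definition agree :: "nat \<Rightarrow> (real^'d \<Rightarrow> nat \<Rightarrow> real) \<Rightarrow> (real^'d \<Rightarrow> nat \<Rightarrow> real) \<Rightarrow> bool" where
  "agree n v w \<longleftrightarrow> (\<forall>x. \<forall>i<n. v x i = w x i)"

text \<open>All columns that would read the new channel are zero, in the matrix and in the kernel,
  so whatever the new channel holds cannot influence the old ones.\<close>

lemma simple_layer_pad:
  assumes "simple_layer n A"
  obtains A' where "simple_layer (Suc n) A'" "\<And>v w. agree n v w \<Longrightarrow> agree n (A v) (A' w)"
proof -
  obtain I W b K where A: "I \<subseteq> {..<n}" "L2_field L n b" "bounded_symbol K" "A = layer_map \<sigma> L n I W b K"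
    using assms by (auto simp: simple_layer_def)
  define W' where "W' i j = (if j < n then W i j else 0)" for i j
  define b' where "b' x i = (if i < n then b x i else 0)" for x i
  define K' where "K' \<xi> i j = (if j < n then K \<xi> i j else 0)" for \<xi> and i j :: nat
  have 1: "L2_field L (Suc n) b'"
    unfolding L2_field_def
  proof (intro allI impI)
    show "sq_integrable L (\<lambda>x. b' x i)" for i
      using A(2) by (cases "i < n") (simp_all add: b'_def L2_field_def)
  qed
  obtain B where B: "\<And>\<xi> i j. cmod (K \<xi> i j) \<le> B" using A(3) by (auto simp: bounded_symbol_def)
  have "cmod (K' \<xi> i j) \<le> max B 0" for \<xi> i j
    using B[of \<xi> i j] by (auto simp: K'_def)
  moreover have "conj_symmetric K'"
    using A(3) unfolding bounded_symbol_def by (auto simp: conj_symmetric_def K'_def)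
  ultimately have 2: "bounded_symbol K'" unfolding bounded_symbol_def by blast
  show ?thesis
  proof
    show "simple_layer (Suc n) (layer_map \<sigma> L (Suc n) I W' b' K')"
      unfolding simple_layer_def using A(1) 1 2
      by (intro exI[of _ I] exI[of _ W'] exI[of _ b'] exI[of _ K'] conjI refl) auto
    fix v w assume vw: "agree n v w"
    then have eq: "(\<lambda>x. w x j) = (\<lambda>x. v x j)" if "j < n" for j
      using that by (auto simp: agree_def)
    have "conv_coeff L (Suc n) K' w i = conv_coeff L n K v i" for i
      using eq by (auto simp: fun_eq_iff conv_coeff_def K'_def intro!: sum.cong)
    then have "conv L (Suc n) K' w x i = conv L n K v x i" for x i
      by (simp add: conv_def)
    moreover have "(\<Sum>j<Suc n. W' i j * w x j) = (\<Sum>j<n. W i j * v x j)" for x i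
      using vw by (auto simp: W'_def agree_def intro!: sum.cong)
    ultimately show "agree n (A v) (layer_map \<sigma> L (Suc n) I W' b' K' w)"
      by (simp add: agree_def A(4) layer_map_def activate_def b'_def)
  qed
qed

lemma simple_layers_pad:
  assumes "\<forall>A\<in>set As. simple_layer n A"
  obtains As' where "\<forall>A\<in>set As'. simple_layer (Suc n) A" "length As' = length As"
    "\<And>v w. agree n v w \<Longrightarrow> agree n (fold (\<lambda>A v. A v) As v) (fold (\<lambda>A v. A v) As' w)"
  using assms
proof (induction As arbitrary: thesis)
  case Nil
  then show ?case by (metis fold_simps(1) list.set(1) empty_iff)
next
  case (Cons A As)
  obtain As' where As': "\<forall>A\<in>set As'. simple_layer (Suc n) A" "length As' = length As"
    "\<And>v w. agree n v w \<Longrightarrow> agree n (fold (\<lambda>A v. A v) As v) (fold (\<lambda>A v. A v) As' w)"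
    using Cons.IH Cons.prems(2) by auto
  obtain A' where A': "simple_layer (Suc n) A'" "\<And>v w. agree n v w \<Longrightarrow> agree n (A v) (A' w)"
    using simple_layer_pad Cons.prems(2) by (metis list.set_intros(1))
  show ?case
    by (rule Cons.prems(1)[of "A' # As'"]) (use As' A' in auto)
qed

definition coordinates :: "nat \<Rightarrow> nat \<Rightarrow> (nat \<Rightarrow> real) \<Rightarrow> nat \<Rightarrow> real" where
  "coordinates n m = affine_map n m (\<lambda>i j. if i = j then 1 else 0) (\<lambda>_. 0)"

lemma coordinates_apply: "i < m \<Longrightarrow> coordinates n m a i = (if i < n then a i else 0)"
  by (simp add: coordinates_def affine_map_def if_distrib[of "\<lambda>c. c * _"] cong: if_cong)

text \<open>One stack of layers carries the whole list at once, one function per channel, so that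
  later computations can read every earlier result. The lifting copies the input into the first
  channels and sets the others to 0.\<close>

definition realizable :: "nat \<Rightarrow> ((real^'d \<Rightarrow> nat \<Rightarrow> real) \<Rightarrow> real^'d \<Rightarrow> real) list \<Rightarrow> bool" where
  "realizable da fs \<longleftrightarrow> (\<exists>As. As \<noteq> [] \<and> (\<forall>A\<in>set As. simple_layer (length fs) A) \<and>
     (\<forall>a x. \<forall>i<length fs. fold (\<lambda>A v. A v) As (\<lambda>x. coordinates da (length fs) (a x)) x i = (fs ! i) a x))"

text \<open>The sum of the zero Fourier series is only almost everywhere zero; it is compensated by the bias.\<close>

abbreviation null_sum :: "real^'d \<Rightarrow> real" where
  "null_sum \<equiv> fourier_sum L (\<lambda>_. 0)"

lemma sq_integrable_null_sum: "sq_integrable L null_sum"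
  using has_fourier_sum_fourier_sum[of "\<lambda>_. 0"] by (simp add: has_fourier_sum_def)

text \<open>The old layers are padded by one channel and one more layer is added. It passes the old
  channels on without activation and computes the new one from an affine combination and
  convolutions of them, activated if \<open>act\<close> holds.\<close>

lemma realizable_snoc:
  assumes fs: "realizable da fs" and b: "sq_integrable L b"
    and k: "\<And>j. multiplier (k j)"
  shows "realizable da (fs @ [\<lambda>a x. (if act then \<sigma> else id) ((\<Sum>j<length fs. w j * (fs ! j) a x) + b x
    + fourier_sum L (\<lambda>\<xi>. \<Sum>j<length fs. k j \<xi> * fourier_coeff L ((fs ! j) a) \<xi>) x)])"
proof -
  define n where "n = length fs"
  obtain As where As: "As \<noteq> []" "\<forall>A\<in>set As. simple_layer n A"
      "\<And>a x i. i < n \<Longrightarrow> fold (\<lambda>A v. A v) As (\<lambda>x. coordinates da n (a x)) x i = (fs ! i) a x"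
    using fs unfolding realizable_def n_def by blast
  obtain As' where As': "\<forall>A\<in>set As'. simple_layer (Suc n) A"
    "\<And>v w. agree n v w \<Longrightarrow> agree n (fold (\<lambda>A v. A v) As v) (fold (\<lambda>A v. A v) As' w)"
    using simple_layers_pad[OF As(2)] by metis
  define I where "I = (if act then {n} else {})"
  define W where "W i j = (if i < n then if i = j then 1 else 0 else if j < n then w j else 0)" for i j
  define b' where "b' x i = (if i < n then - null_sum x else b x)" for x and i :: nat
  define K where "K \<xi> i j = (if i = n \<and> j < n then k j \<xi> else 0)" for \<xi> and i j :: nat
  define A where "A = layer_map \<sigma> L (Suc n) I W b' K"
  have 1: "L2_field L (Suc n) b'"
    unfolding L2_field_def
  proof (intro allI impI)
    show "sq_integrable L (\<lambda>x. b' x i)" for i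
      using b sq_integrable_null_sum by (cases "i < n") (simp_all add: b'_def sq_integrable_minus)
  qed
  have "\<exists>B. \<forall>\<xi>. cmod (k j \<xi>) \<le> B" for j using k[of j] by (auto simp: multiplier_def)
  then obtain B where B: "\<And>j \<xi>. cmod (k j \<xi>) \<le> B j" by metis
  have B0: "0 \<le> B j" for j using B[of j 0] norm_ge_zero order_trans by blast
  have "cmod (K \<xi> i j) \<le> (\<Sum>j<n. B j)" for \<xi> i j
    using B0 by (auto simp: K_def sum_nonneg intro!: order_trans[OF B] member_le_sum)
  moreover have "conj_symmetric K"
    using k by (auto simp: conj_symmetric_def K_def multiplier_def)
  ultimately have 2: "bounded_symbol K" unfolding bounded_symbol_def by blast
  have A: "simple_layer (Suc n) A"
    unfolding simple_layer_def A_def using 1 2 by (intro exI conjI refl) (auto simp: I_def)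
  have out: "A v x i = (if i < n then v x i else (if act then \<sigma> else id) ((\<Sum>j<n. w j * v x j) + b x
      + fourier_sum L (\<lambda>\<xi>. \<Sum>j<n. k j \<xi> * fourier_coeff L (\<lambda>x. v x j) \<xi>) x))" if "i < Suc n" for v x i
  proof (cases "i < n")
    case True
    have "conv_coeff L (Suc n) K v i = (\<lambda>_. 0)" using True by (simp add: fun_eq_iff conv_coeff_def K_def)
    then have "conv L (Suc n) K v x i = null_sum x" by (simp add: conv_def)
    moreover have "(\<Sum>j<Suc n. W i j * v x j) = v x i"
      using True by (simp add: W_def if_distrib[of "\<lambda>c. c * _"] cong: if_cong)
    ultimately show ?thesis
      using True by (simp add: A_def layer_map_def activate_def I_def b'_def)
  next
    case False
    then have i: "i = n" using that by simp
    have "conv_coeff L (Suc n) K v n = (\<lambda>\<xi>. \<Sum>j<n. k j \<xi> * fourier_coeff L (\<lambda>x. v x j) \<xi>)"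
      by (simp add: fun_eq_iff conv_coeff_def K_def)
    then have "conv L (Suc n) K v x n = fourier_sum L (\<lambda>\<xi>. \<Sum>j<n. k j \<xi> * fourier_coeff L (\<lambda>x. v x j) \<xi>) x"
      by (simp add: conv_def)
    then show ?thesis
      by (simp add: i A_def layer_map_def activate_def I_def b'_def W_def)
  qed
  let ?new = "\<lambda>a x. (if act then \<sigma> else id) ((\<Sum>j<n. w j * (fs ! j) a x) + b x
    + fourier_sum L (\<lambda>\<xi>. \<Sum>j<n. k j \<xi> * fourier_coeff L ((fs ! j) a) \<xi>) x)"
  have "realizable da (fs @ [?new])"
    unfolding realizable_def
  proof (intro exI conjI allI impI)
    show "As' @ [A] \<noteq> []" by simp
    show "\<forall>A\<in>set (As' @ [A]). simple_layer (length (fs @ [?new])) A"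
      using As' A by (auto simp: n_def)
    fix a x i assume i: "i < length (fs @ [?new])"
    define v where "v = fold (\<lambda>A v. A v) As' (\<lambda>x. coordinates da (Suc n) (a x))"
    have "agree n (\<lambda>x. coordinates da n (a x)) (\<lambda>x. coordinates da (Suc n) (a x))"
      by (simp add: agree_def coordinates_apply)
    from As'(2)[OF this] have v: "v x j = (fs ! j) a x" if "j < n" for x j
      using that As(3)[OF that, of a x] unfolding agree_def v_def by metis
    have v': "(\<lambda>x. v x j) = (fs ! j) a" if "j < n" for j using v[OF that] by blast
    have "fold (\<lambda>A v. A v) (As' @ [A]) (\<lambda>x. coordinates da (length (fs @ [?new])) (a x)) x i = A v x i"
      by (simp add: v_def n_def)
    also have "\<dots> = ((fs @ [?new]) ! i) a x"
    proof (cases "i < n")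
      case True
      then show ?thesis using out[of i v x] v[OF True] by (simp add: nth_append n_def)
    next
      case False
      then have "i = n" using i by (simp add: n_def)
      moreover have "(\<Sum>j<n. w j * v x j) = (\<Sum>j<n. w j * (fs ! j) a x)" by (intro sum.cong) (simp_all add: v)
      moreover have "(\<lambda>\<xi>. \<Sum>j<n. k j \<xi> * fourier_coeff L (\<lambda>x. v x j) \<xi>) = (\<lambda>\<xi>. \<Sum>j<n. k j \<xi> * fourier_coeff L ((fs ! j) a) \<xi>)"
        by (intro ext sum.cong refl) (simp add: v')
      ultimately show ?thesis using out[of n v x] by (simp add: nth_append n_def)
    qed
    finally show "fold (\<lambda>A v. A v) (As' @ [A]) (\<lambda>x. coordinates da (length (fs @ [?new])) (a x)) x i = ((fs @ [?new]) ! i) a x" .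
  qed
  then show ?thesis by (simp only: n_def)
qed

lemma realizable_snoc_affine:
  assumes fs: "realizable da fs" and b: "sq_integrable L b"
  shows "realizable da (fs @ [\<lambda>a x. (if act then \<sigma> else id) ((\<Sum>j<length fs. w j * (fs ! j) a x) + b x)])"
proof -
  have "multiplier (\<lambda>_. 0)" by (auto simp: multiplier_def)
  from realizable_snoc[OF fs sq_integrable_diff[OF b sq_integrable_null_sum] this, of act w]
  show ?thesis by simp
qed

text \<open>The operations available to a layer, in expression form. Products are not among them;
  they are approximated through \<open>comp_act\<close>.\<close>

inductive comp :: "nat \<Rightarrow> ((real^'d \<Rightarrow> nat \<Rightarrow> real) \<Rightarrow> real^'d \<Rightarrow> real) \<Rightarrow> bool" for da where
  comp_input: "i < da \<Longrightarrow> comp da (\<lambda>a x. a x i)"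
| comp_const: "comp da (\<lambda>a x. c)"
| comp_add: "comp da f \<Longrightarrow> comp da g \<Longrightarrow> comp da (\<lambda>a x. f a x + g a x)"
| comp_scale: "comp da f \<Longrightarrow> comp da (\<lambda>a x. c * f a x)"
| comp_act: "comp da f \<Longrightarrow> comp da (\<lambda>a x. \<sigma> (f a x))"
| comp_mult: "comp da f \<Longrightarrow> multiplier k \<Longrightarrow> comp da (\<lambda>a. mult k (f a))"

lemma comp_diff: "comp da f \<Longrightarrow> comp da g \<Longrightarrow> comp da (\<lambda>a x. f a x - g a x)"
  using comp_add[of da f "\<lambda>a x. (-1) * g a x"] comp_scale[of da g "-1"] by simp

lemma comp_sum:
  "(\<And>i. i \<in> I \<Longrightarrow> comp da (f i)) \<Longrightarrow> comp da (\<lambda>a x. \<Sum>i\<in>I. f i a x)"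
  by (induction I rule: infinite_finite_induct) (simp_all add: comp_const comp_add)

lemma comp_sq_integrable:
  assumes "comp da f" "\<And>i. i < da \<Longrightarrow> sq_integrable L (\<lambda>x. a x i)"
  shows "sq_integrable L (f a)"
  using assms
  by induction (auto intro: sq_integrable_add sq_integrable_mult_left sq_integrable_act sq_integrable_mult)

definition extends :: "nat \<Rightarrow> ((real^'d \<Rightarrow> nat \<Rightarrow> real) \<Rightarrow> real^'d \<Rightarrow> real) list \<Rightarrow>
    ((real^'d \<Rightarrow> nat \<Rightarrow> real) \<Rightarrow> real^'d \<Rightarrow> real) list \<Rightarrow> bool" where
  "extends da fs fs' \<longleftrightarrow> realizable da fs' \<and> set fs \<subseteq> set fs'"

text \<open>Compiles an expression into channels: each constructor appends one channel to a list
  that already contains its operands. The list \<open>fs\<close> is generalized so that the second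
  operand of a sum is compiled on top of the channels of the first.\<close>

lemma comp_extends:
  assumes "comp da f" "realizable da fs" "\<And>i. i < da \<Longrightarrow> (\<lambda>a x. a x i) \<in> set fs"
  shows "\<exists>fs'. extends da fs fs' \<and> f \<in> set fs'"
  using assms
proof (induction arbitrary: fs)
  case (comp_input i)
  then show ?case unfolding extends_def by blast
next
  case (comp_const c)
  have "realizable da (fs @ [\<lambda>a x. c])"
    using realizable_snoc_affine[OF comp_const(1), of "\<lambda>_. c" False "\<lambda>_. 0"] by simp
  then show ?case unfolding extends_def by (intro exI[of _ "fs @ [\<lambda>a x. c]"]) auto
next
  case (comp_add f g)
  obtain fs1 where 1: "extends da fs fs1" "f \<in> set fs1"
    using comp_add.IH(1)[OF comp_add.prems] by blast
  obtain fs2 where 2: "extends da fs1 fs2" "g \<in> set fs2"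
    using comp_add.IH(2)[of fs1] 1 comp_add.prems unfolding extends_def by blast
  have "f \<in> set fs2" using 1 2 unfolding extends_def by blast
  then obtain i where i: "i < length fs2" "fs2 ! i = f" unfolding in_set_conv_nth by blast
  obtain j where j: "j < length fs2" "fs2 ! j = g" using 2(2) unfolding in_set_conv_nth by blast
  note ij = i j
  \<comment> \<open>Two indicators are added, so that the weight is 2 when both operands sit in the
    same channel.\<close>
  let ?w = "\<lambda>m. (if m = i then 1 else 0) + (if m = j then 1 else (0::real))"
  have "(\<Sum>m<length fs2. ?w m * (fs2 ! m) a x) = f a x + g a x" for a x
    using ij by (simp add: distrib_right sum.distrib if_distrib[of "\<lambda>c. c * _"] cong: if_cong)
  then have "realizable da (fs2 @ [\<lambda>a x. f a x + g a x])"
    using realizable_snoc_affine[of da fs2 "\<lambda>_. 0" False ?w] 2(1) unfolding extends_def by simp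
  then show ?case using 1 2 unfolding extends_def
    by (intro exI[of _ "fs2 @ [\<lambda>a x. f a x + g a x]"]) auto
next
  case (comp_scale f c)
  obtain fs1 where 1: "extends da fs fs1" "f \<in> set fs1"
    using comp_scale.IH[OF comp_scale.prems] by blast
  obtain i where i: "i < length fs1" "fs1 ! i = f"
    using 1(2) unfolding in_set_conv_nth by blast
  let ?w = "\<lambda>m. if m = i then c else 0"
  have "(\<Sum>m<length fs1. ?w m * (fs1 ! m) a x) = c * f a x" for a x
    using i by (simp add: if_distrib[of "\<lambda>c. c * _"] cong: if_cong)
  then have "realizable da (fs1 @ [\<lambda>a x. c * f a x])"
    using realizable_snoc_affine[of da fs1 "\<lambda>_. 0" False ?w] 1(1) unfolding extends_def by simp
  then show ?case using 1 unfolding extends_def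
    by (intro exI[of _ "fs1 @ [\<lambda>a x. c * f a x]"]) auto
next
  case (comp_act f)
  obtain fs1 where 1: "extends da fs fs1" "f \<in> set fs1"
    using comp_act.IH[OF comp_act.prems] by blast
  obtain i where i: "i < length fs1" "fs1 ! i = f"
    using 1(2) unfolding in_set_conv_nth by blast
  let ?w = "\<lambda>m. if m = i then 1 else (0::real)"
  have "(\<Sum>m<length fs1. ?w m * (fs1 ! m) a x) = f a x" for a x
    using i by (simp add: if_distrib[of "\<lambda>c. c * _"] cong: if_cong)
  then have "realizable da (fs1 @ [\<lambda>a x. \<sigma> (f a x)])"
    using realizable_snoc_affine[of da fs1 "\<lambda>_. 0" True ?w] 1(1) unfolding extends_def by simp
  then show ?case using 1 unfolding extends_def
    by (intro exI[of _ "fs1 @ [\<lambda>a x. \<sigma> (f a x)]"]) auto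
next
  case (comp_mult f k)
  obtain fs1 where 1: "extends da fs fs1" "f \<in> set fs1"
    using comp_mult.IH[OF comp_mult.prems] by blast
  obtain i where i: "i < length fs1" "fs1 ! i = f"
    using 1(2) unfolding in_set_conv_nth by blast
  let ?k = "\<lambda>m \<xi>. if m = i then k \<xi> else 0"
  have m: "multiplier (?k m)" for m
    using comp_mult.hyps(2) by (auto simp: multiplier_def)
  have "(\<lambda>\<xi>. \<Sum>m<length fs1. ?k m \<xi> * fourier_coeff L ((fs1 ! m) a) \<xi>) = (\<lambda>\<xi>. k \<xi> * fourier_coeff L (f a) \<xi>)" for a
    using i by (intro ext) (simp add: if_distrib[of "\<lambda>c. c * _"] cong: if_cong)
  then have "realizable da (fs1 @ [\<lambda>a x. mult k (f a) x])"
    using realizable_snoc[of da fs1 "\<lambda>_. 0" ?k False "\<lambda>_. 0"] 1(1) m unfolding extends_def by (simp add: mult_def)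
  then show ?case using 1 unfolding extends_def
    by (intro exI[of _ "fs1 @ [\<lambda>a x. mult k (f a) x]"]) auto
qed

lemma comps_extends:
  assumes "\<And>f. f \<in> set hs \<Longrightarrow> comp da f" "realizable da fs" "\<And>i. i < da \<Longrightarrow> (\<lambda>a x. a x i) \<in> set fs"
  shows "\<exists>fs'. extends da fs fs' \<and> set hs \<subseteq> set fs'"
  using assms(1)
proof (induction hs)
  case Nil
  then show ?case using assms(2) unfolding extends_def by auto
next
  case (Cons h hs)
  obtain fs1 where 1: "extends da fs fs1" "set hs \<subseteq> set fs1" using Cons by auto
  have "(\<lambda>a x. a x i) \<in> set fs1" if "i < da" for i
    using assms(3)[OF that] 1 unfolding extends_def by blast
  moreover have "comp da h" "realizable da fs1" using Cons.prems 1 unfolding extends_def by auto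
  ultimately obtain fs2 where "extends da fs1 fs2" "h \<in> set fs2"
    using comp_extends by blast
  then show ?case using 1 unfolding extends_def by (intro exI[of _ fs2]) auto
qed

text \<open>An FNO has at least one layer, so the bare input is realized by an identity layer whose
  bias compensates the sum of the zero series.\<close>

lemma realizable_inputs: "realizable da (map (\<lambda>i a x. a x i) [0..<da])"
  unfolding realizable_def
proof (intro exI conjI)
  let ?A = "layer_map \<sigma> L da {} (\<lambda>i j. if i = j then 1 else 0) (\<lambda>x i. - null_sum x) (\<lambda>_ _ _. 0)"
  show "[?A] \<noteq> []" by simp
  have "L2_field L da (\<lambda>x i. - null_sum x)"
    by (simp add: L2_field_def sq_integrable_minus sq_integrable_null_sum)
  moreover have "bounded_symbol (\<lambda>_ _ _. 0)" by (auto simp: bounded_symbol_def conj_symmetric_def)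
  ultimately have "simple_layer da ?A" unfolding simple_layer_def by blast
  then show "\<forall>A\<in>set [?A]. simple_layer (length (map (\<lambda>i a x. a x i) [0..<da])) A" by simp
  have "?A v x i = v x i" if "i < da" for v x i
  proof -
    have "conv_coeff L da (\<lambda>_ _ _. 0) v i = (\<lambda>_. 0)" by (simp add: fun_eq_iff conv_coeff_def)
    then show ?thesis using that
      by (simp add: layer_map_def activate_def conv_def if_distrib[of "\<lambda>c. c * _"] cong: if_cong)
  qed
  then show "\<forall>a x. \<forall>i<length (map (\<lambda>i a x. a x i) [0..<da]).
      fold (\<lambda>A v. A v) [?A] (\<lambda>x. coordinates da (length (map (\<lambda>i a x. a x i) [0..<da])) (a x)) x i =
      (map (\<lambda>i a x. a x i) [0..<da] ! i) a x"
    by (simp add: coordinates_apply)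
qed

lemma realizable_zeros:
  assumes "realizable da fs" shows "realizable da (fs @ replicate n (\<lambda>a x. 0))"
proof (induction n)
  case (Suc n)
  then show ?case
    using realizable_snoc_affine[OF Suc, of "\<lambda>_. 0" False "\<lambda>_. 0"]
    by (simp add: replicate_append_same[symmetric])
qed (use assms in simp)

text \<open>The output layer consists of the potential convolution alone and reads the channels that
  hold the entries \<open>H i j\<close>.\<close>

theorem fno_of_comp:
  assumes H: "\<And>i j. comp da (H i j :: (real^'d \<Rightarrow> nat \<Rightarrow> real) \<Rightarrow> real^'d \<Rightarrow> real)"
  shows "fno \<sigma> L da (\<lambda>a x. \<chi> i::'d. fourier_sum L (\<lambda>\<xi>. \<Sum>j\<in>UNIV. potential \<xi> j * fourier_coeff L (H i j a) \<xi>) x)"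
proof -
  obtain ps where ps: "set ps = (UNIV :: ('d \<times> 'd) set)" using finite_list[OF finite] by blast
  let ?in = "map (\<lambda>i a x. a x i) [0..<da] @ replicate CARD('d) (\<lambda>a x. 0)"
  have "\<exists>fs. extends da ?in fs \<and> set (map (\<lambda>p. H (fst p) (snd p)) ps) \<subseteq> set fs"
    using H by (intro comps_extends realizable_zeros realizable_inputs) auto
  then obtain fs0 where fs0: "extends da ?in fs0" "set (map (\<lambda>p. H (fst p) (snd p)) ps) \<subseteq> set fs0" by blast
  \<comment> \<open>The appended zero channels make the number of channels at least the output
    dimension.\<close>
  define fs where "fs = fs0 @ replicate CARD('d) (\<lambda>a x. 0)"
  have real: "realizable da fs" unfolding fs_def using fs0 by (intro realizable_zeros) (simp add: extends_def)
  define n where "n = length fs"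
  have n: "CARD('d) \<le> n" by (simp add: n_def fs_def)
  have "H i j \<in> set fs" for i j
    using fs0(2) ps by (auto simp: fs_def image_subset_iff)
  then have "\<exists>m. m < n \<and> fs ! m = H i j" for i j by (simp add: n_def in_set_conv_nth)
  then obtain c where c: "\<And>i j. c i j < n" "\<And>i j. fs ! c i j = H i j" by metis
  obtain As where As: "As \<noteq> []" "\<forall>A\<in>set As. simple_layer n A"
      "\<And>a x i. i < n \<Longrightarrow> fold (\<lambda>A v. A v) As (\<lambda>x. coordinates da n (a x)) x i = (fs ! i) a x"
    using real unfolding realizable_def n_def by blast
  \<comment> \<open>Summing over \<open>j\<close> accounts for several entries being stored in the
    same channel.\<close>
  define K :: "int^'d \<Rightarrow> 'd \<Rightarrow> nat \<Rightarrow> complex" where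
    "K \<xi> i m = (\<Sum>j\<in>UNIV. if m = c i j then potential \<xi> j else 0)" for \<xi> i m
  have coeff: "conv_coeff L n K v i \<xi> = (\<Sum>j\<in>UNIV. potential \<xi> j * fourier_coeff L (\<lambda>x. v x (c i j)) \<xi>)" for v i \<xi>
  proof -
    have "conv_coeff L n K v i \<xi> = (\<Sum>j\<in>UNIV. \<Sum>m<n. (if m = c i j then potential \<xi> j else 0) * fourier_coeff L (\<lambda>x. v x m) \<xi>)"
      unfolding conv_coeff_def K_def sum_distrib_right by (rule sum.swap)
    also have "\<dots> = (\<Sum>j\<in>UNIV. potential \<xi> j * fourier_coeff L (\<lambda>x. v x (c i j)) \<xi>)"
      using c(1) by (simp add: if_distrib[of "\<lambda>c. c * _"] cong: if_cong)
    finally show ?thesis .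
  qed
  have bs: "bounded_symbol K"
  proof -
    have "\<exists>B. \<forall>\<xi>. cmod (potential \<xi> j) \<le> B" for j using multiplier_potential[of j] by (auto simp: multiplier_def)
    then obtain B where B: "\<And>j \<xi>. cmod (potential \<xi> j) \<le> B j" by metis
    have B0: "0 \<le> B j" for j using B[of 0 j] norm_ge_zero order_trans by blast
    have "cmod (K \<xi> i m) \<le> (\<Sum>j\<in>UNIV. B j)" for \<xi> i m
      unfolding K_def using B B0 by (intro sum_norm_le) auto
    moreover have "conj_symmetric K"
      unfolding conj_symmetric_def K_def cnj_sum by (intro allI sum.cong refl) (simp add: potential_uminus)
    ultimately show ?thesis unfolding bounded_symbol_def by blast
  qed
  have H1: "conv_bounded_H1 L n K"
    unfolding conv_bounded_H1_def
  proof (intro exI allI impI conjI)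
    fix v assume v: "L2_field L n v"
    define w where "w x = (\<chi> i. conv L n K v x i)" for x
    define D :: "real^'d \<Rightarrow> real^'d^'d" where "D x = (\<chi> i j. v x (c i j))" for x
    show F: "has_fourier_sum L (conv_coeff L n K v i) (\<lambda>x. conv L n K v x i)" for i
      by (rule conv_has_fourier_sum[OF bs v])
    have sv: "sq_integrable L (\<lambda>x. v x (c i j))" for i j using v c(1) by (simp add: L2_field_def)
    have D: "sq_integrable L D" by (rule sq_integrable_componentwise2) (simp add: D_def sv)
    have w: "sq_integrable L w"
      unfolding sq_integrable_componentwise using F by (simp add: w_def has_fourier_sum_def)
    have cw: "fourier_coeff L (\<lambda>x. w x $ i) \<xi> = (\<Sum>j\<in>UNIV. potential \<xi> j * fourier_coeff L (\<lambda>x. D x $ i $ j) \<xi>)" for i \<xi>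
      using has_fourier_sum_imp_coeff[OF F] by (simp add: w_def D_def coeff)
    note P = potential_H1[OF w D cw]
    show "(\<lambda>x. \<chi> i. conv L n K v x i) \<in> H1_per L"
      using P(1) by (simp add: w_def[abs_def] H1_per0_def)
    \<comment> \<open>Each entry of \<open>D\<close> reads one channel, possibly the same for many
      entries, so each is bounded by the norm of all channels. The number of entries is the square
      of the dimension, which gives the dimension as a factor.\<close>
    have "(l2 L D)\<^sup>2 = (\<Sum>i\<in>UNIV. \<Sum>j\<in>UNIV. (l2 L (\<lambda>x. v x (c i j)))\<^sup>2)"
      by (simp add: l2_mat[OF D]) (simp add: D_def)
    also have "\<dots> \<le> (\<Sum>i\<in>(UNIV::'d set). \<Sum>j\<in>(UNIV::'d set). \<Sum>m<n. (l2 L (\<lambda>x. v x m))\<^sup>2)"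
      using c(1) by (intro sum_mono member_le_sum[of "c _ _" "{..<n}" "\<lambda>m. (l2 L (\<lambda>x. v x m))\<^sup>2"]) auto
    also have "(\<Sum>m<n. (l2 L (\<lambda>x. v x m))\<^sup>2) = (L2_norm_field L n v)\<^sup>2"
      by (simp add: L2_norm_field_def l2_power2 sum_nonneg)
    also have "(\<Sum>i\<in>(UNIV::'d set). \<Sum>j\<in>(UNIV::'d set). (L2_norm_field L n v)\<^sup>2) =
        (real CARD('d) * L2_norm_field L n v)\<^sup>2"
      by (simp add: power_mult_distrib power2_eq_square[of "real CARD('d)"] mult.assoc)
    finally have "l2 L D \<le> real CARD('d) * L2_norm_field L n v"
      by (rule power2_le_imp_le) (simp add: L2_norm_field_def sum_nonneg)
    then have "sqrt (poincare + 1) * l2 L D \<le> sqrt (poincare + 1) * (real CARD('d) * L2_norm_field L n v)"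
      using poincare_nonneg by (intro mult_left_mono) auto
    then show "H1_norm L (\<lambda>x. \<chi> i. conv L n K v x i) \<le> (sqrt (poincare + 1) * real CARD('d)) * L2_norm_field L n v"
      using P(3) by (simp add: w_def[abs_def] mult.assoc)
  qed
  have out: "fno_output L n (output_map L n (\<lambda>_ _. 0) (\<lambda>_. 0) K)"
    unfolding fno_output_def using bs H1 by (intro exI[of _ "\<lambda>_ _. 0"] exI[of _ "\<lambda>_. 0"] exI[of _ K]) (simp add: bounded_symbol_def)
  have "(\<lambda>a x. \<chi> i::'d. fourier_sum L (\<lambda>\<xi>. \<Sum>j\<in>UNIV. potential \<xi> j * fourier_coeff L (H i j a) \<xi>) x) =
      (\<lambda>a. output_map L n (\<lambda>_ _. 0) (\<lambda>_. 0) K (fold (\<lambda>A v. A v) As (\<lambda>x. coordinates da n (a x))))"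
  proof (intro ext)
    fix a x
    let ?v = "fold (\<lambda>A v. A v) As (\<lambda>x. coordinates da n (a x))"
    have "(\<lambda>x. ?v x (c i j)) = H i j a" for i j
      using As(3)[OF c(1)] c(2) by (simp add: fun_eq_iff)
    then have "conv_coeff L n K ?v i = (\<lambda>\<xi>. \<Sum>j\<in>UNIV. potential \<xi> j * fourier_coeff L (H i j a) \<xi>)" for i
      by (simp add: fun_eq_iff coeff)
    then show "(\<chi> i::'d. fourier_sum L (\<lambda>\<xi>. \<Sum>j\<in>UNIV. potential \<xi> j * fourier_coeff L (H i j a) \<xi>) x) =
        output_map L n (\<lambda>_ _. 0) (\<lambda>_. 0) K ?v x"
      by (simp add: output_map_def conv_def)
  qed
  moreover have "neural_net \<sigma> da n (coordinates da n)"
    unfolding coordinates_def by (rule nn_affine)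
  moreover have "\<forall>A\<in>set As. fno_layer \<sigma> L n A" using As(2) simple_layer_imp_fno_layer by blast
  ultimately show ?thesis
    unfolding fno_def using n As(1) out by blast
qed

lemma fno_output_coeff:
  fixes H :: "'d \<Rightarrow> 'd \<Rightarrow> real^'d \<Rightarrow> real"
  assumes H: "\<And>i j. sq_integrable L (H i j)"
  defines "w \<equiv> (\<lambda>x. \<chi> i. fourier_sum L (\<lambda>\<xi>. \<Sum>j\<in>UNIV. potential \<xi> j * fourier_coeff L (H i j) \<xi>) x)"
  shows "sq_integrable L w"
    and "fourier_coeff L (\<lambda>x. w x $ i) \<xi> = (\<Sum>j\<in>UNIV. potential \<xi> j * fourier_coeff L (H i j) \<xi>)"
proof -
  obtain B where B: "\<And>j \<xi>. cmod (potential \<xi> j) \<le> B j"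
    using multiplier_potential unfolding multiplier_def by metis
  have B': "cmod (potential \<xi> j) \<le> (\<Sum>j\<in>UNIV. \<bar>B j\<bar>)" for \<xi> j
  proof (rule order_trans[OF B])
    have "B j \<le> \<bar>B j\<bar>" by simp
    also have "\<dots> \<le> (\<Sum>j\<in>UNIV. \<bar>B j\<bar>)" by (intro member_le_sum) auto
    finally show "B j \<le> (\<Sum>j\<in>UNIV. \<bar>B j\<bar>)" .
  qed
  have F: "has_fourier_sum L (\<lambda>\<xi>. \<Sum>j\<in>UNIV. potential \<xi> j * fourier_coeff L (H i j) \<xi>)
      (fourier_sum L (\<lambda>\<xi>. \<Sum>j\<in>UNIV. potential \<xi> j * fourier_coeff L (H i j) \<xi>))" for i
    by (intro has_fourier_sum_fourier_sum combination_summable[where B="\<Sum>j\<in>UNIV. \<bar>B j\<bar>"] H B')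
      (simp add: potential_uminus fourier_coeff_uminus_freq)
  then show "sq_integrable L w"
    unfolding sq_integrable_componentwise by (simp add: w_def has_fourier_sum_def)
  show "fourier_coeff L (\<lambda>x. w x $ i) \<xi> = (\<Sum>j\<in>UNIV. potential \<xi> j * fourier_coeff L (H i j) \<xi>)"
    using has_fourier_sum_imp_coeff[OF F] by (simp add: w_def)
qed

end

section \<open>An activation that multiplies\<close>

definition tri :: "real \<Rightarrow> real" where
  "tri t = \<bar>t - of_int (round t)\<bar>"

definition sigma :: "real \<Rightarrow> real" where
  "sigma t = t * tri t"

lemma tri_le: "tri t \<le> \<bar>t - of_int n\<bar>"
  unfolding tri_def by (rule round_diff_minimal)

lemma tri_nonneg: "0 \<le> tri t"
  by (simp add: tri_def)

lemma tri_le_half: "tri t \<le> 1 / 2"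
  unfolding tri_def using of_int_round_abs_le[of t] by (simp add: abs_minus_commute)

lemma tri_add_int: "tri (t + of_int n) = tri t"
proof -
  have "tri (t + of_int n) \<le> tri t" for t n
    using tri_le[of "t + of_int n" "round t + n"] by (simp add: tri_def)
  from this[of t n] this[of "t + of_int n" "- n"] show ?thesis by simp
qed

lemma tri_small: "0 \<le> t \<Longrightarrow> t \<le> 1 / 2 \<Longrightarrow> tri t = t"
proof (rule antisym)
  assume t: "0 \<le> t" "t \<le> 1 / 2"
  show "tri t \<le> t" using tri_le[of t 0] t by simp
  show "t \<le> tri t"
  proof (cases "round t \<le> 0")
    case True
    then have "real_of_int (round t) \<le> 0" by simp
    then show ?thesis using t by (simp add: tri_def)
  next
    case False
    then have "1 \<le> real_of_int (round t)" by simp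
    then show ?thesis using t by (simp add: tri_def)
  qed
qed

lemma tri_Lipschitz: "\<bar>tri s - tri t\<bar> \<le> \<bar>s - t\<bar>"
proof -
  have "tri s \<le> tri t + \<bar>s - t\<bar>" for s t
    using tri_le[of s "round t"] by (simp add: tri_def)
  from this[of s t] this[of t s] show ?thesis by linarith
qed

lemma continuous_tri: "continuous_on UNIV tri"
proof (rule continuous_onI)
  fix x e :: real assume e: "0 < e"
  have "dist (tri x') (tri x) \<le> e" if "dist x' x < e" for x'
    using tri_Lipschitz[of x' x] that by (simp add: dist_real_def)
  then show "\<exists>d>0. \<forall>x'\<in>UNIV. dist x' x < d \<longrightarrow> dist (tri x') (tri x) \<le> e"
    using e by blast
qed

lemma continuous_sigma: "continuous_on UNIV sigma"
  unfolding sigma_def[abs_def] by (intro continuous_intros continuous_tri)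

lemma abs_sigma_le: "\<bar>sigma t\<bar> \<le> \<bar>t\<bar>"
  using tri_nonneg[of t] tri_le_half[of t] by (simp add: sigma_def abs_mult mult_left_le)

lemma tri_from_sigma: "tri t = sigma (t + 1) - sigma t"
  using tri_add_int[of t 1] by (simp add: sigma_def algebra_simps)

text \<open>The maps \<open>y + tri y\<close> and \<open>y + 1/2 + tri (y + 1/2)\<close> alternate between being
  constant and an integer, and moving with slope 2.\<close>

lemma tri_identity:
  "tri (y + tri y + x) + tri (y + 1 / 2 + tri (y + 1 / 2) + x) - tri (2 * y + x) = tri x"
proof -
  define n where "n = \<lfloor>y\<rfloor>"
  define r where "r = y - of_int n"
  have y: "y = r + of_int n" by (simp add: r_def)
  have r: "0 \<le> r" "r < 1" unfolding r_def n_def by linarith+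
  have half: "tri (- (1 / 2)) = 1 / 2"
    using tri_add_int[of "- (1 / 2)" 1] tri_small[of "1 / 2"] by simp
  have neg: "tri (- t) = t" if "0 \<le> t" "t \<le> 1 / 2" for t
    using tri_le[of "- t" 0] tri_Lipschitz[of "- t" "- (1 / 2)"] half that by simp
  have shift: "tri s = tri t" if "s = t + of_int m" for s t m
    unfolding that by (rule tri_add_int)
  have y2: "tri (2 * y + x) = tri (2 * r + x)"
    by (rule shift[where m="2 * n"]) (simp add: y)
  show ?thesis
  proof (cases "r \<le> 1 / 2")
    \<comment> \<open>Here p' is the integer n + 1, and p differs from 2 y by the integer n. In the
      other half of the period p and p' exchange roles.\<close>
    case True
    have 1: "tri y = r" unfolding y tri_add_int using True r by (intro tri_small)
    have "tri (y + 1 / 2) = tri (- (1 / 2 - r))"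
      by (rule shift[where m="n + 1"]) (simp add: y)
    then have 2: "tri (y + 1 / 2) = 1 / 2 - r" using neg[of "1 / 2 - r"] True r by simp
    have "tri (y + tri y + x) = tri (2 * r + x)"
      by (rule shift[where m=n]) (simp only: 1, simp add: y)
    moreover have "tri (y + 1 / 2 + tri (y + 1 / 2) + x) = tri x"
      by (rule shift[where m="n + 1"]) (simp only: 2, simp add: y)
    ultimately show ?thesis by (simp only: y2)
  next
    case False
    have "tri y = tri (- (1 - r))"
      by (rule shift[where m="n + 1"]) (simp add: y)
    then have 1: "tri y = 1 - r" using neg[of "1 - r"] False r by simp
    have "tri (y + 1 / 2) = tri (r - 1 / 2)"
      by (rule shift[where m="n + 1"]) (simp add: y)
    then have 2: "tri (y + 1 / 2) = r - 1 / 2" using tri_small[of "r - 1 / 2"] False r by simp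
    have "tri (y + tri y + x) = tri x"
      by (rule shift[where m="n + 1"]) (simp only: 1, simp add: y)
    moreover have "tri (y + 1 / 2 + tri (y + 1 / 2) + x) = tri (2 * r + x)"
      by (rule shift[where m=n]) (simp only: 2, simp add: y)
    ultimately show ?thesis by (simp only: y2)
  qed
qed

text \<open>The three arguments grow like y, y and 2 y; with the weight 1/2 on the last, the terms
  proportional to \<open>y\<close> combine to \<open>y\<close> times the left side of
  \<open>tri_identity\<close>.\<close>

definition mul_core :: "real \<Rightarrow> real \<Rightarrow> real" where
  "mul_core x y = sigma (y + tri y + x) + sigma (y + 1 / 2 + tri (y + 1 / 2) + x) - 1 / 2 * sigma (2 * y + x)"

text \<open>By \<open>tri_identity\<close> the part proportional to \<open>y\<close> is exactly y *
  x, because \<open>tri\<close> is the identity on the assumed range. What remains are bounded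
  offsets times values of \<open>tri\<close>, of size at most 1/2, 3/4 and 1/8.\<close>

lemma mul_core_error:
  assumes "0 \<le> x" "x \<le> 1 / 2"
  shows "\<bar>mul_core x y - y * x\<bar> \<le> 2"
proof -
  define a b c where "a = tri (y + tri y + x)" and "b = tri (y + 1 / 2 + tri (y + 1 / 2) + x)" and "c = tri (2 * y + x)"
  have "mul_core x y = y * (a + b - c) + (tri y + x) * a + (1 / 2 + tri (y + 1 / 2) + x) * b - 1 / 2 * x * c"
    by (simp add: mul_core_def sigma_def a_def b_def c_def algebra_simps)
  also have "a + b - c = x"
    unfolding a_def b_def c_def tri_identity using assms by (rule tri_small)
  finally have eq: "mul_core x y - y * x = (tri y + x) * a + (1 / 2 + tri (y + 1 / 2) + x) * b - 1 / 2 * x * c" by simp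
  have "0 \<le> (tri y + x) * a" "(tri y + x) * a \<le> 1 * (1 / 2)"
    using assms tri_nonneg[of y] tri_le_half[of y] tri_le_half[of "y + tri y + x"]
    unfolding a_def by (intro mult_nonneg_nonneg tri_nonneg mult_mono; linarith)+
  moreover have "0 \<le> (1 / 2 + tri (y + 1 / 2) + x) * b" "(1 / 2 + tri (y + 1 / 2) + x) * b \<le> (3 / 2) * (1 / 2)"
    using assms tri_nonneg[of "y + 1 / 2"] tri_le_half[of "y + 1 / 2"] tri_le_half[of "y + 1 / 2 + tri (y + 1 / 2) + x"]
    unfolding b_def by (intro mult_nonneg_nonneg tri_nonneg mult_mono; linarith)+
  moreover have "0 \<le> 1 / 2 * x * c" "1 / 2 * x * c \<le> 1 / 4 * (1 / 2)"
    using assms tri_le_half[of "2 * y + x"]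
    unfolding c_def by (intro mult_nonneg_nonneg tri_nonneg mult_mono; linarith)+
  ultimately show ?thesis unfolding eq by linarith
qed

text \<open>The map c -> 1/4 + c / (4 R) sends [-R, R] onto [0, 1/2], where \<open>tri\<close> is
  the identity. Subtracting a quarter of y / h removes the offset 1/4, and the factor 4 R h undoes
  both scalings, so the error 2 of \<open>mul_core\<close> becomes 8 R h.\<close>

definition mul_net :: "real \<Rightarrow> real \<Rightarrow> real \<Rightarrow> real \<Rightarrow> real" where
  "mul_net R h c y = (4 * R * h) * (mul_core (1 / 4 + 1 / (4 * R) * c) (1 / h * y) - 1 / 4 * (1 / h * y))"

lemma mul_net_error:
  assumes R: "0 < R" and h: "0 < h" and c: "\<bar>c\<bar> \<le> R"
  shows "\<bar>mul_net R h c y - c * y\<bar> \<le> 8 * R * h"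
proof -
  define x where "x = 1 / 4 + 1 / (4 * R) * c"
  have "\<bar>1 / (4 * R) * c\<bar> \<le> 1 / 4" using R c by (simp add: abs_mult field_simps)
  then have "0 \<le> x" "x \<le> 1 / 2" unfolding x_def by linarith+
  then have err: "\<bar>mul_core x (1 / h * y) - (1 / h * y) * x\<bar> \<le> 2" by (rule mul_core_error)
  have "c * y = (4 * R * h) * ((1 / h * y) * x - 1 / 4 * (1 / h * y))"
    using R h by (simp add: x_def field_simps)
  then have "mul_net R h c y - c * y = (4 * R * h) * (mul_core x (1 / h * y) - (1 / h * y) * x)"
    by (simp add: mul_net_def x_def right_diff_distrib)
  then have "\<bar>mul_net R h c y - c * y\<bar> = (4 * R * h) * \<bar>mul_core x (1 / h * y) - (1 / h * y) * x\<bar>"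
    using R h by (simp add: abs_mult)
  also have "\<dots> \<le> (4 * R * h) * 2" using R h err by (intro mult_left_mono) auto
  finally show ?thesis by simp
qed

section \<open>Coordinates of the input\<close>

lemma sum_nth_distinct: "distinct xs \<Longrightarrow> (\<Sum>i<length xs. f (xs ! i)) = (\<Sum>x\<in>set xs. f x)"
  by (rule sum.reindex_bij_betw) (rule bij_betw_nth, auto)

lemma ordered_basis_expansion:
  assumes B: "ordered_basis V bs" and v: "v \<in> V"
  shows "(\<Sum>i<length bs. representation (set bs) v (bs ! i) *\<^sub>R bs ! i) = v"
proof -
  have "(\<Sum>i<length bs. representation (set bs) v (bs ! i) *\<^sub>R bs ! i) = (\<Sum>b\<in>set bs. representation (set bs) v b *\<^sub>R b)"
    using B sum_nth_distinct[of bs "\<lambda>b. representation (set bs) v b *\<^sub>R b"] by (simp add: ordered_basis_def)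
  also have "\<dots> = v"
    using B v by (intro real_vector.sum_representation_eq) (auto simp: ordered_basis_def)
  finally show ?thesis .
qed

text \<open>The values of T on matrix units give an injective linear map \<open>f\<close> into a
  Euclidean space. A left inverse followed by a coordinate is linear there, hence bounded, and
  splits into one functional for each matrix unit.\<close>

lemma coordinate_functionals:
  fixes ts :: "((real^'d^'d) \<Rightarrow>\<^sub>L (real^'d^'d)) list"
  assumes ts: "ordered_basis V ts"
  obtains \<phi> :: "'d \<Rightarrow> 'd \<Rightarrow> real^'d^'d \<Rightarrow> real" where "\<And>k l. bounded_linear (\<phi> k l)"
    "\<And>T. T \<in> V \<Longrightarrow> representation (set ts) T b = (\<Sum>k\<in>UNIV. \<Sum>l\<in>UNIV. \<phi> k l (blinfun_apply T (axis k (axis l 1))))"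
proof -
  define f :: "((real^'d^'d) \<Rightarrow>\<^sub>L (real^'d^'d)) \<Rightarrow> (real^'d^'d)^'d^'d" where
    "f T = (\<chi> k l. blinfun_apply T (axis k (axis l 1)))" for T
  have "linear f"
    by (simp add: linear_iff f_def vec_eq_iff blinfun.add_left blinfun.scaleR_left)
  moreover have "inj f"
  proof (rule injI)
    fix S T assume "f S = f T"
    then have "blinfun_apply S (axis k (axis l 1)) = blinfun_apply T (axis k (axis l 1))" for k l
      by (simp add: f_def vec_eq_iff)
    note eq = this
    show "S = T"
    proof (rule blinfun_eqI)
      show "blinfun_apply S A = blinfun_apply T A" for A
        by (simp only: blinfun_matrix_expansion[of S A] blinfun_matrix_expansion[of T A] eq)
    qed
  qed
  ultimately obtain g where g: "linear g" "g \<circ> f = id"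
    using linear_injective_left_inverse by blast
  \<comment> \<open>\<open>representation\<close> is additive only on the span of its basis, so the
    basis is extended to the whole space before a linear functional is formed.\<close>
  let ?E = "real_vector.extend_basis (set ts)"
  have ind: "independent (set ts)" and sp: "span (set ts) = V" using ts by (auto simp: ordered_basis_def)
  have E: "independent ?E" "span ?E = UNIV" "set ts \<subseteq> ?E"
    using real_vector.independent_extend_basis[OF ind] real_vector.span_extend_basis[OF ind]
      real_vector.extend_basis_superset[OF ind] by auto
  define \<rho> where "\<rho> y = representation ?E (g y) b" for y
  have lin: "linear \<rho>"
    unfolding linear_iff \<rho>_def
    using real_vector.representation_add[OF E(1)] real_vector.representation_scale[OF E(1)] E(2)
    by (simp add: linear_add[OF g(1)] linear_scale[OF g(1)])
  define \<phi> where "\<phi> k l z = \<rho> (axis k (axis l z))" for k l :: 'd and z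
  have "linear (\<phi> k l)" for k l
  proof -
    have "axis k (axis l (z + z')) = (axis k (axis l z) + axis k (axis l z') :: (real^'d^'d)^'d^'d)"
      and "axis k (axis l (c *\<^sub>R z)) = (c *\<^sub>R axis k (axis l z) :: (real^'d^'d)^'d^'d)" for z z' :: "real^'d^'d" and c
      by (simp_all add: vec_eq_iff axis_def)
    then show ?thesis by (simp add: linear_iff \<phi>_def linear_add[OF lin] linear_scale[OF lin])
  qed
  then have bl: "bounded_linear (\<phi> k l)" for k l by (simp add: linear_conv_bounded_linear)
  have "representation (set ts) T b = (\<Sum>k\<in>UNIV. \<Sum>l\<in>UNIV. \<phi> k l (blinfun_apply T (axis k (axis l 1))))" if T: "T \<in> V" for T
  proof -
    have pull: "(\<Sum>l\<in>UNIV. if P then u l else 0) = (if P then \<Sum>l\<in>UNIV. u l else 0)" for P and u :: "'d \<Rightarrow> real"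
      by simp
    have "f T = (\<Sum>k\<in>UNIV. \<Sum>l\<in>UNIV. axis k (axis l (f T $ k $ l)))"
      by (simp add: vec_eq_iff axis_def if_distrib[of "\<lambda>v. v $ _"] pull cong: if_cong)
    from arg_cong[OF this, of \<rho>]
    have "\<rho> (f T) = (\<Sum>k\<in>UNIV. \<Sum>l\<in>UNIV. \<rho> (axis k (axis l (f T $ k $ l))))"
      by (simp only: linear_sum[OF lin])
    also have "\<dots> = (\<Sum>k\<in>UNIV. \<Sum>l\<in>UNIV. \<phi> k l (blinfun_apply T (axis k (axis l 1))))"
      by (simp add: \<phi>_def f_def)
    finally have "\<rho> (f T) = (\<Sum>k\<in>UNIV. \<Sum>l\<in>UNIV. \<phi> k l (blinfun_apply T (axis k (axis l 1))))" .
    moreover have "g (f T) = T" using g(2) by (metis comp_apply id_apply)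
    moreover have "representation ?E T = representation (set ts) T"
      using T E ind sp by (intro real_vector.representation_extend) auto
    ultimately show ?thesis by (simp add: \<rho>_def)
  qed
  then show ?thesis using that bl by blast
qed

lemma norm_matrix_le_sum: "norm (A::real^'n^'m) \<le> (\<Sum>i\<in>UNIV. \<Sum>j\<in>UNIV. \<bar>A $ i $ j\<bar>)"
proof -
  have "norm A = L2_set (\<lambda>i. norm (A $ i)) UNIV" by (rule norm_vec_def)
  also have "\<dots> \<le> (\<Sum>i\<in>UNIV. norm (A $ i))" by (intro L2_set_le_sum) simp
  also have "\<dots> \<le> (\<Sum>i\<in>UNIV. \<Sum>j\<in>UNIV. \<bar>A $ i $ j\<bar>)" by (intro sum_mono norm_le_l1_cart)
  finally show ?thesis .
qed

lemma input_field_strain: "i < length bs \<Longrightarrow> input_field bs ts e C x i = representation (set bs) e (bs ! i)"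
  and input_field_stiffness: "m < length ts \<Longrightarrow> input_field bs ts e C x (length bs + m) = representation (set ts) (C x) (ts ! m)"
  by (simp_all add: input_field_def)

text \<open>The network must be fixed before the field is known, so \<open>R\<close> is built only
  from the norms of the coordinate functionals of \<open>ts\<close> and from |C A| \<le>
  \<open>\<alpha>p\<close> |A|.\<close>

lemma input_field_bounded:
  fixes ts :: "((real^'d^'d) \<Rightarrow>\<^sub>L (real^'d^'d)) list"
  assumes ts: "ordered_basis sym_sym ts" and \<alpha>: "0 < \<alpha>m" "\<alpha>m < \<alpha>p"
  obtains R where "0 < R"
    "\<And>L bs e C m. C \<in> stiffness_fields L \<alpha>m \<alpha>p \<Longrightarrow> m < length ts \<Longrightarrow>
      (\<lambda>x. input_field bs ts e C x (length bs + m)) \<in> borel_measurable (cellM L) \<and>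
      (AE x in cellM L. \<bar>input_field bs ts e C x (length bs + m)\<bar> \<le> R)"
proof -
  define good where "good m \<phi> \<longleftrightarrow> (\<forall>k l. bounded_linear (\<phi> k l)) \<and> (\<forall>T\<in>sym_sym. representation (set ts) T (ts ! m) =
      (\<Sum>k\<in>UNIV. \<Sum>l\<in>UNIV. \<phi> k l (blinfun_apply T (axis k (axis l 1)))))"
    for m and \<phi> :: "'d \<Rightarrow> 'd \<Rightarrow> real^'d^'d \<Rightarrow> real"
  have "\<exists>\<phi>. good m \<phi>" for m
    unfolding good_def by (rule coordinate_functionals[OF ts, of "ts ! m"]) blast
  then obtain \<phi> where "\<And>m. good m (\<phi> m)" by metis
  then have bl: "\<And>m k l. bounded_linear (\<phi> m k l)" and
    \<phi>: "\<And>m T. T \<in> sym_sym \<Longrightarrow> representation (set ts) T (ts ! m) =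
      (\<Sum>k\<in>UNIV. \<Sum>l\<in>UNIV. \<phi> m k l (blinfun_apply T (axis k (axis l 1))))"
    unfolding good_def by blast+
  have "\<exists>B. 0 \<le> B \<and> (\<forall>z. \<bar>\<phi> m k l z\<bar> \<le> norm z * B)" for m k l
    using bounded_linear.nonneg_bounded[OF bl[of m k l]] unfolding real_norm_def by blast
  then obtain B where B: "\<And>m k l. 0 \<le> B m k l" "\<And>m k l z. \<bar>\<phi> m k l z\<bar> \<le> norm z * B m k l" by metis
  define r where "r m = (\<Sum>k\<in>UNIV. \<Sum>l\<in>UNIV. \<alpha>p * B m k l)" for m
  have r: "0 \<le> r m" for m unfolding r_def using B(1) \<alpha> by (intro sum_nonneg mult_nonneg_nonneg) auto
  define R where "R = 1 + (\<Sum>m<length ts. r m)"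
  show ?thesis
  proof
    show "0 < R" unfolding R_def using r by (simp add: add_pos_nonneg sum_nonneg)
    fix L :: "real^'d" and bs :: "(real^'d^'d) list" and e C m
    assume C: "C \<in> stiffness_fields L \<alpha>m \<alpha>p" and m: "m < length ts"
    have Cs: "C x \<in> sym_sym" if "x \<in> cell L" for x using C that by (simp add: stiffness_fields_def)
    let ?s = "\<lambda>x. \<Sum>k\<in>UNIV. \<Sum>l\<in>UNIV. \<phi> m k l (blinfun_apply (C x) (axis k (axis l 1)))"
    have eq: "input_field bs ts e C x (length bs + m) = ?s x" if "x \<in> cell L" for x
      unfolding input_field_stiffness[OF m] by (rule \<phi>[OF Cs[OF that]])
    have "(\<lambda>x. blinfun_apply (C x) A) \<in> borel_measurable (cellM L)" for A
      using C by (intro measurable_blinfun_apply_const) (simp add: stiffness_fields_def)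
    then have "?s \<in> borel_measurable (cellM L)"
      by (intro borel_measurable_sum borel_measurable_continuous_on[OF linear_continuous_on[OF bl]])
    moreover have "(\<lambda>x. input_field bs ts e C x (length bs + m)) \<in> borel_measurable (cellM L) \<longleftrightarrow> ?s \<in> borel_measurable (cellM L)"
      by (intro measurable_cong eq) simp
    moreover have "AE x in cellM L. \<bar>input_field bs ts e C x (length bs + m)\<bar> \<le> R"
      using stiffness_admissible[OF C]
    proof eventually_elim
      fix x assume adm: "admissible \<alpha>m \<alpha>p (C x)"
      then have "C x \<in> sym_sym" by (simp add: admissible_def)
      from \<phi>[OF this, of m] have "\<bar>input_field bs ts e C x (length bs + m)\<bar> = \<bar>?s x\<bar>"
        by (simp only: input_field_stiffness[OF m])
      also have "\<dots> \<le> r m"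
        unfolding r_def
      proof (intro order_trans[OF sum_abs] sum_mono)
        fix k l
        have "norm (axis k (axis l 1) :: real^'d^'d) = 1" by (rule norm_Basis) simp
        then have "norm (blinfun_apply (C x) (axis k (axis l 1))) \<le> \<alpha>p"
          using admissible_norm_le[OF adm \<alpha>, of "axis k (axis l 1)"] by simp
        then have "norm (blinfun_apply (C x) (axis k (axis l 1))) * B m k l \<le> \<alpha>p * B m k l"
          by (rule mult_right_mono[OF _ B(1)])
        then show "\<bar>\<phi> m k l (blinfun_apply (C x) (axis k (axis l 1)))\<bar> \<le> \<alpha>p * B m k l"
          using B(2)[of m k l "blinfun_apply (C x) (axis k (axis l 1))"] by linarith
      qed
      also have "\<dots> \<le> R" unfolding R_def using m r member_le_sum[of m "{..<length ts}" r] by simp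
      finally show "\<bar>input_field bs ts e C x (length bs + m)\<bar> \<le> R" .
    qed
    ultimately show "(\<lambda>x. input_field bs ts e C x (length bs + m)) \<in> borel_measurable (cellM L) \<and>
      (AE x in cellM L. \<bar>input_field bs ts e C x (length bs + m)\<bar> \<le> R)" by blast
  qed
qed

section \<open>The approximating network\<close>

definition input_strain :: "(real^'d^'d) list \<Rightarrow> 'd \<Rightarrow> 'd \<Rightarrow> (real^'d \<Rightarrow> nat \<Rightarrow> real) \<Rightarrow> real^'d \<Rightarrow> real" where
  "input_strain bs k l a x = (\<Sum>n<length bs. (bs ! n) $ k $ l * a x n)"

text \<open>The expansion of C : (e + H) in coordinates of C and entries of e + H, with each product
  of the two replaced by \<open>mul_net\<close>. The entries of the basis tensors enter as fixed
  weights.\<close>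

definition net_stress :: "real \<Rightarrow> real \<Rightarrow> (real^'d^'d) list \<Rightarrow> ((real^'d^'d) \<Rightarrow>\<^sub>L (real^'d^'d)) list \<Rightarrow>
    ('d \<Rightarrow> 'd \<Rightarrow> (real^'d \<Rightarrow> nat \<Rightarrow> real) \<Rightarrow> real^'d \<Rightarrow> real) \<Rightarrow>
    'd \<Rightarrow> 'd \<Rightarrow> (real^'d \<Rightarrow> nat \<Rightarrow> real) \<Rightarrow> real^'d \<Rightarrow> real" where
  "net_stress R h bs ts H i j a x = (\<Sum>m<length ts. \<Sum>k\<in>UNIV. \<Sum>l\<in>UNIV.
     blinfun_apply (ts ! m) (axis k (axis l 1)) $ i $ j *
     mul_net R h (a x (length bs + m)) (input_strain bs k l a x + H k l a x))"

lemma input_strain_input_field: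
  assumes bs: "ordered_basis sym_mats bs" and e: "e \<in> sym_mats"
  shows "input_strain bs k l (input_field bs ts e C) x = e $ k $ l"
proof -
  have "e $ k $ l = (\<Sum>n<length bs. representation (set bs) e (bs ! n) *\<^sub>R bs ! n) $ k $ l"
    by (simp only: ordered_basis_expansion[OF bs e])
  also have "\<dots> = (\<Sum>n<length bs. representation (set bs) e (bs ! n) * (bs ! n) $ k $ l)"
    by (simp add: sum_component)
  finally show ?thesis
    by (simp add: input_strain_def input_field_strain mult.commute)
qed

lemma stiffness_component:
  assumes ts: "ordered_basis sym_sym ts" and T: "C x \<in> sym_sym"
  shows "blinfun_apply (C x) A $ i $ j = (\<Sum>m<length ts. \<Sum>k\<in>UNIV. \<Sum>l\<in>UNIV.
     blinfun_apply (ts ! m) (axis k (axis l 1)) $ i $ j * (input_field bs ts e C x (length bs + m) * A $ k $ l))"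
proof -
  have "blinfun_apply (C x) A = blinfun_apply (\<Sum>m<length ts. representation (set ts) (C x) (ts ! m) *\<^sub>R ts ! m) A"
    by (simp only: ordered_basis_expansion[OF ts T])
  also have "\<dots> = (\<Sum>m<length ts. representation (set ts) (C x) (ts ! m) *\<^sub>R blinfun_apply (ts ! m) A)"
    by (simp only: blinfun.sum_left blinfun.scaleR_left)
  finally have "blinfun_apply (C x) A $ i $ j = (\<Sum>m<length ts. representation (set ts) (C x) (ts ! m) * blinfun_apply (ts ! m) A $ i $ j)"
    by (simp add: sum_component)
  also have "\<dots> = (\<Sum>m<length ts. \<Sum>k\<in>UNIV. \<Sum>l\<in>UNIV.
     blinfun_apply (ts ! m) (axis k (axis l 1)) $ i $ j * (input_field bs ts e C x (length bs + m) * A $ k $ l))"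
  proof (intro sum.cong refl)
    fix m assume "m \<in> {..<length ts}"
    then have m: "input_field bs ts e C x (length bs + m) = representation (set ts) (C x) (ts ! m)"
      by (intro input_field_stiffness) simp
    have "blinfun_apply (ts ! m) A $ i $ j = (\<Sum>k\<in>UNIV. \<Sum>l\<in>UNIV. A $ k $ l * blinfun_apply (ts ! m) (axis k (axis l 1)) $ i $ j)"
      by (subst blinfun_matrix_expansion) (simp add: sum_component)
    then show "representation (set ts) (C x) (ts ! m) * blinfun_apply (ts ! m) A $ i $ j = (\<Sum>k\<in>UNIV. \<Sum>l\<in>UNIV.
       blinfun_apply (ts ! m) (axis k (axis l 1)) $ i $ j * (input_field bs ts e C x (length bs + m) * A $ k $ l))"
      by (simp only: m sum_distrib_left mult_ac)
  qed
  finally show ?thesis .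
qed

text \<open>Each product contributes at most 8 R h times its weight, whatever the size of
  \<open>H\<close>. The bound is therefore pointwise, and the iterates may be unbounded.\<close>

lemma net_stress_error:
  assumes bs: "ordered_basis sym_mats bs" and ts: "ordered_basis sym_sym ts" and e: "e \<in> sym_mats"
    and T: "C x \<in> sym_sym" and R: "0 < R" and h: "0 < h"
    and c: "\<And>m. m < length ts \<Longrightarrow> \<bar>input_field bs ts e C x (length bs + m)\<bar> \<le> R"
  shows "norm ((\<chi> i j. net_stress R h bs ts H i j (input_field bs ts e C) x)
      - blinfun_apply (C x) (e + (\<chi> k l. H k l (input_field bs ts e C) x))) \<le>
    (\<Sum>i\<in>UNIV. \<Sum>j\<in>UNIV. \<Sum>m<length ts. \<Sum>k\<in>UNIV. \<Sum>l\<in>UNIV.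
      \<bar>blinfun_apply (ts ! m) (axis k (axis l 1)) $ i $ j\<bar> * (8 * R)) * h"
proof -
  let ?a = "input_field bs ts e C"
  have "\<bar>net_stress R h bs ts H i j ?a x - blinfun_apply (C x) (e + (\<chi> k l. H k l ?a x)) $ i $ j\<bar> \<le>
      (\<Sum>m<length ts. \<Sum>k\<in>UNIV. \<Sum>l\<in>UNIV. \<bar>blinfun_apply (ts ! m) (axis k (axis l 1)) $ i $ j\<bar> * (8 * R)) * h" for i j
  proof -
    have "net_stress R h bs ts H i j ?a x - blinfun_apply (C x) (e + (\<chi> k l. H k l ?a x)) $ i $ j =
      (\<Sum>m<length ts. \<Sum>k\<in>UNIV. \<Sum>l\<in>UNIV. blinfun_apply (ts ! m) (axis k (axis l 1)) $ i $ j *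
        (mul_net R h (?a x (length bs + m)) (e $ k $ l + H k l ?a x) - ?a x (length bs + m) * (e $ k $ l + H k l ?a x)))"
      unfolding stiffness_component[where C=C and x=x and bs=bs and e=e and i=i and j=j, OF ts T]
      by (simp add: net_stress_def input_strain_input_field[OF bs e] sum_subtractf right_diff_distrib)
    also have "\<bar>\<dots>\<bar> \<le> (\<Sum>m<length ts. \<Sum>k\<in>UNIV. \<Sum>l\<in>UNIV. \<bar>blinfun_apply (ts ! m) (axis k (axis l 1)) $ i $ j\<bar> * (8 * R * h))"
    proof (intro order_trans[OF sum_abs] sum_mono)
      fix m k l assume "m \<in> {..<length ts}"
      then have "\<bar>mul_net R h (?a x (length bs + m)) (e $ k $ l + H k l ?a x) - ?a x (length bs + m) * (e $ k $ l + H k l ?a x)\<bar> \<le> 8 * R * h"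
        using c by (intro mul_net_error R h) simp
      then show "\<bar>blinfun_apply (ts ! m) (axis k (axis l 1)) $ i $ j *
        (mul_net R h (?a x (length bs + m)) (e $ k $ l + H k l ?a x) - ?a x (length bs + m) * (e $ k $ l + H k l ?a x))\<bar>
        \<le> \<bar>blinfun_apply (ts ! m) (axis k (axis l 1)) $ i $ j\<bar> * (8 * R * h)"
        unfolding abs_mult by (intro mult_left_mono) auto
    qed
    also have "\<dots> = (\<Sum>m<length ts. \<Sum>k\<in>UNIV. \<Sum>l\<in>UNIV. \<bar>blinfun_apply (ts ! m) (axis k (axis l 1)) $ i $ j\<bar> * (8 * R)) * h"
      by (simp only: sum_distrib_right mult.assoc)
    finally show ?thesis .
  qed
  then have "(\<Sum>i\<in>UNIV. \<Sum>j\<in>UNIV. \<bar>net_stress R h bs ts H i j ?a x - blinfun_apply (C x) (e + (\<chi> k l. H k l ?a x)) $ i $ j\<bar>) \<le>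
      (\<Sum>i\<in>UNIV. \<Sum>j\<in>UNIV. (\<Sum>m<length ts. \<Sum>k\<in>UNIV. \<Sum>l\<in>UNIV. \<bar>blinfun_apply (ts ! m) (axis k (axis l 1)) $ i $ j\<bar> * (8 * R)) * h)"
    by (intro sum_mono)
  then show ?thesis
    using norm_matrix_le_sum[of "(\<chi> i j. net_stress R h bs ts H i j ?a x) - blinfun_apply (C x) (e + (\<chi> k l. H k l ?a x))"]
    by (simp add: sum_distrib_right)
qed

section \<open>The iteration as a network and its error\<close>

sublocale periodic_cell \<subseteq> sigma: activated_cell L sigma
  by unfold_locales (rule continuous_sigma, rule abs_sigma_le)

context periodic_cell
begin

lemma comp_tri: "sigma.comp da f \<Longrightarrow> sigma.comp da (\<lambda>a x. tri (f a x))"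
  unfolding tri_from_sigma
  by (intro sigma.comp_diff sigma.comp_act sigma.comp_add sigma.comp_const)

lemma comp_mul_net:
  assumes f: "sigma.comp da f" and g: "sigma.comp da g"
  shows "sigma.comp da (\<lambda>a x. mul_net R h (f a x) (g a x))"
  unfolding mul_net_def mul_core_def
  by (intro sigma.comp_diff sigma.comp_act sigma.comp_add sigma.comp_const sigma.comp_scale comp_tri f g)

lemma comp_net_stress:
  assumes H: "\<And>k l. sigma.comp (length bs + length ts) (H k l)"
  shows "sigma.comp (length bs + length ts) (net_stress R h bs ts H i j)"
proof -
  have "sigma.comp (length bs + length ts) (input_strain bs k l)" for k l
    unfolding input_strain_def[abs_def] by (intro sigma.comp_sum sigma.comp_scale sigma.comp_input) auto
  then show ?thesis
    unfolding net_stress_def[abs_def]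
    by (intro sigma.comp_sum sigma.comp_scale comp_mul_net sigma.comp_add sigma.comp_input H) auto
qed

text \<open>Written entry by entry, with each entry a scalar operator on the input field, so that
  every stage is an expression of \<open>sigma.comp\<close>; \<open>net_grad_Suc_proj\<close>
  recovers the matrix form.\<close>

primrec net_grad :: "real \<Rightarrow> real \<Rightarrow> real \<Rightarrow> (real^'d^'d) list \<Rightarrow> ((real^'d^'d) \<Rightarrow>\<^sub>L (real^'d^'d)) list \<Rightarrow>
    nat \<Rightarrow> 'd \<Rightarrow> 'd \<Rightarrow> (real^'d \<Rightarrow> nat \<Rightarrow> real) \<Rightarrow> real^'d \<Rightarrow> real" where
  "net_grad \<gamma> R h bs ts 0 = (\<lambda>i l a x. 0)"
| "net_grad \<gamma> R h bs ts (Suc n) = (\<lambda>i l a x. \<Sum>j\<in>UNIV. mult (grad_proj j l)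
     (\<lambda>x. net_grad \<gamma> R h bs ts n i j a x - \<gamma> * net_stress R h bs ts (net_grad \<gamma> R h bs ts n) i j a x) x)"

lemma comp_net_grad: "sigma.comp (length bs + length ts) (net_grad \<gamma> R h bs ts n i l)"
proof (induction n arbitrary: i l)
  case (Suc n)
  have "sigma.comp (length bs + length ts) (\<lambda>a x. net_grad \<gamma> R h bs ts n i j a x - \<gamma> * net_stress R h bs ts (net_grad \<gamma> R h bs ts n) i j a x)" for j
    by (intro sigma.comp_diff sigma.comp_scale comp_net_stress Suc)
  from sigma.comp_mult[OF this multiplier_grad_proj]
  show ?case unfolding net_grad.simps by (rule sigma.comp_sum)
qed (simp add: sigma.comp_const)

lemma net_grad_Suc_proj:
  "(\<lambda>x. \<chi> i l. net_grad \<gamma> R h bs ts (Suc n) i l a x) = proj (\<lambda>x. (\<chi> i l. net_grad \<gamma> R h bs ts n i l a x)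
     - \<gamma> *\<^sub>R (\<chi> i l. net_stress R h bs ts (net_grad \<gamma> R h bs ts n) i l a x))"
  by (simp add: fun_eq_iff vec_eq_iff proj_def)

text \<open>The recursion d' \<le> q d + c has the stationary value c / (1 - q), and the distance of
  the zero field to \<open>G\<close> is bounded by \<open>gradient_a_priori\<close>.\<close>

lemma net_grad_error:
  assumes C: "C \<in> stiffness_fields L \<alpha>m \<alpha>p" and \<alpha>: "0 < \<alpha>m" "\<alpha>m < \<alpha>p" and G: "gradient_type G"
    and fixp: "AE x in cellM L. proj (\<lambda>x. G x - (1 / \<alpha>p) *\<^sub>R blinfun_apply (C x) (e + G x)) x = G x"
    and sq: "\<And>i l n. sq_integrable L (net_grad (1 / \<alpha>p) R h bs ts n i l a)"
    and sqM: "\<And>i l n. sq_integrable L (net_stress R h bs ts (net_grad (1 / \<alpha>p) R h bs ts n) i l a)"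
    and err: "\<And>n. AE x in cellM L. norm ((\<chi> i j. net_stress R h bs ts (net_grad (1 / \<alpha>p) R h bs ts n) i j a x)
      - blinfun_apply (C x) (e + (\<chi> k l. net_grad (1 / \<alpha>p) R h bs ts n k l a x))) \<le> \<eta>"
  defines "q \<equiv> sqrt (1 - \<alpha>m / (2 * \<alpha>p))"
  shows "l2 L (\<lambda>x. (\<chi> i l. net_grad (1 / \<alpha>p) R h bs ts n i l a x) - G x) \<le>
    norm e * sqrt vol / (1 - q) * q ^ n + 1 / \<alpha>p * (\<eta> * sqrt vol) / (1 - q)"
proof -
  have q: "0 \<le> q" "q < 1" unfolding q_def by (rule contraction_factor[OF \<alpha>])+
  have sG: "sq_integrable L G" using G by (simp only: gradient_type_def)
  define H where "H n x = (\<chi> i l. net_grad (1 / \<alpha>p) R h bs ts n i l a x)" for n x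
  define M where "M n x = (\<chi> i l. net_stress R h bs ts (net_grad (1 / \<alpha>p) R h bs ts n) i l a x)" for n x
  have H_Suc: "H (Suc n) = proj (\<lambda>x. H n x - (1 / \<alpha>p) *\<^sub>R M n x)" for n
    unfolding H_def[abs_def] M_def by (rule net_grad_Suc_proj)
  have sH: "sq_integrable L (H n)" for n
    by (rule sq_integrable_componentwise2) (simp add: H_def sq)
  have sM: "sq_integrable L (M n)" for n
    by (rule sq_integrable_componentwise2) (simp add: M_def sqM)
  have H0: "H 0 = (\<lambda>_. 0)" by (simp add: fun_eq_iff H_def vec_eq_iff)
  have gH: "gradient_type (H n)" for n
  proof (cases n)
    case 0
    then show ?thesis by (simp add: H0 gradient_type_0)
  next
    case (Suc m)
    then show ?thesis unfolding Suc H_Suc by (intro gradient_type_proj sq_integrable_diff sq_integrable_scaleR sH sM)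
  qed
  define c where "c = 1 / \<alpha>p * (\<eta> * sqrt vol)"
  have step: "l2 L (\<lambda>x. H (Suc n) x - G x) \<le> q * l2 L (\<lambda>x. H n x - G x) + c" for n
  proof -
    have "l2 L (\<lambda>x. H (Suc n) x - G x) \<le> q * l2 L (\<lambda>x. H n x - G x) + 1 / \<alpha>p * l2 L (\<lambda>x. M n x - blinfun_apply (C x) (e + H n x))"
      unfolding H_Suc q_def by (rule iteration_step[OF C \<alpha> G gH sM fixp])
    also have "l2 L (\<lambda>x. M n x - blinfun_apply (C x) (e + H n x)) \<le> \<eta> * sqrt vol"
    proof (rule l2_le_of_AE_bound)
      show "sq_integrable L (\<lambda>x. M n x - blinfun_apply (C x) (e + H n x))"
        by (intro sq_integrable_diff sM sq_integrable_stiffness[OF C \<alpha>] sq_integrable_add sq_integrable_const sH)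
      show "AE x in cellM L. norm (M n x - blinfun_apply (C x) (e + H n x)) \<le> \<eta>"
        unfolding M_def H_def by (rule err)
    qed
    finally show ?thesis using \<alpha> by (simp add: c_def divide_right_mono)
  qed
  have "l2 L (\<lambda>x. H n x - G x) \<le> norm e * sqrt vol / (1 - q) * q ^ n + c / (1 - q)"
  proof (induction n)
    case 0
    have "(1 - q) * l2 L G \<le> norm e * sqrt vol"
      unfolding q_def by (rule gradient_a_priori[OF C \<alpha> G fixp])
    then have 1: "l2 L G \<le> norm e * sqrt vol / (1 - q)" using q by (simp add: field_simps)
    \<comment> \<open>The nonnegativity of \<open>c\<close> is read off from the fact that its
      factor \<open>\<eta> * sqrt vol\<close> bounds a norm.\<close>
    have "0 \<le> l2 L (\<lambda>x. M 0 x - blinfun_apply (C x) (e + H 0 x))" by simp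
    also have "\<dots> \<le> \<eta> * sqrt vol"
    proof (rule l2_le_of_AE_bound)
      show "sq_integrable L (\<lambda>x. M 0 x - blinfun_apply (C x) (e + H 0 x))"
        by (intro sq_integrable_diff sM sq_integrable_stiffness[OF C \<alpha>] sq_integrable_add sq_integrable_const sH)
      show "AE x in cellM L. norm (M 0 x - blinfun_apply (C x) (e + H 0 x)) \<le> \<eta>"
        unfolding M_def H_def by (rule err)
    qed
    finally have "0 \<le> \<eta> * sqrt vol" .
    moreover have "0 \<le> 1 / \<alpha>p" using \<alpha> by simp
    ultimately have "0 \<le> c" unfolding c_def by (rule mult_nonneg_nonneg[rotated])
    then have "0 \<le> c / (1 - q)" using q by simp
    then show ?case using 1 by (simp add: H0)
  next
    case (Suc n)
    have "l2 L (\<lambda>x. H (Suc n) x - G x) \<le> q * (norm e * sqrt vol / (1 - q) * q ^ n + c / (1 - q)) + c"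
      using step[of n] mult_left_mono[OF Suc q(1)] by linarith
    also have "\<dots> = norm e * sqrt vol / (1 - q) * q ^ Suc n + (q * (c / (1 - q)) + c)"
      by (simp add: distrib_left)
    also have "q * (c / (1 - q)) + c = c / (1 - q)" using q by (simp add: field_simps)
    finally show ?case .
  qed
  then show ?thesis by (simp only: H_def c_def)
qed

lemma input_field_sq_integrable:
  assumes bounded: "\<And>m. m < length ts \<Longrightarrow>
      (\<lambda>x. input_field bs ts e C x (length bs + m)) \<in> borel_measurable (cellM L) \<and>
      (AE x in cellM L. \<bar>input_field bs ts e C x (length bs + m)\<bar> \<le> R)"
    and i: "i < length bs + length ts"
  shows "sq_integrable L (\<lambda>x. input_field bs ts e C x i)"
proof (cases "i < length bs")
  case True
  then show ?thesis by (simp add: input_field_strain)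
next
  case False
  then obtain m where m: "i = length bs + m" "m < length ts"
    using i by (metis add_less_cancel_left le_Suc_ex linorder_not_less)
  show ?thesis unfolding m(1)
    using bounded[OF m(2)] by (intro sq_integrable_bounded[where B=R]) auto
qed

text \<open>The bound \<open>R\<close>, the scale \<open>h\<close> and the number of steps
  \<open>n\<close> are chosen before \<open>e\<close> and \<open>C\<close>; one network therefore
  serves the whole class.\<close>

lemma fno_approximation:
  fixes bs :: "(real^'d^'d) list"
  assumes \<alpha>: "0 < \<alpha>m" "\<alpha>m < \<alpha>p" and \<epsilon>0: "0 < \<epsilon>0" and \<delta>: "0 < \<delta>"
    and bs: "ordered_basis sym_mats bs" and ts: "ordered_basis sym_sym ts"
  shows "\<exists>F :: (real^'d \<Rightarrow> nat \<Rightarrow> real) \<Rightarrow> real^'d \<Rightarrow> real^'d.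
    fno sigma L (length bs + length ts) F \<and>
    (\<forall>e\<in>sym_mats. \<forall>C\<in>stiffness_fields L \<alpha>m \<alpha>p.
      F (input_field bs ts e C) \<in> H1_per0 L \<and>
      unique_corrector_solution L e C (solution_op L e C)) \<and>
    (\<forall>e\<in>sym_mats. \<forall>C\<in>stiffness_fields L \<alpha>m \<alpha>p. norm e \<le> \<epsilon>0 \<longrightarrow>
      H1_norm L (\<lambda>x. F (input_field bs ts e C) x - solution_op L e C x) \<le> \<delta>)"
proof -
  obtain R where R: "0 < R" and bounded: "\<And>bs e C m. C \<in> stiffness_fields L \<alpha>m \<alpha>p \<Longrightarrow> m < length ts \<Longrightarrow>
      (\<lambda>x. input_field bs ts e C x (length bs + m)) \<in> borel_measurable (cellM L) \<and>
      (AE x in cellM L. \<bar>input_field bs ts e C x (length bs + m)\<bar> \<le> R)"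
    using input_field_bounded[OF ts \<alpha>] by metis
  define q where "q = sqrt (1 - \<alpha>m / (2 * \<alpha>p))"
  have q: "0 \<le> q" "q < 1" unfolding q_def by (rule contraction_factor[OF \<alpha>])+
  define \<kappa> where "\<kappa> = (\<Sum>i\<in>(UNIV::'d set). \<Sum>j\<in>(UNIV::'d set). \<Sum>m<length ts. \<Sum>k\<in>UNIV. \<Sum>l\<in>UNIV.
      \<bar>blinfun_apply (ts ! m) (axis k (axis l 1)) $ i $ j\<bar> * (8 * R))"
  have \<kappa>: "0 \<le> \<kappa>" unfolding \<kappa>_def using R by (intro sum_nonneg mult_nonneg_nonneg) auto
  define P where "P = sqrt (poincare + 1)"
  have P: "0 \<le> P" unfolding P_def using poincare_nonneg by simp
  \<comment> \<open>\<open>a0\<close> and \<open>c0\<close> are the coefficients of q^n and of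
    \<open>h\<close> in the final H^1 bound, and \<open>n\<close> and \<open>h\<close> make each of
    the two contributions at most half of \<open>\<delta>\<close>. Adding 1 in the denominators
    covers the case of a zero coefficient.\<close>
  define a0 where "a0 = P * (\<epsilon>0 * sqrt vol / (1 - q))"
  define c0 where "c0 = P * (1 / \<alpha>p * (\<kappa> * sqrt vol) / (1 - q))"
  have a0: "0 \<le> a0" unfolding a0_def using P q \<epsilon>0 by simp
  have c0: "0 \<le> c0" unfolding c0_def using P q \<alpha> \<kappa> by simp
  define h where "h = \<delta> / (2 * (c0 + 1))"
  have h: "0 < h" "c0 * h \<le> \<delta> / 2" using \<delta> c0 by (simp_all add: h_def field_simps)
  have "0 < \<delta> / (2 * (a0 + 1))" using \<delta> a0 by simp
  then obtain n where "q ^ n < \<delta> / (2 * (a0 + 1))" using real_arch_pow_inv[OF _ q(2)] by blast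
  then have "a0 * q ^ n \<le> a0 * (\<delta> / (2 * (a0 + 1)))" using a0 by (intro mult_left_mono) auto
  also have "\<dots> \<le> \<delta> / 2" using a0 \<delta> by (simp add: field_simps)
  finally have n: "a0 * q ^ n \<le> \<delta> / 2" .
  let ?H = "net_grad (1 / \<alpha>p) R h bs ts"
  define F where "F a x = (\<chi> i::'d. fourier_sum L (\<lambda>\<xi>. \<Sum>j\<in>UNIV. potential \<xi> j * fourier_coeff L (?H n i j a) \<xi>) x)" for a x
  have fno: "fno sigma L (length bs + length ts) F"
    unfolding F_def[abs_def] by (rule sigma.fno_of_comp[OF comp_net_grad])
  have main: "F (input_field bs ts e C) \<in> H1_per0 L \<and> unique_corrector_solution L e C (solution_op L e C) \<and>
      (norm e \<le> \<epsilon>0 \<longrightarrow> H1_norm L (\<lambda>x. F (input_field bs ts e C) x - solution_op L e C x) \<le> \<delta>)"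
    if e: "e \<in> sym_mats" and C: "C \<in> stiffness_fields L \<alpha>m \<alpha>p" for e C
  proof -
    define a where "a = input_field bs ts e C"
    have sa: "sq_integrable L (\<lambda>x. a x i)" if "i < length bs + length ts" for i
      unfolding a_def by (rule input_field_sq_integrable[OF bounded[OF C] that])
    have sq: "sq_integrable L (?H n i l a)" for n i l
      by (rule sigma.comp_sq_integrable[OF comp_net_grad sa])
    have sqM: "sq_integrable L (net_stress R h bs ts (?H n) i l a)" for n i l
      by (rule sigma.comp_sq_integrable[OF comp_net_stress[OF comp_net_grad] sa])
    have bd: "AE x in cellM L. \<forall>m\<in>{..<length ts}. \<bar>input_field bs ts e C x (length bs + m)\<bar> \<le> R"
      using bounded[OF C] by (intro AE_finite_allI) auto
    have err: "AE x in cellM L. norm ((\<chi> i j. net_stress R h bs ts (?H n) i j a x)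
      - blinfun_apply (C x) (e + (\<chi> k l. ?H n k l a x))) \<le> \<kappa> * h" for n
      using bd stiffness_admissible[OF C] unfolding a_def \<kappa>_def
      by eventually_elim (intro net_stress_error bs ts e R h, auto simp: admissible_def)
    obtain G where G: "gradient_type G"
      and fixp: "AE x in cellM L. proj (\<lambda>x. G x - (1 / \<alpha>p) *\<^sub>R blinfun_apply (C x) (e + G x)) x = G x"
      using fixed_point_exists[OF C \<alpha>] by blast
    have sG: "sq_integrable L G" using G by (simp only: gradient_type_def)
    define Hn where "Hn x = (\<chi> i l. ?H n i l a x)" for x
    have sHn: "sq_integrable L Hn" by (rule sq_integrable_componentwise2) (simp add: Hn_def sq)
    have sF: "sq_integrable L (F a)" and cF: "\<And>i \<xi>. fourier_coeff L (\<lambda>x. F a x $ i) \<xi> =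
        (\<Sum>j\<in>UNIV. potential \<xi> j * fourier_coeff L (\<lambda>x. Hn x $ i $ j) \<xi>)"
      using sigma.fno_output_coeff[of "\<lambda>i j. ?H n i j a", OF sq] by (simp_all add: F_def[abs_def] Hn_def)
    have uniq: "unique_corrector_solution L e C (solution_op L e C)"
      by (rule unique_solution_op[OF C \<alpha> G fixp])
    then have "solution_op L e C \<in> H1_per0 L"
      by (simp add: unique_corrector_solution_def corrector_solution_def)
    then have sS: "sq_integrable L (solution_op L e C)" by (simp add: H1_per0_def sq_integrable_H1)
    have "H1_norm L (\<lambda>x. F a x - solution_op L e C x) \<le> \<delta>" if ne: "norm e \<le> \<epsilon>0"
    proof -
      have "l2 L (\<lambda>x. Hn x - G x) \<le> norm e * sqrt vol / (1 - q) * q ^ n + 1 / \<alpha>p * ((\<kappa> * h) * sqrt vol) / (1 - q)"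
        unfolding Hn_def q_def by (rule net_grad_error[OF C \<alpha> G fixp sq sqM err])
      also have "\<dots> \<le> \<epsilon>0 * sqrt vol / (1 - q) * q ^ n + 1 / \<alpha>p * ((\<kappa> * h) * sqrt vol) / (1 - q)"
        using ne q vol_pos by (intro add_right_mono mult_right_mono divide_right_mono) auto
      finally have le: "l2 L (\<lambda>x. Hn x - G x) \<le> \<epsilon>0 * sqrt vol / (1 - q) * q ^ n + 1 / \<alpha>p * ((\<kappa> * h) * sqrt vol) / (1 - q)" .
      have "H1_norm L (\<lambda>x. F a x - solution_op L e C x) \<le> P * l2 L (\<lambda>x. Hn x - G x)"
        unfolding P_def by (rule H1_error_le[OF sF sS sHn sG cF solution_op_potential_field[OF C \<alpha> G fixp]])
      also have "\<dots> \<le> P * (\<epsilon>0 * sqrt vol / (1 - q) * q ^ n + 1 / \<alpha>p * ((\<kappa> * h) * sqrt vol) / (1 - q))"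
        by (rule mult_left_mono[OF le P])
      also have "\<dots> = a0 * q ^ n + c0 * h"
        by (simp add: a0_def c0_def algebra_simps)
      also have "\<dots> \<le> \<delta>" using n h(2) by linarith
      finally show ?thesis .
    qed
    moreover have "F a \<in> H1_per0 L" by (rule potential_H1(1)[OF sF sHn cF])
    ultimately show ?thesis using uniq unfolding a_def by blast
  qed
  show ?thesis using fno main by (intro exI[of _ F]) blast
qed

end

theorem theorem1p1:
  shows "\<exists>\<sigma> :: real \<Rightarrow> real. continuous_on UNIV \<sigma> \<and>
    (\<forall>(L :: real^'d) (\<alpha>m :: real) (\<alpha>p :: real) (\<epsilon>0 :: real) (\<delta> :: real)
      (bs :: (real^'d^'d) list) (ts :: ((real^'d^'d) \<Rightarrow>\<^sub>L (real^'d^'d)) list).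
      (\<forall>i. 0 < L $ i) \<and> 0 < \<alpha>m \<and> \<alpha>m < \<alpha>p \<and> 0 < \<epsilon>0 \<and> 0 < \<delta> \<and>
      ordered_basis sym_mats bs \<and> ordered_basis sym_sym ts \<longrightarrow>
      (\<exists>F :: (real^'d \<Rightarrow> nat \<Rightarrow> real) \<Rightarrow> real^'d \<Rightarrow> real^'d.
        fno \<sigma> L (dim (sym_mats :: (real^'d^'d) set) +
                 dim (sym_sym :: ((real^'d^'d) \<Rightarrow>\<^sub>L (real^'d^'d)) set)) F \<and>
        (\<forall>e\<in>sym_mats. \<forall>C\<in>stiffness_fields L \<alpha>m \<alpha>p.
          F (input_field bs ts e C) \<in> H1_per0 L \<and>
          unique_corrector_solution L e C (solution_op L e C)) \<and>
        (\<forall>e\<in>sym_mats. \<forall>C\<in>stiffness_fields L \<alpha>m \<alpha>p. norm e \<le> \<epsilon>0 \<longrightarrow>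
          H1_norm L (\<lambda>x. F (input_field bs ts e C) x - solution_op L e C x) \<le> \<delta>)))"
proof (intro exI[of _ sigma] conjI continuous_sigma allI impI, elim conjE)
  fix L :: "real^'d" and \<alpha>m \<alpha>p \<epsilon>0 \<delta> :: real
    and bs :: "(real^'d^'d) list" and ts :: "((real^'d^'d) \<Rightarrow>\<^sub>L (real^'d^'d)) list"
  assume *: "\<forall>i. 0 < L $ i" "0 < \<alpha>m" "\<alpha>m < \<alpha>p" "0 < \<epsilon>0" "0 < \<delta>"
    "ordered_basis sym_mats bs" "ordered_basis sym_sym ts"
  interpret periodic_cell L using *(1) by unfold_locales blast
  show "\<exists>F :: (real^'d \<Rightarrow> nat \<Rightarrow> real) \<Rightarrow> real^'d \<Rightarrow> real^'d.
        fno sigma L (dim (sym_mats :: (real^'d^'d) set) +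
                 dim (sym_sym :: ((real^'d^'d) \<Rightarrow>\<^sub>L (real^'d^'d)) set)) F \<and>
        (\<forall>e\<in>sym_mats. \<forall>C\<in>stiffness_fields L \<alpha>m \<alpha>p.
          F (input_field bs ts e C) \<in> H1_per0 L \<and>
          unique_corrector_solution L e C (solution_op L e C)) \<and>
        (\<forall>e\<in>sym_mats. \<forall>C\<in>stiffness_fields L \<alpha>m \<alpha>p. norm e \<le> \<epsilon>0 \<longrightarrow>
          H1_norm L (\<lambda>x. F (input_field bs ts e C) x - solution_op L e C x) \<le> \<delta>)"
    using fno_approximation[OF *(2-7)]
    by (simp only: ordered_basis_length[OF *(6)] ordered_basis_length[OF *(7)])
qed

end
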